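(* Let $c>0$ and let $M$ be a compact connected spacelike biconservative surface in the 3-dimensional de Sitter space $\mathbb{S}_1^3(c)$. Then $M$ is totally umbilical.
   Context: De Sitter space: $\mathbb{R}_1^{4}$ is $\mathbb{R}^{4}$ with the metric $\langle v,w\rangle=-v_0w_0+\sum_{i=1}^{3}v_iw_i$, and $\mathbb{S}_1^{3}(c)=\{x\in\mathbb{R}_1^{4}:\langle x,x\rangle=1/c\}$ with the induced Lorentzian metric, which has constant sectional curvature $c>0$. A surface in $\mathbb{S}_1^3(c)$ is an immersed 2-dimensional manifold $M$; it is spacelike if the induced metric is positive definite, equivalently if its unit normal field $\eta$ satisfies $\langle\eta,\eta\rangle=-1$. With $\bar\nabla$ and $\nabla$ the Levi-Civita connections of the ambient space and of $M$, the shape operator $A=A_\eta$ is defined by $\bar\nabla_v\eta=-Av$, so $\bar\nabla_vw-\nabla_vw=-\langle Av,w\rangle\eta$. The mean curvature function $f$ is defined by $\operatorname{trace}A=-2f$, i.e. the mean curvature vector is $H=f\eta$. The spacelike surface $M$ is biconservative if $A(\operatorname{grad}f)=f\operatorname{grad}f$ on $M$. It is totally umbilical if $A$ is a multiple of the identity at every point. *)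

theory Defs
  imports "HOL-Analysis.Analysis"
begin

subsection \<open>Smooth maps\<close>

text \<open>Used for open \<open>S\<close> in a finite-dimensional space.\<close>

primrec Ck_on :: "nat \<Rightarrow> 'a::real_normed_vector set \<Rightarrow> ('a \<Rightarrow> 'b::real_normed_vector) \<Rightarrow> bool" where
  "Ck_on 0 S f \<longleftrightarrow> continuous_on S f"
| "Ck_on (Suc k) S f \<longleftrightarrow>
     f differentiable_on S \<and> (\<forall>v. Ck_on k S (\<lambda>u. frechet_derivative f (at u) v))"

definition smooth_on :: "'a::real_normed_vector set \<Rightarrow> ('a \<Rightarrow> 'b::real_normed_vector) \<Rightarrow> bool" where
  "smooth_on S f \<longleftrightarrow> (\<forall>k. Ck_on k S f)"


subsection \<open>Smooth surfaces (two-dimensional manifolds without boundary)\<close>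

type_synonym 'm chart = "'m set \<times> ('m \<Rightarrow> real^2)"

text \<open>A chart is a pair \<open>(U, \<phi>)\<close>. Its inverse, the local parametrization of \<open>U\<close>, is
  \<open>inv_into U \<phi>\<close>, defined on the open set \<open>\<phi> ` U\<close>.\<close>

definition surface_chart :: "'m topology \<Rightarrow> 'm chart \<Rightarrow> bool" where
  "surface_chart M = (\<lambda>(U, \<phi>). openin M U \<and> open (\<phi> ` U) \<and>
     homeomorphic_map (subtopology M U) (top_of_set (\<phi> ` U)) \<phi>)"

definition smooth_surface :: "'m topology \<Rightarrow> 'm chart set \<Rightarrow> bool" where
  "smooth_surface M \<A> \<longleftrightarrow>
     Hausdorff_space M \<and> second_countable M \<and>
     (\<forall>\<kappa>\<in>\<A>. surface_chart M \<kappa>) \<and> (\<Union>(fst ` \<A>)) = topspace M \<and>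
     (\<forall>(U, \<phi>)\<in>\<A>. \<forall>(V, \<psi>)\<in>\<A>. smooth_on (\<phi> ` (U \<inter> V)) (\<psi> \<circ> inv_into U \<phi>))"

text \<open>Smoothness of \<open>h\<close> on an open subset \<open>W\<close> of the surface.\<close>

definition smooth_on_surface ::
    "'m chart set \<Rightarrow> 'm set \<Rightarrow> ('m \<Rightarrow> 'b::real_normed_vector) \<Rightarrow> bool" where
  "smooth_on_surface \<A> W h \<longleftrightarrow>
     (\<forall>(U, \<phi>)\<in>\<A>. smooth_on (\<phi> ` (U \<inter> W)) (h \<circ> inv_into U \<phi>))"


subsection \<open>De Sitter space and its Levi-Civita connection\<close>

text \<open>The index type \<open>4\<close> has the elements \<open>0, 1, 2, 3\<close>.\<close>

definition lorentz :: "real^4 \<Rightarrow> real^4 \<Rightarrow> real" where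
  "lorentz v w = - (v $ 0 * w $ 0) + (\<Sum>i\<in>{1, 2, 3}. v $ i * w $ i)"

definition de_sitter :: "real \<Rightarrow> (real^4) set" where
  "de_sitter c = {x. lorentz x x = 1 / c}"

text \<open>
  Since the position vector \<open>p\<close> is normal to \<open>de_sitter c\<close> at \<open>p\<close>, the Levi-Civita connection of
  \<open>de_sitter c\<close> is the tangential part of the flat derivative of \<open>real^4\<close>. It is given here for
  vector fields along a map \<open>X\<close> into de Sitter space: if \<open>Y u\<close> is tangent to de Sitter space at
  \<open>X u\<close>, then \<open>dS_connection X Y u v\<close> is the covariant derivative of \<open>Y\<close> at \<open>u\<close> in the
  direction \<open>v\<close>. The lemmas \<open>dS_connection_tangent\<close>, \<open>dS_connection_metric\<close>,
  \<open>dS_connection_torsion_free\<close> and \<open>dS_connection_pullback\<close> below show that, for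
  \<open>X = (\<lambda>p. p)\<close>, it is tangent, metric and torsion-free, and that along a general \<open>X\<close> it is the
  pullback.\<close>

definition dS_connection ::
    "('a::real_normed_vector \<Rightarrow> real^4) \<Rightarrow> ('a \<Rightarrow> real^4) \<Rightarrow> 'a \<Rightarrow> 'a \<Rightarrow> real^4" where
  "dS_connection X Y u v =
     (let D = frechet_derivative Y (at u) v
      in D - (lorentz D (X u) / lorentz (X u) (X u)) *\<^sub>R X u)"

lemma lorentz_expand:
  "lorentz v w = - (v$0 * w$0) + v$1 * w$1 + v$2 * w$2 + v$3 * w$3"
  by (simp add: lorentz_def)

lemma lorentz_commute: "lorentz v w = lorentz w v"
  by (simp add: lorentz_expand mult.commute)

lemma bounded_bilinear_lorentz: "bounded_bilinear lorentz"
proof -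
  have "bilinear lorentz"
    unfolding bilinear_def by (auto intro!: linearI simp: lorentz_expand algebra_simps)
  then show ?thesis
    by (simp add: bilinear_conv_bounded_bilinear)
qed

lemma lorentz_derivative:
  assumes "Y differentiable at u" "Z differentiable at u"
  shows "((\<lambda>q. lorentz (Y q) (Z q)) has_derivative
           (\<lambda>v. lorentz (Y u) (frechet_derivative Z (at u) v)
              + lorentz (frechet_derivative Y (at u) v) (Z u))) (at u)"
  by (rule bounded_bilinear.FDERIV[OF bounded_bilinear_lorentz
        frechet_derivative_works[THEN iffD1, OF assms(1)]
        frechet_derivative_works[THEN iffD1, OF assms(2)]])

lemmas lorentz_simps =
  bounded_bilinear.diff_left[OF bounded_bilinear_lorentz]
  bounded_bilinear.diff_right[OF bounded_bilinear_lorentz]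
  bounded_bilinear.scaleR_left[OF bounded_bilinear_lorentz]
  bounded_bilinear.scaleR_right[OF bounded_bilinear_lorentz]

lemma dS_connection_tangent:
  assumes "lorentz (X u) (X u) \<noteq> 0"
  shows "lorentz (dS_connection X Y u v) (X u) = 0"
  using assms by (simp add: dS_connection_def Let_def lorentz_simps)

lemma dS_connection_metric:
  assumes "Y differentiable at u" "Z differentiable at u"
    and "lorentz (Y u) (X u) = 0" "lorentz (Z u) (X u) = 0"
  shows "frechet_derivative (\<lambda>q. lorentz (Y q) (Z q)) (at u) v =
           lorentz (dS_connection X Y u v) (Z u) + lorentz (Y u) (dS_connection X Z u v)"
  unfolding frechet_derivative_at[OF lorentz_derivative[OF assms(1,2)], symmetric]
  using assms(3,4) lorentz_commute[of "X u" "Z u"]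
  by (simp add: dS_connection_def Let_def lorentz_simps)

lemma dS_connection_torsion_free:
  fixes Y Z :: "real^4 \<Rightarrow> real^4"
  assumes "open S" "p \<in> S" "Y differentiable at p" "Z differentiable at p"
    and "\<And>q. q \<in> S \<Longrightarrow> lorentz (Y q) q = 0" "\<And>q. q \<in> S \<Longrightarrow> lorentz (Z q) q = 0"
  shows "dS_connection (\<lambda>q. q) Z p (Y p) - dS_connection (\<lambda>q. q) Y p (Z p) =
           frechet_derivative Z (at p) (Y p) - frechet_derivative Y (at p) (Z p)"
proof -
  have key: "lorentz (W p) v + lorentz (frechet_derivative W (at p) v) p = 0"
    if "W differentiable at p" and W: "\<And>q. q \<in> S \<Longrightarrow> lorentz (W q) q = 0"
    for W :: "real^4 \<Rightarrow> real^4" and v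
  proof -
    have 1: "((\<lambda>q. lorentz (W q) q) has_derivative
        (\<lambda>v. lorentz (W p) v + lorentz (frechet_derivative W (at p) v) p)) (at p)"
      by (rule bounded_bilinear.FDERIV[OF bounded_bilinear_lorentz
        frechet_derivative_works[THEN iffD1, OF that(1)] has_derivative_ident])
    have "((\<lambda>q. lorentz (W q) q) has_derivative (\<lambda>v. 0)) (at p)"
      by (rule has_derivative_transform_within_open[OF has_derivative_const[of 0] assms(1,2)])
        (simp add: W)
    from has_derivative_unique[OF 1 this] show ?thesis by meson
  qed
  have "lorentz (frechet_derivative Z (at p) (Y p)) p = lorentz (frechet_derivative Y (at p) (Z p)) p"
    using key[OF assms(3,5), of "Z p"] key[OF assms(4,6), of "Y p"] lorentz_commute[of "Y p" "Z p"]
    by simp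
  then show ?thesis
    by (simp add: dS_connection_def Let_def)
qed

lemma dS_connection_pullback:
  assumes "X differentiable at u" "Z differentiable at (X u)"
  shows "dS_connection X (Z \<circ> X) u v =
           dS_connection (\<lambda>q. q) Z (X u) (frechet_derivative X (at u) v)"
  using assms by (simp add: dS_connection_def frechet_derivative_compose)


subsection \<open>Local geometry of a parametrized surface\<close>

text \<open>
  In this section \<open>X\<close> is a local parametrization of the surface, defined on an open subset of
  \<open>real^2\<close>, and \<open>N\<close> is a unit normal field along \<open>X\<close>. Tangent vectors of the surface are given by
  their coordinates \<open>v :: real^2\<close>; the vector in the ambient space is \<open>push X u v\<close>.\<close>

abbreviation push :: "(real^2 \<Rightarrow> real^4) \<Rightarrow> real^2 \<Rightarrow> real^2 \<Rightarrow> real^4" where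
  "push X u \<equiv> frechet_derivative X (at u)"

definition induced_metric :: "(real^2 \<Rightarrow> real^4) \<Rightarrow> real^2 \<Rightarrow> real^2 \<Rightarrow> real^2 \<Rightarrow> real" where
  "induced_metric X u v w = lorentz (push X u v) (push X u w)"

definition shape_operator ::
    "(real^2 \<Rightarrow> real^4) \<Rightarrow> (real^2 \<Rightarrow> real^4) \<Rightarrow> real^2 \<Rightarrow> real^2 \<Rightarrow> real^2" where
  "shape_operator X N u v = (THE w. dS_connection X N u v = - push X u w)"

definition mean_curvature :: "(real^2 \<Rightarrow> real^4) \<Rightarrow> (real^2 \<Rightarrow> real^4) \<Rightarrow> real^2 \<Rightarrow> real" where
  "mean_curvature X N u = - trace (matrix (shape_operator X N u)) / 2"

definition grad :: "(real^2 \<Rightarrow> real^4) \<Rightarrow> (real^2 \<Rightarrow> real) \<Rightarrow> real^2 \<Rightarrow> real^2" where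
  "grad X f u = (THE w. \<forall>v. induced_metric X u w v = frechet_derivative f (at u) v)"


subsection \<open>Spacelike, biconservative and totally umbilical surfaces\<close>

definition immersed_in_de_sitter ::
    "real \<Rightarrow> 'm topology \<Rightarrow> 'm chart set \<Rightarrow> ('m \<Rightarrow> real^4) \<Rightarrow> bool" where
  "immersed_in_de_sitter c M \<A> x \<longleftrightarrow>
     (\<forall>p\<in>topspace M. x p \<in> de_sitter c) \<and> smooth_on_surface \<A> (topspace M) x \<and>
     (\<forall>(U, \<phi>)\<in>\<A>. \<forall>u\<in>\<phi> ` U. inj (push (x \<circ> inv_into U \<phi>) u))"

definition spacelike :: "'m chart set \<Rightarrow> ('m \<Rightarrow> real^4) \<Rightarrow> bool" where
  "spacelike \<A> x \<longleftrightarrow>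
     (\<forall>(U, \<phi>)\<in>\<A>. \<forall>u\<in>\<phi> ` U. \<forall>v. v \<noteq> 0 \<longrightarrow> induced_metric (x \<circ> inv_into U \<phi>) u v v > 0)"

text \<open>Smooth unit normal field, of a spacelike surface, on the open subset \<open>W\<close>. It is normal to the
  surface within de Sitter space, i.e. also tangent to de Sitter space.\<close>

definition unit_normal_on ::
    "'m chart set \<Rightarrow> ('m \<Rightarrow> real^4) \<Rightarrow> 'm set \<Rightarrow> ('m \<Rightarrow> real^4) \<Rightarrow> bool" where
  "unit_normal_on \<A> x W \<eta> \<longleftrightarrow>
     smooth_on_surface \<A> W \<eta> \<and>
     (\<forall>p\<in>W. lorentz (\<eta> p) (\<eta> p) = -1 \<and> lorentz (\<eta> p) (x p) = 0) \<and>
     (\<forall>(U, \<phi>)\<in>\<A>. \<forall>p\<in>U \<inter> W. \<forall>v. lorentz (\<eta> p) (push (x \<circ> inv_into U \<phi>) (\<phi> p) v) = 0)"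

text \<open>Replacing \<open>\<eta>\<close> by \<open>-\<eta>\<close> changes the signs of the shape operator \<open>A\<close>, of \<open>f\<close> and of \<open>grad f\<close>, so
  both conditions below do not depend on the choice of \<open>\<eta>\<close>. They are imposed for every smooth
  unit normal field on every open subset, so no global choice of \<open>\<eta>\<close> is part of the data.\<close>

definition biconservative ::
    "'m topology \<Rightarrow> 'm chart set \<Rightarrow> ('m \<Rightarrow> real^4) \<Rightarrow> bool" where
  "biconservative M \<A> x \<longleftrightarrow>
     (\<forall>W \<eta>. openin M W \<and> unit_normal_on \<A> x W \<eta> \<longrightarrow>
       (\<forall>(U, \<phi>)\<in>\<A>. \<forall>u\<in>\<phi> ` (U \<inter> W).
          let X = x \<circ> inv_into U \<phi>; N = \<eta> \<circ> inv_into U \<phi>; f = mean_curvature X N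
          in shape_operator X N u (grad X f u) = f u *\<^sub>R grad X f u))"

definition totally_umbilical ::
    "'m topology \<Rightarrow> 'm chart set \<Rightarrow> ('m \<Rightarrow> real^4) \<Rightarrow> bool" where
  "totally_umbilical M \<A> x \<longleftrightarrow>
     (\<forall>W \<eta>. openin M W \<and> unit_normal_on \<A> x W \<eta> \<longrightarrow>
       (\<forall>(U, \<phi>)\<in>\<A>. \<forall>u\<in>\<phi> ` (U \<inter> W).
          \<exists>\<mu>::real. \<forall>v. shape_operator (x \<circ> inv_into U \<phi>) (\<eta> \<circ> inv_into U \<phi>) u v = \<mu> *\<^sub>R v))"

end

(*
The proof is a pure maximum principle. Write t = tr A = -2f and d = det A.

Where grad f does not vanish, f is an eigenvalue of A, so that w = d + (3/4) t^2 = 0; by continuity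
the second derivatives of w still vanish on the closure of this set. At a point of the closure where
t^2 is maximal, the derivative of A (grad f) = f grad f gives <A, Hess t> = -(t/2) Lap t, and Simons'
identity
   t Lap t + |dt|^2 - Lap d = |nabla A|^2 + <A, Hess t> + (c - d) (t^2 - 4 d)
turns into 3 t Lap t >= 4 t^2 (c + (3/4) t^2), which is impossible at a maximum unless t = 0. Hence t is locally
constant at every maximum point of t^2, and globally constant because M is connected.

At the highest and lowest points of M the Laplacian of the height x_0 bounds t from both sides and
yields t^2 < 4 c. At a minimum of d Simons' identity then reads (c - d) (t^2 - 4 d) <= 0, where
c - d > 0 unless t^2 = 4 d. So the nonnegative discriminant t^2 - 4 d vanishes where it is largest.
*)
theory Submission
  imports Defs
begin

subsection \<open>Calculus of smooth maps\<close>

text \<open>Principal curvatures and principal frames need not be smooth at umbilical points, and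
  \<open>A (grad f) = f grad f\<close> says nothing where grad f vanishes. Hence only t and d, which
  are smooth everywhere, are used, and w = 0 enters through its derivatives up to order two, which
  survive the passage to the closure. Off the closure grad f vanishes on an open set, so t is
  locally constant there anyway.

  The factor c - d in Simons' identity is the Gauss curvature; its minus sign comes from the
  timelike normal. It is positive where d = -(3/4) t^2, so the first maximum principle needs no
  bound on t. For constant t its sign is not automatic: d <= t^2/4 only gives c - d >= c - t^2/4,
  and this is why the height is studied.

  The height argument needs the sign of t, hence one normal field on all of M. The normal part of
  the time axis is timelike, so it vanishes nowhere and provides a future-directed unit normal.

  Pointwise computations take place in coordinates that are Euclidean to first order, where
  coordinate second derivatives are covariant Hessians. So no connection on M has to be
  defined.\<close>

definition dd :: "'a::real_normed_vector \<Rightarrow> ('a \<Rightarrow> 'b::real_normed_vector) \<Rightarrow> 'a \<Rightarrow> 'b" where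
  "dd v f u = frechet_derivative f (at u) v"

lemma Ck_on_Suc_dd:
  "Ck_on (Suc k) S f \<longleftrightarrow> f differentiable_on S \<and> (\<forall>v. Ck_on k S (dd v f))"
  by (simp add: dd_def[abs_def])

lemma has_derivative_dd: "(f has_derivative D) (at u) \<Longrightarrow> dd v f u = D v"
  unfolding dd_def by (simp flip: frechet_derivative_at)

lemma dd_has_derivative: "f differentiable (at u) \<Longrightarrow> (f has_derivative (\<lambda>v. dd v f u)) (at u)"
  unfolding dd_def by (simp add: frechet_derivative_works flip: eta_contract_eq)

text \<open>Holds at every point, differentiable or not: \<open>frechet_derivative\<close> is a
  choice from the set of all derivatives, and maps that agree near a point have the same
  ones.\<close>

lemma dd_cong:
  assumes "open S" "u \<in> S" "\<And>x. x \<in> S \<Longrightarrow> f x = g x"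
  shows "dd v f u = dd v g u"
proof -
  have "(f has_derivative D) (at u) \<longleftrightarrow> (g has_derivative D) (at u)" for D
    using has_derivative_transform_within_open[of _ _ _ _ S, OF _ assms(1,2)] assms(3) by metis
  then show ?thesis unfolding dd_def frechet_derivative_def by simp
qed

lemma differentiable_on_cong_open:
  assumes "open S" "\<And>x. x \<in> S \<Longrightarrow> f x = g x" "f differentiable_on S"
  shows "g differentiable_on S"
  unfolding differentiable_on_def
proof
  fix x assume "x \<in> S"
  then have "f differentiable (at x within S)" using assms(3) by (simp add: differentiable_on_def)
  then show "g differentiable (at x within S)"
    by (rule differentiable_transform_within[where d=1]) (use assms(2) \<open>x \<in> S\<close> in auto)
qed

lemma Ck_on_cong_imp:
  "open S \<Longrightarrow> (\<And>x. x \<in> S \<Longrightarrow> f x = g x) \<Longrightarrow> Ck_on k S f \<Longrightarrow> Ck_on k S g"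
proof (induction k arbitrary: f g)
  case 0
  then show ?case using continuous_on_cong[of S S f g] by simp
next
  case (Suc k)
  have "Ck_on k S (dd v g)" for v
  proof (rule Suc.IH[OF Suc.prems(1)])
    show "dd v f x = dd v g x" if "x \<in> S" for x
      using dd_cong[OF Suc.prems(1) that] Suc.prems(2) by blast
    show "Ck_on k S (dd v f)" using Suc.prems(3) unfolding Ck_on_Suc_dd by blast
  qed
  then show ?case
    using differentiable_on_cong_open[OF Suc.prems(1), of f g] Suc.prems(2,3)
    unfolding Ck_on_Suc_dd by blast
qed

lemma Ck_on_cong:
  "open S \<Longrightarrow> (\<And>x. x \<in> S \<Longrightarrow> f x = g x) \<Longrightarrow> Ck_on k S f \<longleftrightarrow> Ck_on k S g"
  using Ck_on_cong_imp[of S f g k] Ck_on_cong_imp[of S g f k] by auto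

lemma Ck_on_SucD: "Ck_on (Suc k) S f \<Longrightarrow> Ck_on k S f"
proof (induction k arbitrary: f)
  case 0 then show ?case by (simp add: differentiable_imp_continuous_on)
next
  case (Suc k)
  then show ?case unfolding Ck_on_Suc_dd[of "Suc k"] Ck_on_Suc_dd[of k S f] by blast
qed

lemma Ck_on_subset: "T \<subseteq> S \<Longrightarrow> Ck_on k S f \<Longrightarrow> Ck_on k T f"
proof (induction k arbitrary: f)
  case 0 then show ?case by (auto intro: continuous_on_subset)
next
  case (Suc k) then show ?case unfolding Ck_on_Suc_dd using differentiable_on_subset by blast
qed

lemma Ck_on_const: "Ck_on k S (\<lambda>x. a)"
proof (induction k arbitrary: a)
  case (Suc k)
  have "dd v (\<lambda>x. a) = (\<lambda>x. 0)" for v :: 'a by (auto simp: dd_def)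
  then show ?case using Suc by (simp add: Ck_on_Suc_dd del: Ck_on.simps(2))
qed simp

lemma differentiable_on_openD: "open S \<Longrightarrow> f differentiable_on S \<Longrightarrow> u \<in> S \<Longrightarrow> f differentiable (at u)"
  by (simp add: differentiable_on_eq_differentiable_at)

lemma dd_add:
  "f differentiable (at u) \<Longrightarrow> g differentiable (at u) \<Longrightarrow> dd v (\<lambda>x. f x + g x) u = dd v f u + dd v g u"
  by (rule has_derivative_dd) (auto intro: derivative_intros dd_has_derivative)

lemma Ck_on_add:
  "open S \<Longrightarrow> Ck_on k S f \<Longrightarrow> Ck_on k S g \<Longrightarrow> Ck_on k S (\<lambda>x. f x + g x)"
proof (induction k arbitrary: f g)
  case 0 then show ?case by (simp add: continuous_on_add)
next
  case (Suc k)
  have "dd v (\<lambda>x. f x + g x) u = dd v f u + dd v g u" if "u \<in> S" for u v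
    using Suc.prems that by (intro dd_add) (auto intro: differentiable_on_openD)
  then have "Ck_on k S (dd v (\<lambda>x. f x + g x))" for v
    using Suc by (subst Ck_on_cong[of _ _ "\<lambda>u. dd v f u + dd v g u"])
      (auto simp: Ck_on_Suc_dd simp del: Ck_on.simps(2))
  then show ?case using Suc.prems by (auto simp: Ck_on_Suc_dd simp del: Ck_on.simps(2))
qed

lemma Ck_on_sum:
  "open S \<Longrightarrow> (\<And>i. i \<in> I \<Longrightarrow> Ck_on k S (f i)) \<Longrightarrow> Ck_on k S (\<lambda>x. \<Sum>i\<in>I. f i x)"
  by (induction I rule: infinite_finite_induct) (auto intro: Ck_on_add Ck_on_const)

lemma dd_bilinear:
  assumes "bounded_bilinear B" "f differentiable (at u)" "g differentiable (at u)"
  shows "dd v (\<lambda>x. B (f x) (g x)) u = B (f u) (dd v g u) + B (dd v f u) (g u)"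
  by (rule has_derivative_dd[OF bounded_bilinear.FDERIV[OF assms(1)]])
    (use assms in \<open>auto intro: dd_has_derivative\<close>)

lemma bilinear_differentiable_on:
  assumes "bounded_bilinear B" "f differentiable_on S" "g differentiable_on S"
  shows "(\<lambda>x. B (f x) (g x)) differentiable_on S"
  using assms bounded_bilinear.FDERIV[OF assms(1)] unfolding differentiable_on_def differentiable_def
  by fast

text \<open>By the product rule a derivative of the product is a sum of products with one factor
  differentiated and the other merely lowered by \<open>Ck_on_SucD\<close>, so the induction has to
  be general in both factors. Bilinearity covers products, scaling, the inner product and
  \<open>lorentz\<close> at once.\<close>

lemma Ck_on_bilinear:
  assumes B: "bounded_bilinear B" and S: "open S"
  shows "Ck_on k S f \<Longrightarrow> Ck_on k S g \<Longrightarrow> Ck_on k S (\<lambda>x. B (f x) (g x))"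
proof (induction k arbitrary: f g)
  case 0 then show ?case by (simp add: bounded_bilinear.continuous_on[OF B])
next
  case (Suc k)
  have eq: "dd v (\<lambda>x. B (f x) (g x)) u = B (f u) (dd v g u) + B (dd v f u) (g u)" if "u \<in> S" for u v
    using Suc.prems that S by (intro dd_bilinear[OF B]) (auto intro: differentiable_on_openD)
  have "Ck_on k S (\<lambda>u. B (f u) (dd v g u) + B (dd v f u) (g u))" for v
    using Suc by (intro Ck_on_add S Suc.IH) (auto intro: Ck_on_SucD simp: Ck_on_Suc_dd simp del: Ck_on.simps(2))
  then have "Ck_on k S (dd v (\<lambda>x. B (f x) (g x)))" for v
    by (subst Ck_on_cong[OF S eq])
  then show ?case using Suc.prems bilinear_differentiable_on[OF B]
    by (auto simp: Ck_on_Suc_dd simp del: Ck_on.simps(2))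
qed

lemma Ck_on_linear:
  assumes "bounded_linear L"
  shows "Ck_on k S L"
proof (cases k)
  case 0 then show ?thesis using assms by (simp add: linear_continuous_on)
next
  case (Suc j)
  have "dd v L = (\<lambda>u. L v)" for v
    by (rule ext, rule has_derivative_dd) (rule bounded_linear_imp_has_derivative[OF assms])
  then show ?thesis using Suc bounded_linear_imp_differentiable_on[OF assms]
    by (simp add: Ck_on_Suc_dd Ck_on_const del: Ck_on.simps(2))
qed

lemma dd_compose:
  fixes g :: "'a::real_normed_vector \<Rightarrow> 'b::euclidean_space"
  assumes "g differentiable (at u)" "f differentiable (at (g u))"
  shows "dd v (\<lambda>x. f (g x)) u = dd (dd v g u) f (g u)"
    and "dd v (\<lambda>x. f (g x)) u = (\<Sum>b\<in>Basis. (dd v g u \<bullet> b) *\<^sub>R dd b f (g u))"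
proof -
  show 1: "dd v (\<lambda>x. f (g x)) u = dd (dd v g u) f (g u)"
    using assms by (simp add: dd_def frechet_derivative_compose[unfolded o_def])
  have "linear (frechet_derivative f (at (g u)))"
    using assms(2) by (simp add: linear_frechet_derivative)
  from linear_sum[OF this, of "\<lambda>b. (dd v g u \<bullet> b) *\<^sub>R b" Basis] linear_cmul[OF this]
  show "dd v (\<lambda>x. f (g x)) u = (\<Sum>b\<in>Basis. (dd v g u \<bullet> b) *\<^sub>R dd b f (g u))"
    unfolding 1 by (simp add: dd_def euclidean_representation)
qed

text \<open>In the chain rule the direction of differentiation of \<open>f\<close> depends on the
  point. Expanding it along the basis leaves fixed directions \<open>b\<close>, so that the
  induction hypothesis applies to each \<open>dd b f\<close>.\<close>

lemma Ck_on_compose: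
  fixes g :: "'a::real_normed_vector \<Rightarrow> 'b::euclidean_space"
  assumes S: "open S" and T: "open T" and im: "\<And>x. x \<in> S \<Longrightarrow> g x \<in> T"
  shows "Ck_on k T f \<Longrightarrow> Ck_on k S g \<Longrightarrow> Ck_on k S (\<lambda>x. f (g x))"
proof (induction k arbitrary: f)
  case 0 then show ?case using im continuous_on_compose2[of T f S g] by auto
next
  case (Suc k)
  have f: "f differentiable (at (g u))" and g: "g differentiable (at u)" if "u \<in> S" for u
    using Suc.prems that S T im by (auto intro: differentiable_on_openD)
  note eq = dd_compose(2)[OF g f]
  have "Ck_on k S (\<lambda>u. \<Sum>b\<in>Basis. (dd v g u \<bullet> b) *\<^sub>R dd b f (g u))" for v
    using Suc.prems by (intro Ck_on_sum S Ck_on_bilinear[OF bounded_bilinear_scaleR S]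
        Ck_on_bilinear[OF bounded_bilinear_inner S] Ck_on_const Suc.IH)
       (auto intro: Ck_on_SucD simp: Ck_on_Suc_dd simp del: Ck_on.simps(2))
  then have "Ck_on k S (dd v (\<lambda>x. f (g x)))" for v
    by (subst Ck_on_cong[OF S eq])
  moreover have "(\<lambda>x. f (g x)) differentiable_on S"
    unfolding differentiable_on_eq_differentiable_at[OF S]
    using differentiable_chain_at[OF g f] by (simp add: o_def)
  ultimately show ?case by (simp add: Ck_on_Suc_dd del: Ck_on.simps(2))
qed

text \<open>The derivative is a polynomial in the reciprocal itself and a derivative of
  \<open>f\<close>, so the induction closes. \<open>Ck_on_sqrt\<close> follows the same
  pattern.\<close>

lemma Ck_on_inverse:
  fixes f :: "'a::real_normed_vector \<Rightarrow> real"
  assumes S: "open S" and nz: "\<And>x. x \<in> S \<Longrightarrow> f x \<noteq> 0"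
  shows "Ck_on k S f \<Longrightarrow> Ck_on k S (\<lambda>x. inverse (f x))"
proof (induction k)
  case 0 then show ?case using nz by (simp add: continuous_on_inverse)
next
  case (Suc k)
  have f: "f differentiable (at u)" if "u \<in> S" for u
    using Suc.prems that S by (auto intro: differentiable_on_openD)
  have eq: "dd v (\<lambda>x. inverse (f x)) u = (-1) * (inverse (f u) * (dd v f u * inverse (f u)))" if "u \<in> S" for u v
    by (rule has_derivative_dd[where D="\<lambda>v. (-1) * (inverse (f u) * (dd v f u * inverse (f u)))", THEN trans])
      (use nz that in \<open>auto intro!: derivative_eq_intros dd_has_derivative f\<close>)
  have "Ck_on k S (\<lambda>u. (-1) * (inverse (f u) * (dd v f u * inverse (f u))))" for v
    using Suc by (intro Ck_on_bilinear[OF bounded_bilinear_mult S] Ck_on_const Suc.IH)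
       (auto intro: Ck_on_SucD simp: Ck_on_Suc_dd simp del: Ck_on.simps(2))
  then have "Ck_on k S (dd v (\<lambda>x. inverse (f x)))" for v
    by (subst Ck_on_cong[OF S eq])
  moreover have "(\<lambda>x. inverse (f x)) differentiable_on S"
    using Suc.prems nz by (auto intro: differentiable_on_inverse)
  ultimately show ?case by (simp add: Ck_on_Suc_dd del: Ck_on.simps(2))
qed

lemma Ck_on_sqrt:
  fixes f :: "'a::real_normed_vector \<Rightarrow> real"
  assumes S: "open S" and pos: "\<And>x. x \<in> S \<Longrightarrow> f x > 0"
  shows "Ck_on k S f \<Longrightarrow> Ck_on k S (\<lambda>x. sqrt (f x))"
proof (induction k)
  case 0 then show ?case by (simp add: continuous_on_real_sqrt)
next
  case (Suc k)
  have f: "f differentiable (at u)" if "u \<in> S" for u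
    using Suc.prems that S by (auto intro: differentiable_on_openD)
  have der: "((\<lambda>x. sqrt (f x)) has_derivative (\<lambda>v. dd v f u * inverse (2 * sqrt (f u)))) (at u)" if "u \<in> S" for u
    by (rule has_derivative_eq_rhs[OF has_derivative_real_sqrt[OF pos[OF that] dd_has_derivative[OF f[OF that]]]])
       (auto simp: divide_simps)
  note eq = has_derivative_dd[OF der]
  have "Ck_on k S (\<lambda>u. dd v f u * inverse (2 * sqrt (f u)))" for v
    using Suc pos by (intro Ck_on_bilinear[OF bounded_bilinear_mult S] Ck_on_const Suc.IH Ck_on_inverse S)
       (auto intro: Ck_on_SucD simp: Ck_on_Suc_dd less_imp_neq[symmetric] simp del: Ck_on.simps(2))
  then have "Ck_on k S (dd v (\<lambda>x. sqrt (f x)))" for v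
    by (subst Ck_on_cong[OF S eq])
  moreover have "(\<lambda>x. sqrt (f x)) differentiable_on S"
    unfolding differentiable_on_eq_differentiable_at[OF S] differentiable_def using der by blast
  ultimately show ?case by (simp add: Ck_on_Suc_dd del: Ck_on.simps(2))
qed

lemma smooth_on_differentiable: "smooth_on S f \<Longrightarrow> open S \<Longrightarrow> u \<in> S \<Longrightarrow> f differentiable (at u)"
  unfolding smooth_on_def using differentiable_on_openD by (metis Ck_on.simps(2))

lemma smooth_on_continuous: "smooth_on S f \<Longrightarrow> continuous_on S f"
  unfolding smooth_on_def by (metis Ck_on.simps(1))

lemma smooth_on_dd: "smooth_on S f \<Longrightarrow> smooth_on S (dd v f)"
  unfolding smooth_on_def using Ck_on_Suc_dd by blast

lemma smooth_on_cong: "open S \<Longrightarrow> (\<And>x. x \<in> S \<Longrightarrow> f x = g x) \<Longrightarrow> smooth_on S f \<longleftrightarrow> smooth_on S g"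
  unfolding smooth_on_def using Ck_on_cong[of S f g] by simp

lemma smooth_on_subset: "smooth_on S f \<Longrightarrow> T \<subseteq> S \<Longrightarrow> smooth_on T f"
  unfolding smooth_on_def by (blast intro: Ck_on_subset)

lemma smooth_on_const: "smooth_on S (\<lambda>x. a)"
  unfolding smooth_on_def by (blast intro: Ck_on_const)

lemma smooth_on_linear: "bounded_linear L \<Longrightarrow> smooth_on S L"
  unfolding smooth_on_def by (blast intro: Ck_on_linear)

lemma smooth_on_bilinear:
  "bounded_bilinear B \<Longrightarrow> open S \<Longrightarrow> smooth_on S f \<Longrightarrow> smooth_on S g \<Longrightarrow> smooth_on S (\<lambda>x. B (f x) (g x))"
  unfolding smooth_on_def by (blast intro: Ck_on_bilinear)

lemmas smooth_on_mult = smooth_on_bilinear[OF bounded_bilinear_mult]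
  and smooth_on_scaleR = smooth_on_bilinear[OF bounded_bilinear_scaleR]
  and smooth_on_lorentz = smooth_on_bilinear[OF bounded_bilinear_lorentz]

lemma smooth_on_add: "open S \<Longrightarrow> smooth_on S f \<Longrightarrow> smooth_on S g \<Longrightarrow> smooth_on S (\<lambda>x. f x + g x)"
  unfolding smooth_on_def by (blast intro: Ck_on_add)

lemma smooth_on_minus:
  assumes "open S" "smooth_on S f" shows "smooth_on S (\<lambda>x. - f x)"
  using smooth_on_scaleR[OF assms(1) smooth_on_const assms(2), of "-1"] by simp

lemma smooth_on_diff:
  "open S \<Longrightarrow> smooth_on S f \<Longrightarrow> smooth_on S g \<Longrightarrow> smooth_on S (\<lambda>x. f x - g x)"
  using smooth_on_add[of S f "\<lambda>x. - g x"] smooth_on_minus[of S g] by simp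

lemma smooth_on_compose:
  fixes g :: "'a::real_normed_vector \<Rightarrow> 'b::euclidean_space"
  shows "open S \<Longrightarrow> open T \<Longrightarrow> smooth_on T f \<Longrightarrow> smooth_on S g \<Longrightarrow> (\<And>x. x \<in> S \<Longrightarrow> g x \<in> T)
    \<Longrightarrow> smooth_on S (\<lambda>x. f (g x))"
  unfolding smooth_on_def by (blast intro: Ck_on_compose)

lemma smooth_on_divide:
  fixes f g :: "'a::real_normed_vector \<Rightarrow> real"
  assumes "open S" "smooth_on S f" "smooth_on S g" "\<And>x. x \<in> S \<Longrightarrow> g x \<noteq> 0"
  shows "smooth_on S (\<lambda>x. f x / g x)"
proof -
  have "smooth_on S (\<lambda>x. inverse (g x))"
    using assms Ck_on_inverse unfolding smooth_on_def by blast
  from smooth_on_mult[OF assms(1,2) this] show ?thesis by (simp add: field_simps)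
qed

lemma smooth_on_sqrt:
  fixes f :: "'a::real_normed_vector \<Rightarrow> real"
  shows "open S \<Longrightarrow> smooth_on S f \<Longrightarrow> (\<And>x. x \<in> S \<Longrightarrow> f x > 0) \<Longrightarrow> smooth_on S (\<lambda>x. sqrt (f x))"
  using Ck_on_sqrt unfolding smooth_on_def by blast

lemma smooth_on_nth:
  fixes f :: "'a::real_normed_vector \<Rightarrow> real^'n"
  assumes "open S" "smooth_on S f" shows "smooth_on S (\<lambda>x. f x $ i)"
  using smooth_on_compose[OF assms(1) open_UNIV smooth_on_linear[OF bounded_linear_vec_nth] assms(2)]
  by simp


lemma linear_dd: "f differentiable (at u) \<Longrightarrow> linear (\<lambda>v. dd v f u)"
  unfolding dd_def using linear_frechet_derivative by blast

lemma dd_eq_sum_Basis: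
  fixes v :: "'a::euclidean_space"
  assumes "f differentiable (at u)"
  shows "dd v f u = (\<Sum>b\<in>Basis. (v \<bullet> b) *\<^sub>R dd b f u)"
  using linear_sum[OF linear_dd[OF assms], of "\<lambda>b. (v \<bullet> b) *\<^sub>R b" Basis]
  by (simp add: euclidean_representation linear_cmul[OF linear_dd[OF assms]])

lemma dd2_bilinear:
  assumes B: "bounded_bilinear B" and S: "open S" "u \<in> S" and f: "smooth_on S f" and g: "smooth_on S g"
  shows "dd v (dd w (\<lambda>x. B (f x) (g x))) u =
    B (f u) (dd v (dd w g) u) + B (dd v f u) (dd w g u) + (B (dd w f u) (dd v g u) + B (dd v (dd w f) u) (g u))"
proof -
  note diff = smooth_on_differentiable[OF _ S(1)]
  have "dd v (dd w (\<lambda>x. B (f x) (g x))) u = dd v (\<lambda>x. B (f x) (dd w g x) + B (dd w f x) (g x)) u"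
    by (rule dd_cong[OF S]) (intro dd_bilinear[OF B] diff f g)
  also have "\<dots> = dd v (\<lambda>x. B (f x) (dd w g x)) u + dd v (\<lambda>x. B (dd w f x) (g x)) u"
    by (rule dd_add) (intro diff[OF smooth_on_bilinear[OF B S(1)]] smooth_on_dd f g S(2))+
  also have "\<dots> = B (f u) (dd v (dd w g) u) + B (dd v f u) (dd w g u) + (B (dd w f u) (dd v g u) + B (dd v (dd w f) u) (g u))"
    by (intro arg_cong2[where f="(+)"] dd_bilinear[OF B] diff smooth_on_dd f g S(2))
  finally show ?thesis .
qed

lemma dd_sum:
  assumes "\<And>i. i \<in> I \<Longrightarrow> f i differentiable (at u)"
  shows "dd v (\<lambda>x. \<Sum>i\<in>I. f i x) u = (\<Sum>i\<in>I. dd v (f i) u)"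
  by (rule has_derivative_dd) (auto intro!: has_derivative_sum dd_has_derivative assms)

text \<open>The last summand, in which \<open>g\<close> is differentiated twice, is the one through
  which a quadratic coordinate change can remove the Christoffel symbols.\<close>

lemma dd2_compose:
  fixes g :: "'a::real_normed_vector \<Rightarrow> 'b::euclidean_space"
  assumes S: "open S" "u \<in> S" and T: "open T" and im: "\<And>x. x \<in> S \<Longrightarrow> g x \<in> T"
    and g: "smooth_on S g" and f: "smooth_on T f"
  shows "dd v (dd w (\<lambda>x. f (g x))) u = dd (dd v g u) (dd (dd w g u) f) (g u) + dd (dd v (dd w g) u) f (g u)"
proof -
  note diffS = smooth_on_differentiable[OF _ S(1)] and diffT = smooth_on_differentiable[OF _ T im[OF S(2)]]
  note rules = smooth_on_scaleR[OF S(1)] smooth_on_bilinear[OF bounded_bilinear_inner S(1)] smooth_on_dd f g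
     smooth_on_const smooth_on_compose[OF S(1) T _ g im] S(2)
  have 1: "dd v (\<lambda>x. (dd w g x \<bullet> b) *\<^sub>R dd b f (g x)) u =
      (dd w g u \<bullet> b) *\<^sub>R dd (dd v g u) (dd b f) (g u) + (dd v (dd w g) u \<bullet> b) *\<^sub>R dd b f (g u)" for b
  proof -
    have "dd v (\<lambda>x. dd w g x \<bullet> b) u = dd v (dd w g) u \<bullet> b"
      using dd_bilinear[OF bounded_bilinear_inner, of "dd w g" u "\<lambda>_. b" v] diffS[OF smooth_on_dd[OF g] S(2), of w]
      by (simp add: dd_def)
    then show ?thesis
      by (subst dd_bilinear[OF bounded_bilinear_scaleR])
        (auto intro!: diffS rules simp: dd_compose(1)[OF diffS[OF g S(2)] diffT[OF smooth_on_dd[OF f]]])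
  qed
  have "dd v (dd w (\<lambda>x. f (g x))) u = dd v (\<lambda>x. \<Sum>b\<in>Basis. (dd w g x \<bullet> b) *\<^sub>R dd b f (g x)) u"
    by (rule dd_cong[OF S], rule dd_compose(2)) (auto intro: diffS smooth_on_differentiable[OF f T] im g)
  also have "\<dots> = (\<Sum>b\<in>Basis. dd v (\<lambda>x. (dd w g x \<bullet> b) *\<^sub>R dd b f (g x)) u)"
    by (rule dd_sum) (intro diffS rules)
  also have "\<dots> = (\<Sum>b\<in>Basis. (dd w g u \<bullet> b) *\<^sub>R dd (dd v g u) (dd b f) (g u)) + dd (dd v (dd w g) u) f (g u)"
    unfolding 1 sum.distrib dd_eq_sum_Basis[OF diffT[OF f], of "dd v (dd w g) u"] ..
  also have "(\<Sum>b\<in>Basis. (dd w g u \<bullet> b) *\<^sub>R dd (dd v g u) (dd b f) (g u)) = dd (dd v g u) (dd (dd w g u) f) (g u)"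
  proof -
    have "dd (dd v g u) (dd (dd w g u) f) (g u) = dd (dd v g u) (\<lambda>y. \<Sum>b\<in>Basis. (dd w g u \<bullet> b) *\<^sub>R dd b f y) (g u)"
      by (rule dd_cong[OF T im[OF S(2)]]) (rule dd_eq_sum_Basis[OF smooth_on_differentiable[OF f T]])
    also have "\<dots> = (\<Sum>b\<in>Basis. dd (dd v g u) (\<lambda>y. (dd w g u \<bullet> b) *\<^sub>R dd b f y) (g u))"
      by (rule dd_sum) (intro diffT smooth_on_scaleR T smooth_on_const smooth_on_dd f)
    also have "\<dots> = (\<Sum>b\<in>Basis. (dd w g u \<bullet> b) *\<^sub>R dd (dd v g u) (dd b f) (g u))"
      by (rule sum.cong[OF refl], subst dd_bilinear[OF bounded_bilinear_scaleR])
        (auto intro: diffT smooth_on_dd f smooth_on_const simp: dd_def)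
    finally show ?thesis by simp
  qed
  finally show ?thesis .
qed

section \<open>Symmetry of second derivatives\<close>

lemma line_has_derivative:
  fixes f :: "'a::real_normed_vector \<Rightarrow> real"
  assumes "f differentiable (at (a + s *\<^sub>R v))"
  shows "((\<lambda>s. f (a + s *\<^sub>R v)) has_real_derivative dd v f (a + s *\<^sub>R v)) (at s)"
proof -
  have 1: "((\<lambda>s. a + s *\<^sub>R v) has_derivative (\<lambda>h. h *\<^sub>R v)) (at s)"
    by (auto intro!: derivative_eq_intros)
  from diff_chain_at[OF 1 dd_has_derivative[OF assms]] show ?thesis
    unfolding o_def has_field_derivative_def
    by (rule has_derivative_eq_rhs[unfolded o_def])
      (auto simp: linear_cmul[OF linear_dd[OF assms]] mult.commute)
qed

text \<open>The mean value theorem, applied first in direction \<open>v\<close> and then in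
  direction \<open>w\<close>. The second difference itself is symmetric in \<open>v\<close> and
  \<open>w\<close>, so exchanging them compares the two orders of differentiation.\<close>

lemma second_difference:
  fixes f :: "'a::real_normed_vector \<Rightarrow> real"
  assumes S: "open S" and f: "smooth_on S f" and h: "h > 0"
    and sub: "\<And>s t. \<lbrakk>0 \<le> s; s \<le> h; 0 \<le> t; t \<le> h\<rbrakk> \<Longrightarrow> u + s *\<^sub>R v + t *\<^sub>R w \<in> S"
  obtains s t where "0 < s" "s < h" "0 < t" "t < h"
    "f (u + h *\<^sub>R v + h *\<^sub>R w) - f (u + h *\<^sub>R v) - f (u + h *\<^sub>R w) + f u
      = h * h * dd w (dd v f) (u + s *\<^sub>R v + t *\<^sub>R w)"
proof -
  note diff = smooth_on_differentiable[OF _ S]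
  have sub0: "u + s *\<^sub>R v \<in> S" if "0 \<le> s" "s \<le> h" for s using sub[of s 0] that h by simp
  have "((\<lambda>s. f (u + h *\<^sub>R w + s *\<^sub>R v) - f (u + s *\<^sub>R v)) has_real_derivative
      dd v f (u + h *\<^sub>R w + s *\<^sub>R v) - dd v f (u + s *\<^sub>R v)) (at s)" if "0 \<le> s" "s \<le> h" for s
    using that h sub[of s h] sub0[of s] by (intro DERIV_diff line_has_derivative diff f) (auto simp: algebra_simps)
  from MVT2[OF h this] obtain s where s: "0 < s" "s < h" and
    1: "f (u + h *\<^sub>R w + h *\<^sub>R v) - f (u + h *\<^sub>R v) - (f (u + h *\<^sub>R w + 0 *\<^sub>R v) - f (u + 0 *\<^sub>R v))
      = (h - 0) * (dd v f (u + h *\<^sub>R w + s *\<^sub>R v) - dd v f (u + s *\<^sub>R v))" by blast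
  have "((\<lambda>t. dd v f (u + s *\<^sub>R v + t *\<^sub>R w)) has_real_derivative dd w (dd v f) (u + s *\<^sub>R v + t *\<^sub>R w)) (at t)"
    if "0 \<le> t" "t \<le> h" for t
    using that s sub[of s t] by (intro line_has_derivative diff smooth_on_dd f) auto
  from MVT2[OF h this] obtain t where t: "0 < t" "t < h" and
    2: "dd v f (u + s *\<^sub>R v + h *\<^sub>R w) - dd v f (u + s *\<^sub>R v + 0 *\<^sub>R w)
      = (h - 0) * dd w (dd v f) (u + s *\<^sub>R v + t *\<^sub>R w)" by blast
  show ?thesis
    by (rule that[OF s t]) (use 1 2 in \<open>simp add: algebra_simps\<close>)
qed

lemma dd_commute_real:
  fixes f :: "'a::real_normed_vector \<Rightarrow> real"
  assumes S: "open S" "u \<in> S" and f: "smooth_on S f"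
  shows "dd v (dd w f) u = dd w (dd v f) u"
proof -
  obtain r where r: "r > 0" "ball u r \<subseteq> S" using S open_contains_ball by blast
  \<comment> \<open>Step sizes tending to zero, small enough to keep every parallelogram inside the
    ball of radius \<open>r\<close>. The summand 1 keeps the denominator positive when both
    directions are zero.\<close>
  define k where "k n = r / (2 * (1 + norm v + norm w)) / (real n + 1)" for n :: nat
  have den: "1 + norm v + norm w > 0" by (simp add: add_pos_nonneg)
  have k: "k n > 0" "k n \<le> r / (2 * (1 + norm v + norm w))" for n
  proof -
    define D where "D = r / (2 * (1 + norm v + norm w))"
    have "D > 0" using r den by (simp add: D_def)
    moreover have "k n = D / (real n + 1)" by (simp add: k_def D_def)
    ultimately have "k n > 0" "k n \<le> D" by (auto simp: divide_le_eq)
    then show "k n > 0" "k n \<le> r / (2 * (1 + norm v + norm w))" by (simp_all add: D_def)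
  qed
  have near: "u + s *\<^sub>R v + t *\<^sub>R w \<in> S" if "0 \<le> s" "s \<le> k n" "0 \<le> t" "t \<le> k n" for s t n
  proof -
    have "norm (s *\<^sub>R v + t *\<^sub>R w) \<le> s * norm v + t * norm w"
      using norm_triangle_ineq[of "s *\<^sub>R v" "t *\<^sub>R w"] that by simp
    also have "\<dots> \<le> k n * norm v + k n * norm w"
      using that by (intro add_mono mult_right_mono) auto
    also have "\<dots> = k n * (norm v + norm w)" by (simp add: algebra_simps)
    also have "\<dots> \<le> r / (2 * (1 + norm v + norm w)) * (norm v + norm w)"
      using k(2)[of n] by (intro mult_right_mono) auto
    also have "\<dots> < r" using r den by (simp add: field_simps add_pos_nonneg add_strict_increasing)
    finally have "dist u (u + s *\<^sub>R v + t *\<^sub>R w) < r"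
      by (metis add.assoc add_diff_cancel_left' dist_commute dist_norm)
    then show ?thesis using r(2) by auto
  qed
  have "\<exists>s t s' t'. 0 < s \<and> s < k n \<and> 0 < t \<and> t < k n \<and> 0 < s' \<and> s' < k n \<and> 0 < t' \<and> t' < k n \<and>
      dd w (dd v f) (u + s *\<^sub>R v + t *\<^sub>R w) = dd v (dd w f) (u + s' *\<^sub>R v + t' *\<^sub>R w)" for n
  proof -
    obtain s t where 1: "0 < s" "s < k n" "0 < t" "t < k n"
      "f (u + k n *\<^sub>R v + k n *\<^sub>R w) - f (u + k n *\<^sub>R v) - f (u + k n *\<^sub>R w) + f u
      = k n * k n * dd w (dd v f) (u + s *\<^sub>R v + t *\<^sub>R w)"
      using second_difference[OF S(1) f k(1)[of n], of u v w] near[of _ n] by blast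
    have near': "u + s *\<^sub>R w + t *\<^sub>R v \<in> S" if "0 \<le> s" "s \<le> k n" "0 \<le> t" "t \<le> k n" for s t
      using near[of t n s] that by (simp add: add.commute add.left_commute)
    obtain s' t' where 2: "0 < s'" "s' < k n" "0 < t'" "t' < k n"
      "f (u + k n *\<^sub>R w + k n *\<^sub>R v) - f (u + k n *\<^sub>R w) - f (u + k n *\<^sub>R v) + f u
      = k n * k n * dd v (dd w f) (u + s' *\<^sub>R w + t' *\<^sub>R v)"
      using second_difference[OF S(1) f k(1)[of n], of u w v] near' by blast
    have "k n * k n * dd w (dd v f) (u + s *\<^sub>R v + t *\<^sub>R w) = k n * k n * dd v (dd w f) (u + t' *\<^sub>R v + s' *\<^sub>R w)"
      using 1(5) 2(5) unfolding add.assoc[of u] add.commute[of "_ *\<^sub>R w"] by linarith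
    then have "dd w (dd v f) (u + s *\<^sub>R v + t *\<^sub>R w) = dd v (dd w f) (u + t' *\<^sub>R v + s' *\<^sub>R w)"
      using k(1)[of n] by simp
    then show ?thesis using 1 2 by blast
  qed
  then obtain s t s' t' where st: "\<And>n. 0 < s n" "\<And>n. s n < k n" "\<And>n. 0 < t n" "\<And>n. t n < k n"
      "\<And>n. 0 < s' n" "\<And>n. s' n < k n" "\<And>n. 0 < t' n" "\<And>n. t' n < k n"
    and eq: "\<And>n. dd w (dd v f) (u + s n *\<^sub>R v + t n *\<^sub>R w) = dd v (dd w f) (u + s' n *\<^sub>R v + t' n *\<^sub>R w)"
    by metis
  have "k \<longlonglongrightarrow> 0"
    unfolding k_def using tendsto_mult_right_zero[OF LIMSEQ_inverse_real_of_nat, of "r / (2 * (1 + norm v + norm w))"]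
    by (simp add: divide_inverse add.commute)
  then have lim: "z \<longlonglongrightarrow> 0" if "\<And>n. 0 < z n" "\<And>n. z n < k n" for z :: "nat \<Rightarrow> real"
    using tendsto_sandwich[of "\<lambda>_. 0" z sequentially k 0] that by (simp add: less_imp_le)
  have pt: "(\<lambda>n. u + p n *\<^sub>R v + q n *\<^sub>R w) \<longlonglongrightarrow> u" if "p \<longlonglongrightarrow> 0" "q \<longlonglongrightarrow> 0" for p q :: "nat \<Rightarrow> real"
  proof -
    have "(\<lambda>n. u + p n *\<^sub>R v + q n *\<^sub>R w) \<longlonglongrightarrow> u + 0 *\<^sub>R v + 0 *\<^sub>R w"
      by (intro tendsto_intros that)
    then show ?thesis by simp
  qed
  have cont: "isCont (dd a (dd b f)) u" for a b
    using smooth_on_continuous[OF smooth_on_dd[OF smooth_on_dd[OF f]]] S continuous_on_eq_continuous_at by blast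
  have 1: "(\<lambda>n. dd w (dd v f) (u + s n *\<^sub>R v + t n *\<^sub>R w)) \<longlonglongrightarrow> dd w (dd v f) u"
    by (intro isCont_tendsto_compose[OF cont] pt lim st)
  have 2: "(\<lambda>n. dd v (dd w f) (u + s' n *\<^sub>R v + t' n *\<^sub>R w)) \<longlonglongrightarrow> dd v (dd w f) u"
    by (intro isCont_tendsto_compose[OF cont] pt lim st)
  show ?thesis using LIMSEQ_unique[OF 1[unfolded eq] 2] by simp
qed

lemma dd_commute:
  fixes f :: "'a::real_normed_vector \<Rightarrow> 'b::euclidean_space"
  assumes S: "open S" "u \<in> S" and f: "smooth_on S f"
  shows "dd v (dd w f) u = dd w (dd v f) u"
proof (rule euclidean_eqI)
  fix b :: 'b
  have sm: "smooth_on S (\<lambda>x. f x \<bullet> b)"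
    by (intro smooth_on_bilinear[OF bounded_bilinear_inner] S f smooth_on_const)
  have 2: "dd v (dd w (\<lambda>x. f x \<bullet> b)) u = dd v (dd w f) u \<bullet> b" for v w
    by (subst dd2_bilinear[OF bounded_bilinear_inner S f smooth_on_const]) (simp add: dd_def[abs_def])
  show "dd v (dd w f) u \<bullet> b = dd w (dd v f) u \<bullet> b"
    using dd_commute_real[OF S sm, of v w] by (simp add: 2)
qed

section \<open>Derivatives at local extrema\<close>

lemma local_max_derivatives:
  fixes g :: "'a::real_normed_vector \<Rightarrow> real"
  assumes S: "open S" "u \<in> S" and g: "smooth_on S g" and mx: "\<And>x. x \<in> S \<Longrightarrow> g x \<le> g u"
  shows "dd v g u = 0" and "dd v (dd v g) u \<le> 0"
proof -
  have "open ((\<lambda>s. u + s *\<^sub>R v) -` S)"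
    by (rule open_vimage[OF S(1)]) (intro continuous_intros)
  moreover have "0 \<in> (\<lambda>s. u + s *\<^sub>R v) -` S" using S by simp
  ultimately obtain e where e: "e > 0" "ball 0 e \<subseteq> (\<lambda>s. u + s *\<^sub>R v) -` S"
    using open_contains_ball by blast
  have inS: "u + s *\<^sub>R v \<in> S" if "\<bar>s\<bar> < e" for s using e(2) that by (auto simp: dist_norm)
  note diff = smooth_on_differentiable[OF _ S(1) inS]
  have D1: "((\<lambda>s. g (u + s *\<^sub>R v)) has_real_derivative dd v g (u + s *\<^sub>R v)) (at s)" if "\<bar>s\<bar> < e" for s
    by (intro line_has_derivative diff g that)
  have D2: "((\<lambda>s. dd v g (u + s *\<^sub>R v)) has_real_derivative dd v (dd v g) (u + s *\<^sub>R v)) (at s)" if "\<bar>s\<bar> < e" for s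
    by (intro line_has_derivative diff smooth_on_dd g that)
  have z: "\<bar>0::real\<bar> < e" using e by simp
  have "dd v g (u + 0 *\<^sub>R v) = 0"
    by (rule DERIV_local_max[OF D1[OF z] e(1)]) (use mx inS in auto)
  then show 1: "dd v g u = 0" by simp
  show "dd v (dd v g) u \<le> 0"
  proof (rule ccontr)
    \<comment> \<open>A positive second derivative would make the first derivative, zero at
      \<open>u\<close>, positive just beyond it; the mean value theorem then yields a value above
      the maximum.\<close>
    assume "\<not> dd v (dd v g) u \<le> 0"
    then have "dd v (dd v g) (u + 0 *\<^sub>R v) > 0" by simp
    from DERIV_pos_inc_right[OF D2[OF z] this] obtain d where d: "d > 0"
      "\<And>h. 0 < h \<Longrightarrow> h < d \<Longrightarrow> dd v g (u + 0 *\<^sub>R v) < dd v g (u + (0 + h) *\<^sub>R v)" by blast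
    define h where "h = min d e / 2"
    have h: "0 < h" "h < d" "h < e" using d e by (auto simp: h_def)
    have "\<exists>y>0. y < h \<and> g (u + h *\<^sub>R v) - g (u + 0 *\<^sub>R v) = (h - 0) * dd v g (u + y *\<^sub>R v)"
      by (rule MVT2[OF h(1)]) (rule D1, use h in auto)
    then obtain y where y: "0 < y" "y < h" "g (u + h *\<^sub>R v) - g u = h * dd v g (u + y *\<^sub>R v)" by auto
    have "dd v g (u + y *\<^sub>R v) > 0" using d(2)[of y] y h 1 by simp
    then have "g (u + h *\<^sub>R v) > g u" using y(3) h(1) by (smt (verit) mult_pos_pos)
    then show False using mx[OF inS[of h]] h by simp
  qed
qed

lemma dd2_cong:
  assumes "open S" "u \<in> S" "\<And>x. x \<in> S \<Longrightarrow> f x = g x"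
  shows "dd v (dd w f) u = dd v (dd w g) u"
  by (rule dd_cong[OF assms(1,2)]) (rule dd_cong[OF assms(1) _ assms(3)])

lemma dd_diff:
  "f differentiable (at u) \<Longrightarrow> g differentiable (at u) \<Longrightarrow> dd v (\<lambda>x. f x - g x) u = dd v f u - dd v g u"
  by (rule has_derivative_dd) (auto intro: derivative_intros dd_has_derivative)

lemma dd2_add:
  assumes "open S" "u \<in> S" "smooth_on S f" "smooth_on S g"
  shows "dd v (dd w (\<lambda>x. f x + g x)) u = dd v (dd w f) u + dd v (dd w g) u"
proof -
  note diff = smooth_on_differentiable[OF _ assms(1)]
  have "dd v (dd w (\<lambda>x. f x + g x)) u = dd v (\<lambda>x. dd w f x + dd w g x) u"
    by (rule dd_cong[OF assms(1,2)]) (intro dd_add diff assms)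
  also have "\<dots> = dd v (dd w f) u + dd v (dd w g) u"
    by (intro dd_add diff smooth_on_dd assms)
  finally show ?thesis .
qed

lemma dd2_diff:
  assumes "open S" "u \<in> S" "smooth_on S f" "smooth_on S g"
  shows "dd v (dd w (\<lambda>x. f x - g x)) u = dd v (dd w f) u - dd v (dd w g) u"
proof -
  note diff = smooth_on_differentiable[OF _ assms(1)]
  have "dd v (dd w (\<lambda>x. f x - g x)) u = dd v (\<lambda>x. dd w f x - dd w g x) u"
    by (rule dd_cong[OF assms(1,2)]) (intro dd_diff diff assms)
  also have "\<dots> = dd v (dd w f) u - dd v (dd w g) u"
    by (intro dd_diff diff smooth_on_dd assms)
  finally show ?thesis .
qed

lemmas dd_mult = dd_bilinear[OF bounded_bilinear_mult]
  and dd2_mult = dd2_bilinear[OF bounded_bilinear_mult]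
  and dd_lorentz = dd_bilinear[OF bounded_bilinear_lorentz]
  and dd2_lorentz = dd2_bilinear[OF bounded_bilinear_lorentz]

lemma dd_smooth_commute:
  fixes f :: "'a::real_normed_vector \<Rightarrow> 'b::euclidean_space"
  assumes S: "open S" "u \<in> S" and f: "smooth_on S f"
  shows "dd y (dd w (dd v f)) u = dd y (dd v (dd w f)) u"
    and "dd z (dd y (dd w (dd v f))) u = dd z (dd y (dd v (dd w f))) u"
proof -
  have "dd w (dd v f) x = dd v (dd w f) x" if "x \<in> S" for x by (rule dd_commute[OF S(1) that f])
  then show "dd y (dd w (dd v f)) u = dd y (dd v (dd w f)) u"
    "dd z (dd y (dd w (dd v f))) u = dd z (dd y (dd v (dd w f))) u"
    using dd_cong[OF S] dd2_cong[OF S] by blast+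
qed

lemma dd_const: "dd v (\<lambda>_. a) = (\<lambda>_. 0)"
  by (rule ext) (simp add: dd_def)

lemma local_min_derivatives:
  fixes g :: "'a::real_normed_vector \<Rightarrow> real"
  assumes S: "open S" "u \<in> S" and g: "smooth_on S g" and mn: "\<And>x. x \<in> S \<Longrightarrow> g u \<le> g x"
  shows "dd v g u = 0" and "0 \<le> dd v (dd v g) u"
proof -
  have neg: "dd v (\<lambda>x. - f x) x = - dd v f x" if "smooth_on S f" "x \<in> S" for f :: "'a \<Rightarrow> real" and x
    by (rule has_derivative_dd) (intro has_derivative_minus dd_has_derivative smooth_on_differentiable[OF that(1) S(1) that(2)])
  have "dd v (dd v (\<lambda>x. - g x)) u = dd v (\<lambda>x. - dd v g x) u"
    by (rule dd_cong[OF S neg[OF g]])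
  then have "dd v (dd v (\<lambda>x. - g x)) u = - dd v (dd v g) u"
    using neg[OF smooth_on_dd[OF g] S(2)] by simp
  then show "dd v g u = 0" "0 \<le> dd v (dd v g) u"
    using local_max_derivatives[OF S smooth_on_minus[OF S(1) g], of v] mn neg[OF g S(2)] by auto
qed

subsection \<open>Local geometry of spacelike patches\<close>

abbreviation e1 :: "real^2" where "e1 \<equiv> axis 1 1"
abbreviation e2 :: "real^2" where "e2 \<equiv> axis 2 1"

lemma e_nth: "e1 $ 1 = 1" "e1 $ 2 = 0" "e2 $ 1 = 0" "e2 $ 2 = 1"
  by (simp_all add: axis_def)

lemma real2_expand: "v = v $ 1 *\<^sub>R e1 + v $ 2 *\<^sub>R (e2 :: real^2)"
  by (simp add: vec_eq_iff forall_2 axis_def)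

lemma dd_real2:
  "f differentiable (at u) \<Longrightarrow> dd v f u = v $ 1 *\<^sub>R dd e1 f u + v $ 2 *\<^sub>R dd e2 f u"
  by (subst real2_expand[of v]) (simp only: linear_add[OF linear_dd] linear_cmul[OF linear_dd])

lemma dd_const_on:
  assumes "open S" "u \<in> S" "\<And>x. x \<in> S \<Longrightarrow> f x = a"
  shows "dd v f u = 0"
proof -
  have "dd v f u = dd v (\<lambda>_. a) u" by (rule dd_cong[OF assms])
  then show ?thesis by (simp add: dd_def)
qed

section \<open>Linear algebra of the Lorentz form\<close>

lemmas lorentz_add = bounded_bilinear.add_left[OF bounded_bilinear_lorentz]
  bounded_bilinear.add_right[OF bounded_bilinear_lorentz]
lemmas lorentz_zero = bounded_bilinear.zero_left[OF bounded_bilinear_lorentz]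
  bounded_bilinear.zero_right[OF bounded_bilinear_lorentz]
lemmas lorentz_minus = bounded_bilinear.minus_left[OF bounded_bilinear_lorentz]
  bounded_bilinear.minus_right[OF bounded_bilinear_lorentz]
lemmas lorentz_algebra = lorentz_add lorentz_zero lorentz_minus lorentz_simps

text \<open>The index type is arithmetic modulo 4, so the element \<open>4\<close> listed in
  \<open>UNIV_4\<close> is the time index \<open>0\<close>.\<close>

lemma UNIV_4_zero: "(UNIV :: 4 set) = {0, 1, 2, 3}"
proof -
  have "(4::4) = 0" by simp
  then show ?thesis unfolding UNIV_4 by auto
qed

lemma lorentz_nondegenerate:
  assumes "\<And>y. lorentz z y = 0" shows "z = 0"
proof -
  have "z $ 0 = 0" "z $ 1 = 0" "z $ 2 = 0" "z $ 3 = 0"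
    using assms[of "axis 0 1"] assms[of "axis 1 1"] assms[of "axis 2 1"] assms[of "axis 3 1"]
    by (auto simp: lorentz_expand axis_def split: if_splits)
  then have "z $ i = 0" for i using UNIV_4_zero by (metis UNIV_I insert_iff singletonD)
  then show ?thesis by (simp add: vec_eq_iff)
qed

text \<open>The Gram matrix of \<open>x\<close>, \<open>n\<close>, \<open>a\<close>,
  \<open>b\<close> is block diagonal and invertible, so the four vectors are independent and span
  the space. A vector orthogonal to all of them is then orthogonal to everything.\<close>

lemma lorentz_frame_zero:
  assumes "lorentz x x \<noteq> 0" "lorentz n n \<noteq> 0" "lorentz n x = 0"
    and "lorentz a x = 0" "lorentz b x = 0" "lorentz n a = 0" "lorentz n b = 0"
    and gram: "lorentz a a * lorentz b b - (lorentz a b)^2 \<noteq> 0"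
    and z: "lorentz z x = 0" "lorentz z n = 0" "lorentz z a = 0" "lorentz z b = 0"
  shows "z = 0"
proof -
  define L where "L k = k $ 0 *\<^sub>R x + k $ 1 *\<^sub>R n + k $ 2 *\<^sub>R a + k $ 3 *\<^sub>R b" for k :: "real^4"
  have lin: "linear L" by (rule linearI) (auto simp: L_def algebra_simps)
  have "k = 0" if "L k = 0" for k
  proof -
    have eq: "lorentz (L k) y = 0" for y by (simp add: that lorentz_zero)
    have "k $ 0 = 0" "k $ 1 = 0"
      using eq[of x] eq[of n] assms by (simp_all add: L_def lorentz_algebra lorentz_commute[of x n] lorentz_commute[of a n] lorentz_commute[of b n])
    moreover have A: "k $ 2 * lorentz a a + k $ 3 * lorentz a b = 0" "k $ 2 * lorentz a b + k $ 3 * lorentz b b = 0"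
      using eq[of a] eq[of b] assms calculation by (simp_all add: L_def lorentz_algebra lorentz_commute[of b a])
    have "k $ 2 * (lorentz a a * lorentz b b - (lorentz a b)^2) = 0"
         "k $ 3 * (lorentz a a * lorentz b b - (lorentz a b)^2) = 0"
      using A by algebra+
    then have "k $ 2 = 0" "k $ 3 = 0" using gram by auto
    ultimately have "k $ i = 0" for i using UNIV_4_zero by (metis UNIV_I insert_iff singletonD)
    then show ?thesis by (simp add: vec_eq_iff)
  qed
  then have "inj L" using lin linear_injective_0 by blast
  then have "surj L" using lin linear_inj_imp_surj by blast
  have "lorentz z y = 0" for y
  proof -
    obtain k where "y = L k" using \<open>surj L\<close> by blast
    then show ?thesis using z by (simp add: L_def lorentz_algebra)
  qed
  then show ?thesis by (rule lorentz_nondegenerate)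
qed

text \<open>The difference of both sides is orthogonal to the whole frame. The factor
  \<open>c\<close> normalizes \<open>x\<close>, whose square is \<open>1 / c\<close>; the minus sign
  is due to the timelike \<open>n\<close>.\<close>

lemma lorentz_frame_expand:
  assumes "lorentz x x = 1 / c" "c \<noteq> 0" "lorentz n n = - 1" "lorentz n x = 0"
    and "lorentz a x = 0" "lorentz b x = 0" "lorentz n a = 0" "lorentz n b = 0"
    and "lorentz a a = 1" "lorentz b b = 1" "lorentz a b = 0"
  shows "z = (c * lorentz z x) *\<^sub>R x - lorentz z n *\<^sub>R n + lorentz z a *\<^sub>R a + lorentz z b *\<^sub>R b"
proof -
  have "z - ((c * lorentz z x) *\<^sub>R x - lorentz z n *\<^sub>R n + lorentz z a *\<^sub>R a + lorentz z b *\<^sub>R b) = 0"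
    by (rule lorentz_frame_zero[of x n a b])
      (use assms in \<open>simp_all add: lorentz_algebra lorentz_commute[of x n] lorentz_commute[of x a]
        lorentz_commute[of x b] lorentz_commute[of a n] lorentz_commute[of b n] lorentz_commute[of b a]\<close>)
  then show ?thesis by simp
qed

section \<open>Fundamental forms, trace and determinant of the shape operator\<close>

definition fff :: "(real^2 \<Rightarrow> real^4) \<Rightarrow> real^2 \<Rightarrow> real^2 \<Rightarrow> real^2 \<Rightarrow> real" where
  "fff X v w u = lorentz (dd v X u) (dd w X u)"

text \<open>The minus sign makes this the form \<open><v, A w>\<close>, because the derivative of
  \<open>N\<close> is minus the image of the shape operator.\<close>

definition sff :: "(real^2 \<Rightarrow> real^4) \<Rightarrow> (real^2 \<Rightarrow> real^4) \<Rightarrow> real^2 \<Rightarrow> real^2 \<Rightarrow> real^2 \<Rightarrow> real" where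
  "sff X N v w u = - lorentz (dd v X u) (dd w N u)"

definition gram_det :: "(real^2 \<Rightarrow> real^4) \<Rightarrow> real^2 \<Rightarrow> real" where
  "gram_det X u = fff X e1 e1 u * fff X e2 e2 u - fff X e1 e2 u * fff X e1 e2 u"

text \<open>Trace of \<open>I^-1 II\<close> by Cramer's rule, with the two mixed terms merged by the
  symmetry of \<open>II\<close>. As a rational expression in the fundamental forms it is visibly
  smooth.\<close>

definition tr_shape :: "(real^2 \<Rightarrow> real^4) \<Rightarrow> (real^2 \<Rightarrow> real^4) \<Rightarrow> real^2 \<Rightarrow> real" where
  "tr_shape X N u = (fff X e2 e2 u * sff X N e1 e1 u - 2 * (fff X e1 e2 u * sff X N e1 e2 u)
     + fff X e1 e1 u * sff X N e2 e2 u) / gram_det X u"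

definition det_shape :: "(real^2 \<Rightarrow> real^4) \<Rightarrow> (real^2 \<Rightarrow> real^4) \<Rightarrow> real^2 \<Rightarrow> real" where
  "det_shape X N u = (sff X N e1 e1 u * sff X N e2 e2 u - sff X N e1 e2 u * sff X N e1 e2 u) / gram_det X u"

lemma fff_commute: "fff X v w u = fff X w v u"
  by (simp add: fff_def lorentz_commute)

text \<open>\<open>Q\<close> is the symmetric bilinear form with coefficients \<open>P\<close>,
  \<open>R\<close>, \<open>S\<close>, evaluated at two vectors. Congruence by the matrix with
  columns \<open>(a, a')\<close> and \<open>(b, b')\<close> multiplies the determinant of a form by
  the squared determinant of the matrix; the second identity is the polarization of this for a pair
  of forms.\<close>

lemma quadratic_form_pair_transform:
  fixes E F G h k l a a' b b' :: real
  defines "Q P R S v w v' w' \<equiv> v * w * P + (v * w' + v' * w) * R + v' * w' * S"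
  shows "Q E F G a a a' a' * Q E F G b b b' b' - Q E F G a b a' b' * Q E F G a b a' b'
      = (a * b' - a' * b)^2 * (E * G - F * F)"
    and "Q E F G b b b' b' * Q h k l a a a' a' - 2 * (Q E F G a b a' b' * Q h k l a b a' b')
      + Q E F G a a a' a' * Q h k l b b b' b' = (a * b' - a' * b)^2 * (G * h - 2 * (F * k) + E * l)"
  unfolding Q_def by algebra+

text \<open>Kept apart from the normal field, because the future-directed normal is constructed from
  the immersion alone.\<close>

locale spacelike_immersion =
  fixes c :: real and S :: "(real^2) set" and X :: "real^2 \<Rightarrow> real^4"
  assumes c_pos: "c > 0" and open_S: "open S"
    and smooth_X: "smooth_on S X"
    and XX: "u \<in> S \<Longrightarrow> lorentz (X u) (X u) = 1 / c"
    and pos: "u \<in> S \<Longrightarrow> v \<noteq> 0 \<Longrightarrow> lorentz (dd v X u) (dd v X u) > 0"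
begin

lemmas diff = smooth_on_differentiable[OF _ open_S]

lemma dX_X: "u \<in> S \<Longrightarrow> lorentz (dd v X u) (X u) = 0"
  using dd_bilinear[OF bounded_bilinear_lorentz diff[OF smooth_X] diff[OF smooth_X], of u v]
    dd_const_on[OF open_S, of u "\<lambda>x. lorentz (X x) (X x)" "1/c" v] XX
  by (simp add: lorentz_commute[of "X u"])

lemma fff_pos: "u \<in> S \<Longrightarrow> fff X e1 e1 u > 0"
  using pos[of u e1] by (simp add: fff_def axis_eq_0_iff)

lemma fff_expand:
  assumes "u \<in> S"
  shows "fff X v w u = v$1 * w$1 * fff X e1 e1 u + (v$1 * w$2 + v$2 * w$1) * fff X e1 e2 u + v$2 * w$2 * fff X e2 e2 u"
  unfolding fff_def dd_real2[OF diff[OF smooth_X assms], of v] dd_real2[OF diff[OF smooth_X assms], of w]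
  by (simp add: lorentz_algebra lorentz_commute[of "dd e2 X u" "dd e1 X u"] algebra_simps)

lemma gram_det_pos: assumes "u \<in> S" shows "gram_det X u > 0"
proof -
  \<comment> \<open>Gram-Schmidt without division: \<open>w\<close> is \<open>E\<close> times the
    part of \<open>e2\<close> orthogonal to \<open>e1\<close>, and its square is \<open>E\<close>
    times the Gram determinant.\<close>
  define w where "w = fff X e1 e1 u *\<^sub>R e2 - fff X e1 e2 u *\<^sub>R e1"
  have w: "w $ 1 = - fff X e1 e2 u" "w $ 2 = fff X e1 e1 u"
    by (simp_all add: w_def e_nth)
  then have "w \<noteq> 0" using fff_pos[OF assms] by auto
  then have "fff X w w u > 0" using pos[OF assms] by (simp add: fff_def)
  also have "fff X w w u = fff X e1 e1 u * gram_det X u"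
    unfolding fff_expand[OF assms, of w w] w gram_det_def by (simp add: algebra_simps)
  finally show ?thesis using fff_pos[OF assms] by (simp add: zero_less_mult_iff)
qed

lemma dX_inj: "u \<in> S \<Longrightarrow> dd v X u = dd w X u \<Longrightarrow> v = w"
  using pos[of u "v - w"] linear_diff[OF linear_dd[OF diff[OF smooth_X]], of u v w]
  by (auto simp: lorentz_zero)

lemma smooth_fff: "smooth_on S (fff X v w)"
  unfolding fff_def[abs_def] by (intro smooth_on_lorentz open_S smooth_on_dd smooth_X)

lemma smooth_gram_det: "smooth_on S (gram_det X)"
  unfolding gram_det_def[abs_def] by (intro smooth_on_diff smooth_on_mult open_S smooth_fff)

end

locale spacelike_patch = spacelike_immersion +
  fixes N :: "real^2 \<Rightarrow> real^4"
  assumes smooth_N: "smooth_on S N"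
    and NN: "u \<in> S \<Longrightarrow> lorentz (N u) (N u) = - 1"
    and NX: "u \<in> S \<Longrightarrow> lorentz (N u) (X u) = 0"
    and NdX: "u \<in> S \<Longrightarrow> lorentz (N u) (dd v X u) = 0"
begin

lemma dN_N: "u \<in> S \<Longrightarrow> lorentz (dd v N u) (N u) = 0"
  using dd_bilinear[OF bounded_bilinear_lorentz diff[OF smooth_N] diff[OF smooth_N], of u v]
    dd_const_on[OF open_S, of u "\<lambda>x. lorentz (N x) (N x)" "-1" v] NN
  by (simp add: lorentz_commute[of "N u"])

lemma dN_X: "u \<in> S \<Longrightarrow> lorentz (dd v N u) (X u) = 0"
  using dd_bilinear[OF bounded_bilinear_lorentz diff[OF smooth_N] diff[OF smooth_X], of u v]
    dd_const_on[OF open_S, of u "\<lambda>x. lorentz (N x) (X x)" 0 v] NX NdX[of u v]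
  by simp

text \<open>Differentiating \<open><N, dX v> = 0\<close> moves the derivative from the normal to the
  immersion. The symmetry of second derivatives then becomes the symmetry of the shape
  operator.\<close>

lemma sff_eq: "u \<in> S \<Longrightarrow> sff X N v w u = lorentz (dd w (dd v X) u) (N u)"
  using dd_bilinear[OF bounded_bilinear_lorentz diff[OF smooth_N] diff[OF smooth_on_dd[OF smooth_X]], of u w v]
    dd_const_on[OF open_S, of u "\<lambda>x. lorentz (N x) (dd v X x)" 0 w] NdX[of _ v]
  by (simp add: sff_def lorentz_commute)

lemma sff_commute: "u \<in> S \<Longrightarrow> sff X N v w u = sff X N w v u"
  using dd_commute[OF open_S _ smooth_X] by (simp add: sff_eq)

lemma sff_expand:
  assumes "u \<in> S"
  shows "sff X N v w u = v$1 * w$1 * sff X N e1 e1 u + (v$1 * w$2 + v$2 * w$1) * sff X N e1 e2 u + v$2 * w$2 * sff X N e2 e2 u"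
proof -
  have "sff X N v w u = v$1 * w$1 * sff X N e1 e1 u + v$1 * w$2 * sff X N e1 e2 u + v$2 * w$1 * sff X N e2 e1 u + v$2 * w$2 * sff X N e2 e2 u"
    unfolding sff_def dd_real2[OF diff[OF smooth_X assms], of v] dd_real2[OF diff[OF smooth_N assms], of w]
    by (simp add: lorentz_algebra algebra_simps)
  then show ?thesis using sff_commute[OF assms, of e2 e1] by (simp add: algebra_simps)
qed

lemma frame_zero:
  assumes "u \<in> S" "lorentz z (X u) = 0" "lorentz z (N u) = 0" "lorentz z (dd e1 X u) = 0" "lorentz z (dd e2 X u) = 0"
  shows "z = 0"
  by (rule lorentz_frame_zero[of "X u" "N u" "dd e1 X u" "dd e2 X u"])
    (use assms gram_det_pos[OF assms(1)] c_pos XX NN NX dX_X NdX in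
      \<open>auto simp: gram_det_def fff_def power2_eq_square\<close>)

text \<open>Cramer's rule for the linear system
  \<open>fff X w (shape u v) u = sff X N w v u\<close>. This explicit solution replaces the
  \<open>THE\<close> in \<open>shape_operator\<close>.\<close>

definition shape :: "real^2 \<Rightarrow> real^2 \<Rightarrow> real^2" where
  "shape u v = ((fff X e2 e2 u * sff X N e1 v u - fff X e1 e2 u * sff X N e2 v u) / gram_det X u) *\<^sub>R e1
     + ((fff X e1 e1 u * sff X N e2 v u - fff X e1 e2 u * sff X N e1 v u) / gram_det X u) *\<^sub>R e2"

lemma shape_nth:
  "shape u v $ 1 = (fff X e2 e2 u * sff X N e1 v u - fff X e1 e2 u * sff X N e2 v u) / gram_det X u"
  "shape u v $ 2 = (fff X e1 e1 u * sff X N e2 v u - fff X e1 e2 u * sff X N e1 v u) / gram_det X u"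
  by (simp_all add: shape_def e_nth)

lemma fff_shape:
  assumes "u \<in> S" shows "fff X (shape u v) w u = sff X N w v u"
proof -
  have "fff X e1 (shape u v) u = sff X N e1 v u" "fff X e2 (shape u v) u = sff X N e2 v u"
    using gram_det_pos[OF assms]
    by (simp_all add: fff_expand[OF assms, of _ "shape u v"] shape_nth e_nth divide_simps)
       (simp_all add: gram_det_def algebra_simps)
  moreover have "fff X w (shape u v) u = w$1 * fff X e1 (shape u v) u + w$2 * fff X e2 (shape u v) u"
    unfolding fff_expand[OF assms, of _ "shape u v"] by (simp add: e_nth algebra_simps)
  ultimately have "fff X w (shape u v) u = w$1 * sff X N e1 v u + w$2 * sff X N e2 v u" by simp
  also have "\<dots> = sff X N w v u"
    unfolding sff_def dd_real2[OF diff[OF smooth_X assms], of w] by (simp add: lorentz_algebra)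
  finally show ?thesis by (simp add: fff_commute)
qed

text \<open>Weingarten's equation: both sides are orthogonal to \<open>X\<close> and
  \<open>N\<close> and have the same products with tangent vectors, so \<open>frame_zero\<close>
  applies to their difference.\<close>

lemma dN_eq: assumes "u \<in> S" shows "dd v N u = - dd (shape u v) X u"
proof -
  have "dd v N u + dd (shape u v) X u = 0"
    by (rule frame_zero[OF assms])
      (use fff_shape[OF assms, of v] in \<open>auto simp: lorentz_algebra dN_X dN_N dX_X assms NdX
         lorentz_commute[of "dd _ X u" "N u"] fff_def sff_def lorentz_commute[of "dd v N u" "dd _ X u"]\<close>)
  then show ?thesis by (simp add: eq_neg_iff_add_eq_0)
qed

lemma shape_operator_eq: assumes "u \<in> S" shows "shape_operator X N u v = shape u v"
proof -
  \<comment> \<open>The flat derivative of \<open>N\<close> is already orthogonal to the position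
    vector, so the projection in \<open>dS_connection\<close> changes nothing.\<close>
  have "dS_connection X N u v = dd v N u"
    using dN_X[OF assms, of v] by (simp add: dS_connection_def dd_def)
  then show ?thesis
    unfolding shape_operator_def dd_def[symmetric]
    by (intro the_equality) (auto simp: dN_eq[OF assms] intro: dX_inj[OF assms])
qed

lemma mean_curvature_eq: assumes "u \<in> S" shows "mean_curvature X N u = - tr_shape X N u / 2"
proof -
  have "trace (matrix (shape_operator X N u)) = shape u e1 $ 1 + shape u e2 $ 2"
    by (simp add: trace_def matrix_def sum_2 shape_operator_eq[OF assms])
  also have "\<dots> = tr_shape X N u"
    using sff_commute[OF assms, of e2 e1] unfolding shape_nth tr_shape_def
    by (simp flip: add_divide_distrib)
  finally show ?thesis by (simp add: mean_curvature_def)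
qed

lemma smooth_sff: "smooth_on S (sff X N v w)"
  unfolding sff_def[abs_def] by (intro smooth_on_minus smooth_on_lorentz open_S smooth_on_dd smooth_X smooth_N)

lemma smooth_tr_shape: "smooth_on S (tr_shape X N)"
  unfolding tr_shape_def[abs_def] using gram_det_pos
  by (intro smooth_on_divide smooth_on_add smooth_on_diff smooth_on_mult smooth_on_const open_S smooth_fff smooth_sff smooth_gram_det)
    force

lemma smooth_det_shape: "smooth_on S (det_shape X N)"
  unfolding det_shape_def[abs_def] using gram_det_pos
  by (intro smooth_on_divide smooth_on_diff smooth_on_mult open_S smooth_sff smooth_gram_det) force

text \<open>In an orthonormal basis the discriminant is \<open>(h11 - h22)^2 + 4 * h12^2\<close>.
  The right side is this sum of squares for the orthonormalization of \<open>e1\<close> and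
  \<open>E e2 - F e1\<close>, multiplied by \<open>(E * D)^2\<close> to clear denominators.\<close>

lemma discriminant:
  assumes "u \<in> S"
  defines "E \<equiv> fff X e1 e1 u" and "F \<equiv> fff X e1 e2 u" and "G \<equiv> fff X e2 e2 u"
    and "h11 \<equiv> sff X N e1 e1 u" and "h12 \<equiv> sff X N e1 e2 u" and "h22 \<equiv> sff X N e2 e2 u"
  shows "(E * gram_det X u)^2 * ((tr_shape X N u)^2 - 4 * det_shape X N u) =
    (E * (E * h22 - G * h11) - 2 * F * (E * h12 - F * h11))^2 + 4 * (E * h12 - F * h11)^2 * gram_det X u"
proof -
  define D where "D = gram_det X u"
  have D: "D > 0" "D = E * G - F * F" using gram_det_pos[OF assms(1)] by (auto simp: D_def gram_det_def E_def F_def G_def)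
  have td: "tr_shape X N u * D = G * h11 - 2 * (F * h12) + E * h22" "det_shape X N u * D = h11 * h22 - h12 * h12"
    using D(1) by (simp_all add: tr_shape_def det_shape_def D_def E_def F_def G_def h11_def h12_def h22_def)
  have "(E * D)^2 * ((tr_shape X N u)^2 - 4 * det_shape X N u)
      = E^2 * ((tr_shape X N u * D)^2 - 4 * (det_shape X N u * D) * D)"
    by (simp add: algebra_simps power2_eq_square)
  then show ?thesis unfolding D_def[symmetric] td
    by (simp add: D(2) algebra_simps power2_eq_square)
qed

lemma discriminant_nonneg: assumes "u \<in> S" shows "4 * det_shape X N u \<le> (tr_shape X N u)^2"
proof -
  have "(fff X e1 e1 u * gram_det X u)^2 * ((tr_shape X N u)^2 - 4 * det_shape X N u) \<ge> 0"
    unfolding discriminant[OF assms] using gram_det_pos[OF assms] by auto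
  then show ?thesis using gram_det_pos[OF assms] fff_pos[OF assms] by (auto simp: zero_le_mult_iff)
qed

text \<open>Both squares in \<open>discriminant\<close> vanish, which makes the second fundamental
  form a multiple of the first, with factor \<open>h11 / E\<close>.\<close>

lemma umbilic:
  assumes "u \<in> S" "(tr_shape X N u)^2 = 4 * det_shape X N u"
  shows "\<exists>\<mu>. \<forall>v. shape_operator X N u v = \<mu> *\<^sub>R v"
proof -
  define E F G where "E = fff X e1 e1 u" and "F = fff X e1 e2 u" and "G = fff X e2 e2 u"
  define h11 h12 h22 where "h11 = sff X N e1 e1 u" and "h12 = sff X N e1 e2 u" and "h22 = sff X N e2 e2 u"
  note defs = E_def F_def G_def h11_def h12_def h22_def
  have E: "E > 0" and D: "gram_det X u > 0" using assms fff_pos gram_det_pos by (auto simp: defs)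
  have "(E * (E * h22 - G * h11) - 2 * F * (E * h12 - F * h11))^2 + 4 * (E * h12 - F * h11)^2 * gram_det X u = 0"
    using discriminant[OF assms(1)] assms(2) by (simp add: defs)
  then have "(E * (E * h22 - G * h11) - 2 * F * (E * h12 - F * h11))^2 = 0 \<and> 4 * (E * h12 - F * h11)^2 * gram_det X u = 0"
    using D by (subst (asm) add_nonneg_eq_0_iff) auto
  then have "E * h12 = F * h11" and "E * (E * h22 - G * h11) = 2 * F * (E * h12 - F * h11)"
    using D by auto
  then have *: "E * h12 = F * h11" "E * h22 = G * h11" using E by auto
  define \<mu> where "\<mu> = h11 / E"
  have "h11 = \<mu> * E" "h12 = \<mu> * F" "h22 = \<mu> * G" using E *  by (auto simp: \<mu>_def field_simps)
  then have s: "sff X N v w u = \<mu> * fff X v w u" for v w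
    unfolding sff_expand[OF assms(1), of v w] fff_expand[OF assms(1), of v w]
    by (simp add: defs[symmetric] algebra_simps)
  have "shape_operator X N u v = \<mu> *\<^sub>R v" for v
  proof -
    have "fff X (shape u v - \<mu> *\<^sub>R v) w u = 0" for w
      using fff_shape[OF assms(1), of v w] s[of w v] fff_commute[of X v w u]
      unfolding fff_def by (simp add: linear_diff[OF linear_dd[OF diff[OF smooth_X assms(1)]]]
        linear_cmul[OF linear_dd[OF diff[OF smooth_X assms(1)]]] lorentz_algebra)
    then have "shape u v - \<mu> *\<^sub>R v = 0" using pos[OF assms(1)] unfolding fff_def by fastforce
    then show ?thesis by (simp add: shape_operator_eq[OF assms(1)])
  qed
  then show ?thesis by blast
qed

section \<open>Invariance under change of coordinates\<close>

lemma reparametrize: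
  assumes T: "open T" and g: "smooth_on T g" and im: "\<And>x. x \<in> T \<Longrightarrow> g x \<in> S"
    and inj: "\<And>x v. x \<in> T \<Longrightarrow> v \<noteq> 0 \<Longrightarrow> dd v g x \<noteq> 0"
  shows "spacelike_patch c T (\<lambda>x. X (g x)) (\<lambda>x. N (g x))"
proof -
  have 1: "dd v (\<lambda>x. X (g x)) u = dd (dd v g u) X (g u)" if "u \<in> T" for v u
    using smooth_on_differentiable[OF g T that] diff[OF smooth_X im[OF that]] by (rule dd_compose(1))
  show ?thesis
    by (intro spacelike_patch.intro spacelike_immersion.intro spacelike_patch_axioms.intro)
      (simp_all add: 1 im inj c_pos T XX NN NX NdX pos smooth_on_compose[OF T open_S _ g im] smooth_X smooth_N)
qed

text \<open>Numerators and denominator in \<open>tr_shape\<close> and \<open>det_shape\<close> all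
  pick up the squared Jacobian determinant of \<open>g\<close>, which cancels.\<close>

lemma shape_reparametrize:
  assumes x: "g x \<in> S" and g: "g differentiable (at x)"
    and inj: "\<And>v. v \<noteq> 0 \<Longrightarrow> dd v g x \<noteq> 0"
  shows "tr_shape (\<lambda>x. X (g x)) (\<lambda>x. N (g x)) x = tr_shape X N (g x)"
    and "det_shape (\<lambda>x. X (g x)) (\<lambda>x. N (g x)) x = det_shape X N (g x)"
proof -
  have X: "dd v (\<lambda>x. X (g x)) x = dd (dd v g x) X (g x)" for v
    using g diff[OF smooth_X x] by (rule dd_compose(1))
  have N: "dd v (\<lambda>x. N (g x)) x = dd (dd v g x) N (g x)" for v
    using g diff[OF smooth_N x] by (rule dd_compose(1))
  have f: "fff (\<lambda>x. X (g x)) v w x = fff X (dd v g x) (dd w g x) (g x)" for v w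
    by (simp add: fff_def X)
  have s: "sff (\<lambda>x. X (g x)) (\<lambda>x. N (g x)) v w x = sff X N (dd v g x) (dd w g x) (g x)" for v w
    by (simp add: sff_def X N)
  define a1 a2 b1 b2 where "a1 = dd e1 g x $ 1" and "a2 = dd e1 g x $ 2" and "b1 = dd e2 g x $ 1" and "b2 = dd e2 g x $ 2"
  note ab = a1_def[symmetric] a2_def[symmetric] b1_def[symmetric] b2_def[symmetric]
  \<comment> \<open>If the Jacobian determinant vanished, \<open>b2 e1 - a2 e2\<close> and
    \<open>b1 e1 - a1 e2\<close> would lie in the kernel of the derivative. By injectivity both are
    zero, hence \<open>dd e1 g x = 0\<close>, which injectivity excludes as well.\<close>
  have "a1 * b2 - a2 * b1 \<noteq> 0"
  proof
    assume *: "a1 * b2 - a2 * b1 = 0"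
    have lin: "dd v g x = v $ 1 *\<^sub>R dd e1 g x + v $ 2 *\<^sub>R dd e2 g x" for v by (rule dd_real2[OF g])
    have 1: "dd (b2 *\<^sub>R e1 - a2 *\<^sub>R e2) g x = 0"
      using * unfolding lin[of "b2 *\<^sub>R e1 - a2 *\<^sub>R e2"] by (simp add: vec_eq_iff forall_2 e_nth ab algebra_simps)
    have 2: "dd (b1 *\<^sub>R e1 - a1 *\<^sub>R e2) g x = 0"
      using * unfolding lin[of "b1 *\<^sub>R e1 - a1 *\<^sub>R e2"] by (simp add: vec_eq_iff forall_2 e_nth ab algebra_simps)
    have "b2 *\<^sub>R e1 - a2 *\<^sub>R e2 = 0" "b1 *\<^sub>R e1 - a1 *\<^sub>R e2 = 0" using inj 1 2 by blast+
    then have "a1 = 0" "a2 = 0" by (auto simp: vec_eq_iff forall_2 e_nth)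
    then have "dd e1 g x = 0" by (simp add: vec_eq_iff forall_2 ab)
    then show False using inj[of e1] by (simp add: axis_eq_0_iff)
  qed
  then have d: "(a1 * b2 - a2 * b1)^2 \<noteq> 0" by simp
  have gd: "gram_det (\<lambda>x. X (g x)) x = (a1 * b2 - a2 * b1)^2 * gram_det X (g x)"
    unfolding gram_det_def f fff_expand[OF x, of "dd _ g x"] ab by (rule quadratic_form_pair_transform)
  have num: "fff (\<lambda>x. X (g x)) e2 e2 x * sff (\<lambda>x. X (g x)) (\<lambda>x. N (g x)) e1 e1 x
     - 2 * (fff (\<lambda>x. X (g x)) e1 e2 x * sff (\<lambda>x. X (g x)) (\<lambda>x. N (g x)) e1 e2 x)
     + fff (\<lambda>x. X (g x)) e1 e1 x * sff (\<lambda>x. X (g x)) (\<lambda>x. N (g x)) e2 e2 x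
    = (a1 * b2 - a2 * b1)^2 * (fff X e2 e2 (g x) * sff X N e1 e1 (g x) - 2 * (fff X e1 e2 (g x) * sff X N e1 e2 (g x))
     + fff X e1 e1 (g x) * sff X N e2 e2 (g x))"
    unfolding f s fff_expand[OF x, of "dd _ g x"] sff_expand[OF x, of "dd _ g x"] ab
    by (rule quadratic_form_pair_transform)
  show "tr_shape (\<lambda>x. X (g x)) (\<lambda>x. N (g x)) x = tr_shape X N (g x)"
    unfolding tr_shape_def gd num using d by simp
  have num2: "sff (\<lambda>x. X (g x)) (\<lambda>x. N (g x)) e1 e1 x * sff (\<lambda>x. X (g x)) (\<lambda>x. N (g x)) e2 e2 x
     - sff (\<lambda>x. X (g x)) (\<lambda>x. N (g x)) e1 e2 x * sff (\<lambda>x. X (g x)) (\<lambda>x. N (g x)) e1 e2 x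
    = (a1 * b2 - a2 * b1)^2 * (sff X N e1 e1 (g x) * sff X N e2 e2 (g x) - sff X N e1 e2 (g x) * sff X N e1 e2 (g x))"
    unfolding s sff_expand[OF x, of "dd _ g x"] ab by (rule quadratic_form_pair_transform)
  show "det_shape (\<lambda>x. X (g x)) (\<lambda>x. N (g x)) x = det_shape X N (g x)"
    unfolding det_shape_def gd num2 using d by simp
qed

end

subsection \<open>Simons' inequality\<close>

text \<open>In normal coordinates \<open>Eij\<close>, \<open>Fij\<close>, \<open>Gij\<close> are second derivatives of the metric and \<open>aij\<close>, \<open>bij\<close>,
  \<open>lij\<close> those of \<open>h11\<close>, \<open>h12\<close>, \<open>h22\<close>. The tangential third derivatives \<open>T\<close> and the normal fourth
  derivatives \<open>Q\<close> of the immersion cancel, so no curvature tensor has to be introduced.\<close>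

lemma simons_algebra:
  fixes c :: real and h11 h12 h22 :: real and T1111 :: real
  assumes
    E11: "E11 = 2*T1111 + 2*(c - h11*h11)" and E12: "E12 = 2*T1121 + 2*(- h11*h12)" and E22: "E22 = 2*T1221 + 2*(- h12*h12)"
    and F11: "F11 = T1121 + T1112 + 2*(- h11*h12)" and F12: "F12 = T1221 + T1122 + (c - h11*h22) + (- h12*h12)"
    and F22: "F22 = T2221 + T1222 + 2*(- h12*h22)"
    and G11: "G11 = 2*T1122 + 2*(- h12*h12)" and G12: "G12 = 2*T1222 + 2*(- h12*h22)" and G22: "G22 = 2*T2222 + 2*(c - h22*h22)"
    and a11: "a11 = Q1111 - 2*(h11*T1111 + h12*T1112) - c*h11 + h11*(h11*h11+h12*h12)"
    and a12: "a12 = Q1112 - (h12*T1111 + h22*T1112) - (h11*T1121+h12*T1122) - c*h12 + h11*(h11*h12+h12*h22)"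
    and a22: "a22 = Q1122 - 2*(h12*T1121 + h22*T1122) - c*h22 + h11*(h12*h12+h22*h22)"
    and b11: "b11 = Q1112 - 2*(h11*T1121 + h12*T1122) + h12*(h11*h11+h12*h12)"
    and b22: "b22 = Q1222 - 2*(h12*T1221 + h22*T1222) + h12*(h12*h12+h22*h22)"
    and l11: "l11 = Q1122 - 2*(h11*T1221 + h12*T1222) - c*h11 + h22*(h11*h11+h12*h12)"
    and l12: "l12 = Q1222 - (h12*T1221 + h22*T1222) - (h11*T2221+h12*T2222) - c*h12 + h22*(h11*h12+h12*h22)"
    and l22: "l22 = Q2222 - 2*(h12*T2221 + h22*T2222) - c*h22 + h22*(h12*h12+h22*h22)"
    and t: "t = h11 + h22" and d: "d = h11*h22 - h12*h12"
    and t11: "t11 = a11 + l11 - E11*h11 - 2*F11*h12 - G11*h22"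
    and t12: "t12 = a12 + l12 - E12*h11 - 2*F12*h12 - G12*h22"
    and t22: "t22 = a22 + l22 - E22*h11 - 2*F22*h12 - G22*h22"
    and d11: "d11 = a11*h22 + 2*h11_1*h22_1 + h11*l11 - 2*h12_1*h12_1 - 2*h12*b11 - d*(E11+G11)"
    and d22: "d22 = a22*h22 + 2*h11_2*h22_2 + h11*l22 - 2*h12_2*h12_2 - 2*h12*b22 - d*(E22+G22)"
  shows "t*(t11+t22) + (h11_1+h22_1)^2 + (h11_2+h22_2)^2 - (d11+d22) =
    (h11_1^2 + h22_1^2 + 2*h12_1^2 + h11_2^2 + h22_2^2 + 2*h12_2^2) + (h11*t11 + 2*h12*t12 + h22*t22)
     + (c-d)*(t^2-4*d)"
  unfolding t11 t12 t22 d11 d22 a11 a12 a22 b11 b22 l11 l12 l22 t d E11 E12 E22 F11 F12 F22 G11 G12 G22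
  by (simp add: algebra_simps power2_eq_square)


text \<open>\<open>ddX_tangent\<close> says that the Christoffel symbols vanish at \<open>p\<close>.
  Together with the orthonormality of \<open>e1\<close>, \<open>e2\<close> it makes coordinate
  Hessian and Laplacian at \<open>p\<close> equal to the covariant ones.\<close>

locale normal_patch = spacelike_patch +
  fixes p
  assumes p_in: "p \<in> S"
    and fff_p: "fff X e1 e1 p = 1" "fff X e1 e2 p = 0" "fff X e2 e2 p = 1"
    and ddX_tangent: "lorentz (dd w (dd v X) p) (dd y X p) = 0"
begin

abbreviation "h v w \<equiv> sff X N v w p"

lemma frame_expand:
  "z = (c * lorentz z (X p)) *\<^sub>R X p - lorentz z (N p) *\<^sub>R N p
     + lorentz z (dd e1 X p) *\<^sub>R dd e1 X p + lorentz z (dd e2 X p) *\<^sub>R dd e2 X p"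
  by (rule lorentz_frame_expand)
    (use c_pos p_in fff_p in \<open>auto simp: XX NN NX NdX dX_X fff_def\<close>)

lemma ddX_X: "u \<in> S \<Longrightarrow> lorentz (dd w (dd v X) u) (X u) = - fff X v w u"
  using dd_lorentz[OF diff[OF smooth_on_dd[OF smooth_X]] diff[OF smooth_X], of u w v]
    dd_const_on[OF open_S, of u "\<lambda>x. lorentz (dd v X x) (X x)" 0 w] dX_X[of _ v]
  by (simp add: fff_def lorentz_commute)

text \<open>The Gauss formula, whose tangential part is zero at the centre of normal
  coordinates.\<close>

lemma ddX_eq: "dd w (dd v X) p = - (c * fff X v w p) *\<^sub>R X p - h v w *\<^sub>R N p"
  by (subst frame_expand[of "dd w (dd v X) p"]) (simp add: ddX_tangent ddX_X[OF p_in] sff_eq[OF p_in])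

lemma dN_eq_p: "dd v N p = - h e1 v *\<^sub>R dd e1 X p - h e2 v *\<^sub>R dd e2 X p"
  by (subst frame_expand[of "dd v N p"])
    (simp add: dN_X[OF p_in] dN_N[OF p_in] sff_def lorentz_commute[of "dd v N p"])

lemma dN_dN: "lorentz (dd v N p) (dd w N p) = h e1 v * h e1 w + h e2 v * h e2 w"
  using fff_p unfolding dN_eq_p fff_def by (simp add: lorentz_algebra lorentz_commute[of "dd e2 X p" "dd e1 X p"])

lemma ddN_N: "lorentz (dd w (dd v N) p) (N p) = - (h e1 v * h e1 w + h e2 v * h e2 w)"
  using dd_lorentz[OF diff[OF smooth_on_dd[OF smooth_N]] diff[OF smooth_N], of p w v]
    dd_const_on[OF open_S p_in, of "\<lambda>x. lorentz (dd v N x) (N x)" 0 w] dN_N[of _ v] p_in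
  by (simp add: dN_dN)

lemma ddN_X: "lorentz (dd w (dd v N) p) (X p) = h v w"
  using dd_lorentz[OF diff[OF smooth_on_dd[OF smooth_N]] diff[OF smooth_X], of p w v]
    dd_const_on[OF open_S p_in, of "\<lambda>x. lorentz (dd v N x) (X x)" 0 w] dN_X[of _ v] p_in
    sff_commute[OF p_in, of v w]
  by (simp add: sff_def lorentz_commute[of "dd v N p"])

definition "T v w y z = lorentz (dd y (dd w (dd v X)) p) (dd z X p)"
definition "Q v w y z = lorentz (dd z (dd y (dd w (dd v X))) p) (N p)"

lemma T_commute: "T v w y z = T w v y z" "T v w y z = T v y w z"
  using dd_smooth_commute(1)[OF open_S p_in smooth_X] dd_commute[OF open_S p_in smooth_on_dd[OF smooth_X]]
  by (simp_all add: T_def)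

lemma Q_commute: "Q v w y z = Q w v y z" "Q v w y z = Q v y w z" "Q v w y z = Q v w z y"
  using dd_smooth_commute(2)[OF open_S p_in smooth_X] dd_smooth_commute(1)[OF open_S p_in smooth_on_dd[OF smooth_X]]
    dd_commute[OF open_S p_in smooth_on_dd[OF smooth_on_dd[OF smooth_X]]]
  by (simp_all add: Q_def)

lemma dd_fff: "dd y (fff X v w) p = 0"
  unfolding fff_def[abs_def]
  by (subst dd_lorentz) (auto simp: ddX_tangent lorentz_commute[of "dd v X p"] intro: diff smooth_on_dd smooth_X p_in)

lemma dd2_fff: "dd z (dd y (fff X v w)) p = T w y z v + T v y z w
    + (c * fff X v z p * fff X w y p - h v z * h w y) + (c * fff X v y p * fff X w z p - h v y * h w z)"
proof -
  \<comment> \<open>Second derivatives of \<open>X\<close> at \<open>p\<close> have only components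
    along \<open>X\<close> and \<open>N\<close>, of squares \<open>1 / c\<close> and
    \<open>- 1\<close>. This is where the Gauss equation enters.\<close>
  have "lorentz (dd a (dd b X) p) (dd a' (dd b' X) p) = c * fff X b a p * fff X b' a' p - h b a * h b' a'" for a b a' b'
    unfolding ddX_eq using XX[OF p_in] NN[OF p_in] NX[OF p_in] c_pos
    by (simp add: lorentz_algebra lorentz_commute[of "X p" "N p"])
  then show ?thesis
    unfolding fff_def[abs_def]
    by (subst dd2_lorentz[OF open_S p_in])
      (auto simp: T_def lorentz_commute[of "dd v X p"] intro: smooth_on_dd smooth_X)
qed

text \<open>Starting from \<open>sff_eq\<close>, fourth derivatives of \<open>X\<close> occur only
  through their normal part \<open>Q\<close>; the derivatives of \<open>N\<close> are eliminated by
  Weingarten's equation and by differentiating the constraints on \<open>N\<close>.\<close>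

lemma dd2_sff: "dd z (dd y (sff X N v w)) p = Q v w y z - (h e1 z * T v w y e1 + h e2 z * T v w y e2)
    - (h e1 y * T v w z e1 + h e2 y * T v w z e2) - c * fff X v w p * h y z
    + h v w * (h e1 y * h e1 z + h e2 y * h e2 z)"
proof -
  have "dd z (dd y (sff X N v w)) p = dd z (dd y (\<lambda>u. lorentz (dd w (dd v X) u) (N u))) p"
    by (rule dd2_cong[OF open_S p_in sff_eq])
  also have "\<dots> = lorentz (dd w (dd v X) p) (dd z (dd y N) p) + lorentz (dd z (dd w (dd v X)) p) (dd y N p)
     + (lorentz (dd y (dd w (dd v X)) p) (dd z N p) + Q v w y z)"
    by (subst dd2_lorentz[OF open_S p_in]) (auto simp: Q_def intro: smooth_on_dd smooth_X smooth_N)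
  also have "lorentz (dd w (dd v X) p) (dd z (dd y N) p)
      = - c * fff X v w p * h y z + h v w * (h e1 y * h e1 z + h e2 y * h e2 z)"
    unfolding ddX_eq using ddN_N[of z y] ddN_X[of z y]
    by (simp add: lorentz_algebra lorentz_commute[of "X p"] lorentz_commute[of "N p"])
      (simp add: algebra_simps)
  finally show ?thesis
    unfolding dN_eq_p T_def by (simp add: lorentz_algebra)
qed

lemma gram_p: "gram_det X p = 1" "dd v (gram_det X) p = 0"
  "dd w (dd v (gram_det X)) p = dd w (dd v (fff X e1 e1)) p + dd w (dd v (fff X e2 e2)) p"
proof -
  note sm = smooth_fff smooth_on_mult[OF open_S] smooth_on_diff[OF open_S]
  show "gram_det X p = 1" by (simp add: gram_det_def fff_p)
  show "dd v (gram_det X) p = 0"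
    unfolding gram_det_def[abs_def]
    by (subst dd_diff dd_mult; (intro diff sm p_in)?)+ (simp add: dd_fff)
  show "dd w (dd v (gram_det X)) p = dd w (dd v (fff X e1 e1)) p + dd w (dd v (fff X e2 e2)) p"
    unfolding gram_det_def[abs_def]
    by (subst dd2_diff[OF open_S p_in] dd2_mult[OF open_S p_in]; (intro sm)?)+ (simp add: dd_fff fff_p)
qed

lemma tr_shape_p:
  shows "tr_shape X N p = h e1 e1 + h e2 e2"
    and "dd v (tr_shape X N) p = dd v (sff X N e1 e1) p + dd v (sff X N e2 e2) p"
    and "dd w (dd v (tr_shape X N)) p = dd w (dd v (sff X N e1 e1)) p + dd w (dd v (sff X N e2 e2)) p
      - dd w (dd v (fff X e1 e1)) p * h e1 e1 - 2 * dd w (dd v (fff X e1 e2)) p * h e1 e2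
      - dd w (dd v (fff X e2 e2)) p * h e2 e2"
proof -
  note sm = smooth_fff smooth_sff smooth_on_mult[OF open_S] smooth_on_diff[OF open_S] smooth_on_add[OF open_S]
    smooth_gram_det smooth_tr_shape
  show tp: "tr_shape X N p = h e1 e1 + h e2 e2" by (simp add: tr_shape_def gram_p fff_p)
  \<comment> \<open>Differentiating the product with \<open>gram_det\<close> avoids the quotient
    rule; at \<open>p\<close> that factor is 1 and its first derivatives vanish. The mixed term is
    written twice to leave only products, sums and differences.\<close>
  have eq: "tr_shape X N u * gram_det X u = fff X e2 e2 u * sff X N e1 e1 u
      - (fff X e1 e2 u * sff X N e1 e2 u + fff X e1 e2 u * sff X N e1 e2 u) + fff X e1 e1 u * sff X N e2 e2 u" if "u \<in> S" for u
    using gram_det_pos[OF that] by (simp add: tr_shape_def)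
  have "dd v (tr_shape X N) p = dd v (\<lambda>u. tr_shape X N u * gram_det X u) p"
    by (subst dd_mult) (auto intro!: diff sm p_in simp: gram_p)
  also have "\<dots> = dd v (\<lambda>u. fff X e2 e2 u * sff X N e1 e1 u
      - (fff X e1 e2 u * sff X N e1 e2 u + fff X e1 e2 u * sff X N e1 e2 u) + fff X e1 e1 u * sff X N e2 e2 u) p"
    by (rule dd_cong[OF open_S p_in eq])
  also have "\<dots> = dd v (sff X N e1 e1) p + dd v (sff X N e2 e2) p"
    by (subst dd_diff dd_add dd_mult; (intro diff sm p_in)?)+ (simp add: dd_fff fff_p)
  finally show "dd v (tr_shape X N) p = dd v (sff X N e1 e1) p + dd v (sff X N e2 e2) p" .
  have "dd w (dd v (\<lambda>u. tr_shape X N u * gram_det X u)) p =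
     dd w (dd v (\<lambda>u. fff X e2 e2 u * sff X N e1 e1 u
      - (fff X e1 e2 u * sff X N e1 e2 u + fff X e1 e2 u * sff X N e1 e2 u) + fff X e1 e1 u * sff X N e2 e2 u)) p"
    by (rule dd2_cong[OF open_S p_in eq])
  also have "\<dots> = dd w (dd v (fff X e2 e2)) p * h e1 e1 + dd w (dd v (sff X N e1 e1)) p
      - 2 * dd w (dd v (fff X e1 e2)) p * h e1 e2
      + dd w (dd v (fff X e1 e1)) p * h e2 e2 + dd w (dd v (sff X N e2 e2)) p"
    by (subst dd2_diff[OF open_S p_in] dd2_add[OF open_S p_in] dd2_mult[OF open_S p_in]; (intro sm)?)+
      (simp add: dd_fff fff_p)
  also have "dd w (dd v (\<lambda>u. tr_shape X N u * gram_det X u)) p =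
     dd w (dd v (tr_shape X N)) p + (h e1 e1 + h e2 e2) * (dd w (dd v (fff X e1 e1)) p + dd w (dd v (fff X e2 e2)) p)"
    by (subst dd2_mult[OF open_S p_in]; (intro sm)?) (simp add: gram_p tp)
  finally show "dd w (dd v (tr_shape X N)) p = dd w (dd v (sff X N e1 e1)) p + dd w (dd v (sff X N e2 e2)) p
      - dd w (dd v (fff X e1 e1)) p * h e1 e1 - 2 * dd w (dd v (fff X e1 e2)) p * h e1 e2
      - dd w (dd v (fff X e2 e2)) p * h e2 e2"
    by (simp add: algebra_simps)
qed

lemma det_shape_p:
  shows "det_shape X N p = h e1 e1 * h e2 e2 - h e1 e2 * h e1 e2"
    and "dd v (dd v (det_shape X N)) p = dd v (dd v (sff X N e1 e1)) p * h e2 e2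
      + 2 * dd v (sff X N e1 e1) p * dd v (sff X N e2 e2) p + h e1 e1 * dd v (dd v (sff X N e2 e2)) p
      - 2 * dd v (sff X N e1 e2) p * dd v (sff X N e1 e2) p - 2 * h e1 e2 * dd v (dd v (sff X N e1 e2)) p
      - (h e1 e1 * h e2 e2 - h e1 e2 * h e1 e2) * (dd v (dd v (fff X e1 e1)) p + dd v (dd v (fff X e2 e2)) p)"
proof -
  note sm = smooth_sff smooth_on_mult[OF open_S] smooth_on_diff[OF open_S] smooth_gram_det smooth_det_shape
  show dp: "det_shape X N p = h e1 e1 * h e2 e2 - h e1 e2 * h e1 e2" by (simp add: det_shape_def gram_p)
  have eq: "det_shape X N u * gram_det X u = sff X N e1 e1 u * sff X N e2 e2 u - sff X N e1 e2 u * sff X N e1 e2 u" if "u \<in> S" for u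
    using gram_det_pos[OF that] by (simp add: det_shape_def)
  have "dd v (dd v (\<lambda>u. det_shape X N u * gram_det X u)) p =
     dd v (dd v (\<lambda>u. sff X N e1 e1 u * sff X N e2 e2 u - sff X N e1 e2 u * sff X N e1 e2 u)) p"
    by (rule dd2_cong[OF open_S p_in eq])
  also have "\<dots> = dd v (dd v (sff X N e1 e1)) p * h e2 e2
      + 2 * dd v (sff X N e1 e1) p * dd v (sff X N e2 e2) p + h e1 e1 * dd v (dd v (sff X N e2 e2)) p
      - 2 * dd v (sff X N e1 e2) p * dd v (sff X N e1 e2) p - 2 * h e1 e2 * dd v (dd v (sff X N e1 e2)) p"
    by (subst dd2_diff[OF open_S p_in] dd2_mult[OF open_S p_in]; (intro sm)?)+ simp
  also have "dd v (dd v (\<lambda>u. det_shape X N u * gram_det X u)) p =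
     dd v (dd v (det_shape X N)) p + (h e1 e1 * h e2 e2 - h e1 e2 * h e1 e2) * (dd v (dd v (fff X e1 e1)) p + dd v (dd v (fff X e2 e2)) p)"
    by (subst dd2_mult[OF open_S p_in]; (intro sm)?) (simp add: gram_p dp)
  finally show "dd v (dd v (det_shape X N)) p = dd v (dd v (sff X N e1 e1)) p * h e2 e2
      + 2 * dd v (sff X N e1 e1) p * dd v (sff X N e2 e2) p + h e1 e1 * dd v (dd v (sff X N e2 e2)) p
      - 2 * dd v (sff X N e1 e2) p * dd v (sff X N e1 e2) p - 2 * h e1 e2 * dd v (dd v (sff X N e1 e2)) p
      - (h e1 e1 * h e2 e2 - h e1 e2 * h e1 e2) * (dd v (dd v (fff X e1 e1)) p + dd v (dd v (fff X e2 e2)) p)"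
    by (simp add: algebra_simps)
qed

text \<open>What is dropped is \<open>|nabla A|^2\<close>, the sum of the squared first derivatives
  of the coefficients of \<open>sff\<close>. The Codazzi equations and the commutation of covariant
  derivatives enter through the symmetries of \<open>T\<close> and \<open>Q\<close>.\<close>

lemma simons_inequality:
  defines "t \<equiv> tr_shape X N" and "d \<equiv> det_shape X N"
  shows "(h e1 e1 * dd e1 (dd e1 t) p + 2 * h e1 e2 * dd e2 (dd e1 t) p + h e2 e2 * dd e2 (dd e2 t) p)
     + (c - d p) * ((t p)^2 - 4 * d p)
    \<le> t p * (dd e1 (dd e1 t) p + dd e2 (dd e2 t) p) + (dd e1 t p)^2 + (dd e2 t p)^2
      - (dd e1 (dd e1 d) p + dd e2 (dd e2 d) p)"
proof -
  have hc: "h e2 e1 = h e1 e2" by (rule sff_commute[OF p_in])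
  have fc: "fff X e2 e1 p = 0" using fff_p fff_commute by metis
  have T: "T e2 e1 e1 z = T e1 e1 e2 z" "T e1 e2 e1 z = T e1 e1 e2 z" "T e2 e1 e2 z = T e1 e2 e2 z" "T e2 e2 e1 z = T e1 e2 e2 z" for z
    using T_commute by metis+
  have Q: "Q e1 e1 e2 e1 = Q e1 e1 e1 e2" "Q e1 e2 e1 e1 = Q e1 e1 e1 e2" "Q e2 e2 e1 e1 = Q e1 e1 e2 e2"
    "Q e1 e2 e2 e1 = Q e1 e1 e2 e2" "Q e2 e2 e1 e2 = Q e1 e2 e2 e2" "Q e2 e2 e2 e1 = Q e1 e2 e2 e2"
    using Q_commute by metis+
  have "t p * (dd e1 (dd e1 t) p + dd e2 (dd e2 t) p) + (dd e1 t p)^2 + (dd e2 t p)^2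
      - (dd e1 (dd e1 d) p + dd e2 (dd e2 d) p) =
     ((dd e1 (sff X N e1 e1) p)^2 + (dd e1 (sff X N e2 e2) p)^2 + 2 * (dd e1 (sff X N e1 e2) p)^2
      + (dd e2 (sff X N e1 e1) p)^2 + (dd e2 (sff X N e2 e2) p)^2 + 2 * (dd e2 (sff X N e1 e2) p)^2)
     + (h e1 e1 * dd e1 (dd e1 t) p + 2 * h e1 e2 * dd e2 (dd e1 t) p + h e2 e2 * dd e2 (dd e2 t) p)
     + (c - d p) * ((t p)^2 - 4 * d p)"
    unfolding t_def d_def tr_shape_p(2)
    by (rule simons_algebra[where ?T1111.0="T e1 e1 e1 e1" and ?T1112.0="T e1 e1 e1 e2" and ?T1121.0="T e1 e1 e2 e1"
        and ?T1122.0="T e1 e1 e2 e2" and ?T1221.0="T e1 e2 e2 e1" and ?T1222.0="T e1 e2 e2 e2"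
        and ?T2221.0="T e2 e2 e2 e1" and ?T2222.0="T e2 e2 e2 e2" and ?Q1111.0="Q e1 e1 e1 e1" and ?Q1112.0="Q e1 e1 e1 e2"
        and ?Q1122.0="Q e1 e1 e2 e2" and ?Q1222.0="Q e1 e2 e2 e2" and ?Q2222.0="Q e2 e2 e2 e2"
        and ?b11.0="dd e1 (dd e1 (sff X N e1 e2)) p" and ?b22.0="dd e2 (dd e2 (sff X N e1 e2)) p",
        OF _ _ _ _ _ _ _ _ _ _ _ _ _ _ _ _ _ tr_shape_p(1) _ tr_shape_p(3) tr_shape_p(3) tr_shape_p(3)])
      (simp_all add: dd2_fff dd2_sff det_shape_p fff_p fc hc T Q algebra_simps)
  then show ?thesis by (auto intro: add_nonneg_nonneg)
qed

section \<open>The height function\<close>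

lemma height_derivatives:
  "dd v (\<lambda>x. X x $ 0) p = dd v X p $ 0" "dd w (dd v (\<lambda>x. X x $ 0)) p = dd w (dd v X) p $ 0"
proof -
  have 1: "dd v (\<lambda>x. f x $ 0) u = dd v f u $ 0" if "f differentiable (at u)" for f :: "real^2 \<Rightarrow> real^4" and u v
    by (rule has_derivative_dd) (intro bounded_linear.has_derivative[OF bounded_linear_vec_nth] dd_has_derivative that)
  show "dd v (\<lambda>x. X x $ 0) p = dd v X p $ 0" by (rule 1[OF diff[OF smooth_X p_in]])
  have "dd w (dd v (\<lambda>x. X x $ 0)) p = dd w (\<lambda>x. dd v X x $ 0) p"
    by (rule dd_cong[OF open_S p_in 1[OF diff[OF smooth_X]]])
  then show "dd w (dd v (\<lambda>x. X x $ 0)) p = dd w (dd v X) p $ 0"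
    by (simp add: 1[OF diff[OF smooth_on_dd[OF smooth_X] p_in]])
qed

text \<open>At a critical point of the height the time axis has no tangential component, so it is a
  combination of \<open>X p\<close> and \<open>N p\<close>. The claim compares time components in
  this expansion.\<close>

lemma height_critical:
  assumes "\<And>v. dd v (\<lambda>x. X x $ 0) p = 0"
  shows "(N p $ 0)^2 = 1 + c * (X p $ 0)^2"
proof -
  have l: "lorentz (axis 0 1) z = - z $ 0" for z by (simp add: lorentz_expand axis_def)
  have "(axis 0 1 :: real^4) = (c * - X p $ 0) *\<^sub>R X p + N p $ 0 *\<^sub>R N p"
    using assms unfolding height_derivatives by (subst frame_expand[of "axis 0 1"]) (simp add: l)
  then have "(axis 0 1 :: real^4) $ 0 = ((c * - X p $ 0) *\<^sub>R X p + N p $ 0 *\<^sub>R N p) $ 0" by simp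
  then show ?thesis by (simp add: axis_def power2_eq_square)
qed

text \<open>Trace of the Gauss formula. Its time component ties the Laplacian of the height to the
  trace of the shape operator.\<close>

lemma laplacian_position:
  "dd e1 (dd e1 X) p + dd e2 (dd e2 X) p = - (2 * c) *\<^sub>R X p - tr_shape X N p *\<^sub>R N p"
  unfolding ddX_eq by (simp add: fff_p tr_shape_p(1) algebra_simps flip: scaleR_2)

end

subsection \<open>Normal coordinates and the maximum principle\<close>

context spacelike_patch begin

lemma normal_coordinates:
  assumes u: "u \<in> S"
  obtains g T where "0 \<in> T" "smooth_on T g" "g 0 = u" "\<And>x. x \<in> T \<Longrightarrow> g x \<in> S"
    "\<And>x v. x \<in> T \<Longrightarrow> v \<noteq> 0 \<Longrightarrow> dd v g x \<noteq> 0"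
    "normal_patch c T (\<lambda>x. X (g x)) (\<lambda>x. N (g x)) 0"
proof -
  define E F D where "E = fff X e1 e1 u" and "F = fff X e1 e2 u" and "D = gram_det X u"
  have E: "E > 0" and D: "D > 0" using fff_pos gram_det_pos u by (auto simp: E_def D_def)
  have D_eq: "D = E * fff X e2 e2 u - F * F" by (simp add: D_def gram_det_def E_def F_def)
  \<comment> \<open>Gram-Schmidt applied to \<open>e1\<close>, \<open>e2\<close> at
    \<open>u\<close>; the square of \<open>E e2 - F e1\<close> is \<open>E * D\<close>.\<close>
  define a b :: "real^2" where "a = (1 / sqrt E) *\<^sub>R e1" and "b = (1 / sqrt (E * D)) *\<^sub>R (E *\<^sub>R e2 - F *\<^sub>R e1)"
  have ab: "a $ 1 = 1 / sqrt E" "a $ 2 = 0" "b $ 1 = - F / sqrt (E * D)" "b $ 2 = E / sqrt (E * D)"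
    by (simp_all add: a_def b_def e_nth)
  have sq: "sqrt E * sqrt E = E" "sqrt (E * D) * sqrt (E * D) = E * D" using E D by simp_all
  have orth: "fff X a a u = 1" "fff X a b u = 0" "fff X b b u = 1"
  proof -
    show "fff X a a u = 1" "fff X a b u = 0" 
      using E D sq by (simp_all add: fff_expand[OF u, of a] ab E_def[symmetric] F_def[symmetric] field_simps)
    have "fff X b b u = (F * F * E - 2 * E * F * F + E * E * fff X e2 e2 u) / (sqrt (E * D) * sqrt (E * D))"
      by (simp add: fff_expand[OF u, of b] ab E_def[symmetric] F_def[symmetric] add_divide_distrib diff_divide_distrib)
    also have "F * F * E - 2 * E * F * F + E * E * fff X e2 e2 u = E * D"
      by (simp add: D_eq algebra_simps)
    finally show "fff X b b u = 1" using sq(2) E D by simp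
  qed
  define L where "L v = v $ 1 *\<^sub>R a + v $ 2 *\<^sub>R b" for v :: "real^2"
  define H where "H v w = dd (L w) (dd (L v) X) u" for v w
  \<comment> \<open>The quadratic term cancels the Christoffel symbols at \<open>u\<close>.\<close>
  define q where "q v w = - lorentz (H v w) (dd a X u) *\<^sub>R a - lorentz (H v w) (dd b X u) *\<^sub>R b" for v w
  have linL: "linear L" by (rule linearI) (auto simp: L_def algebra_simps)
  have Hsym: "H v w = H w v" for v w
    unfolding H_def by (rule dd_commute[OF open_S u smooth_X])
  have linH: "linear (H v)" for v
    unfolding H_def using linear_compose[OF linL linear_dd[OF diff[OF smooth_on_dd[OF smooth_X] u]], of "L v"]
    by (simp add: o_def)
  have qsym: "q v w = q w v" for v w by (simp add: q_def Hsym)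
  have linq: "linear (q v)" for v
    by (rule linearI) (auto simp: q_def linear_add[OF linH] linear_cmul[OF linH] lorentz_algebra algebra_simps)
  have "bilinear q" unfolding bilinear_def using linq by (simp add: qsym[of _ "_ :: real^2"])
  then have q: "bounded_bilinear q" by (simp add: bilinear_conv_bounded_bilinear)
  have L: "bounded_linear L" using linL by (simp add: linear_conv_bounded_linear)
  \<comment> \<open>As \<open>q\<close> is symmetric and bilinear, the factor \<open>1/2\<close>
    makes \<open>q\<close> itself the second derivative of \<open>g\<close>.\<close>
  define g where "g x = u + L x + (1/2) *\<^sub>R q x x" for x
  have smg: "smooth_on UNIV g"
    unfolding g_def[abs_def]
    by (intro smooth_on_add smooth_on_scaleR smooth_on_const smooth_on_bilinear[OF q] smooth_on_linear
        L bounded_linear_ident open_UNIV)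
  have "(g has_derivative (\<lambda>v. L v + q x v)) (at x)" for x
    unfolding g_def[abs_def]
    by (auto intro!: derivative_eq_intros bounded_linear_imp_has_derivative[OF L] bounded_bilinear.FDERIV[OF q]
        simp: qsym[of _ x] simp flip: scaleR_2)
  then have dg: "dd v g x = L v + q x v" for v x by (rule has_derivative_dd)
  have "((\<lambda>x. L v + q x v) has_derivative (\<lambda>w. q w v)) (at x)" for v x
    by (auto intro!: derivative_eq_intros bounded_linear_imp_has_derivative[OF bounded_bilinear.bounded_linear_left[OF q]])
  then have ddg: "dd w (dd v g) x = q w v" for v w x
    unfolding dg[abs_def] by (rule has_derivative_dd)
  define J where "J x = dd e1 g x $ 1 * dd e2 g x $ 2 - dd e1 g x $ 2 * dd e2 g x $ 1" for x
  \<comment> \<open>Removing the zeros of the Jacobian determinant \<open>J\<close> makes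
    \<open>g\<close> an immersion on its whole domain.\<close>
  define T where "T = g -` S \<inter> J -` (- {0})"
  have q0: "q 0 v = 0" "q v 0 = 0" for v using linear_0[OF linq, of v] qsym[of 0 v] by simp_all
  have L0: "L 0 = 0" "L e1 = a" "L e2 = b" by (simp_all add: L_def e_nth)
  have g0: "g 0 = u" by (simp add: g_def q0 L0)
  have J0: "J 0 \<noteq> 0" using E D unfolding J_def dg q0 L0 by (simp add: ab)
  have smJ: "smooth_on UNIV J"
    unfolding J_def[abs_def] by (intro smooth_on_diff smooth_on_mult smooth_on_nth open_UNIV smooth_on_dd smg)
  then have T: "open T" unfolding T_def using smooth_on_continuous[OF smg] smooth_on_continuous[OF smJ] open_S
    by (intro open_Int open_vimage) (auto simp: open_Compl)
  have inj: "dd v g x \<noteq> 0" if "x \<in> T" "v \<noteq> 0" for x v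
  proof
    assume 0: "dd v g x = 0"
    have "dd v g x = v $ 1 *\<^sub>R dd e1 g x + v $ 2 *\<^sub>R dd e2 g x"
      by (rule dd_real2[OF smooth_on_differentiable[OF smg]]) auto
    then have "v $ 1 * dd e1 g x $ 1 + v $ 2 * dd e2 g x $ 1 = 0" "v $ 1 * dd e1 g x $ 2 + v $ 2 * dd e2 g x $ 2 = 0"
      using 0 by (simp_all add: vec_eq_iff forall_2)
    then have "v $ 1 * J x = 0" "v $ 2 * J x = 0" unfolding J_def by algebra+
    then show False using that by (auto simp: T_def vec_eq_iff forall_2)
  qed
  have smT: "smooth_on T g" by (rule smooth_on_subset[OF smg]) simp
  have im: "g x \<in> S" if "x \<in> T" for x using that by (simp add: T_def)
  have T0: "0 \<in> T" using u J0 by (simp add: T_def g0)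
  interpret Y: spacelike_patch c T "\<lambda>x. X (g x)" "\<lambda>x. N (g x)"
    by (rule reparametrize[OF T smT im inj])
  have dY: "dd v (\<lambda>x. X (g x)) 0 = dd (L v) X u" for v
    using dd_compose(1)[OF smooth_on_differentiable[OF smT T T0] diff[OF smooth_X im[OF T0]], of v]
    by (simp add: dg q0 g0)
  note lindX = linear_dd[OF diff[OF smooth_X u]]
  have XL: "dd (L v) X u = v $ 1 *\<^sub>R dd a X u + v $ 2 *\<^sub>R dd b X u" for v
    unfolding L_def by (simp add: linear_add[OF lindX] linear_cmul[OF lindX])
  have Xq: "dd (q w v) X u = - lorentz (H w v) (dd a X u) *\<^sub>R dd a X u - lorentz (H w v) (dd b X u) *\<^sub>R dd b X u" for v w
    unfolding q_def by (simp add: linear_diff[OF lindX] linear_cmul[OF lindX] linear_neg[OF lindX])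
  have ddY: "dd w (dd v (\<lambda>x. X (g x))) 0 = H w v + dd (q w v) X u" for v w
    using dd2_compose[OF T T0 open_S im smT smooth_X, of w v]
    by (simp add: dg q0 g0 ddg Hsym[of w v]) (simp add: H_def)
  have "normal_patch c T (\<lambda>x. X (g x)) (\<lambda>x. N (g x)) 0"
  proof
    show "0 \<in> T" by (rule T0)
    show "fff (\<lambda>x. X (g x)) e1 e1 0 = 1" "fff (\<lambda>x. X (g x)) e1 e2 0 = 0" "fff (\<lambda>x. X (g x)) e2 e2 0 = 1"
      using orth by (simp_all add: fff_def dY L0)
    show "lorentz (dd w (dd v (\<lambda>x. X (g x))) 0) (dd y (\<lambda>x. X (g x)) 0) = 0" for v w y
      using orth lorentz_commute[of "dd b X u" "dd a X u"] unfolding ddY dY XL Xq fff_def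
      by (simp add: lorentz_algebra)
  qed
  then show ?thesis using that[OF T0 smT g0 im inj] by blast
qed

end

text \<open>Otherwise \<open>n <= sqrt c * x\<close>, against \<open>n^2 = 1 + c * x^2\<close>. The
  summand 1 is what makes the bound strict.\<close>

lemma sqrt_bound_aux:
  fixes c x n t :: real
  assumes "c > 0" "n > 0" "n^2 = 1 + c * x^2" "2 * c * x + t * n \<ge> 0"
  shows "t > - 2 * sqrt c"
proof (rule ccontr)
  assume "\<not> t > - 2 * sqrt c"
  then have "t * n \<le> (- 2 * sqrt c) * n" using assms(2) by (intro mult_right_mono) auto
  then have "2 * c * x \<ge> 2 * sqrt c * n" using assms(4) by linarith
  moreover have "2 * c * x = 2 * sqrt c * (sqrt c * x)" using assms(1) by simp
  ultimately have "sqrt c * (sqrt c * x) \<ge> sqrt c * n" by linarith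
  then have "sqrt c * x \<ge> n" using assms(1) by simp
  then have "n^2 \<le> (sqrt c * x)^2" using assms(2) by (intro power_mono) auto
  then show False using assms by (simp add: power_mult_distrib)
qed

section \<open>Bounds on trace and determinant at extremal points\<close>

context spacelike_patch begin

lemma shape_reparam_at:
  assumes "open T" "smooth_on T g" "x \<in> T" "\<And>x. x \<in> T \<Longrightarrow> g x \<in> S" "\<And>x v. x \<in> T \<Longrightarrow> v \<noteq> 0 \<Longrightarrow> dd v g x \<noteq> 0"
  shows "tr_shape (\<lambda>x. X (g x)) (\<lambda>x. N (g x)) x = tr_shape X N (g x)"
    and "det_shape (\<lambda>x. X (g x)) (\<lambda>x. N (g x)) x = det_shape X N (g x)"
  using shape_reparametrize[OF assms(4)[OF assms(3)] smooth_on_differentiable[OF assms(2,1,3)] assms(5)[OF assms(3)]]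
  by auto

text \<open>The Laplacian of the height is nonpositive at its maximum; with \<open>x\<close> and
  \<open>n\<close> the time components of \<open>X\<close> and \<open>N\<close> this reads
  \<open>2 * c * x + t * n >= 0\<close>. The sign of \<open>n\<close> decides on which side
  \<open>t\<close> is bounded.\<close>

lemma tr_shape_height_max:
  assumes u: "u \<in> S" and N0: "N u $ 0 > 0" and mx: "\<And>x. x \<in> S \<Longrightarrow> X x $ 0 \<le> X u $ 0"
  shows "tr_shape X N u > - 2 * sqrt c"
proof -
  obtain T g where g: "0 \<in> T" "smooth_on T g" "g 0 = u" "\<And>x. x \<in> T \<Longrightarrow> g x \<in> S"
    "\<And>x v. x \<in> T \<Longrightarrow> v \<noteq> 0 \<Longrightarrow> dd v g x \<noteq> 0"
    and n: "normal_patch c T (\<lambda>x. X (g x)) (\<lambda>x. N (g x)) 0" using normal_coordinates[OF u] by blast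
  interpret Y: normal_patch c T "\<lambda>x. X (g x)" "\<lambda>x. N (g x)" 0 by (rule n)
  have tr: "tr_shape (\<lambda>x. X (g x)) (\<lambda>x. N (g x)) 0 = tr_shape X N u"
    using shape_reparam_at(1)[OF Y.open_S g(2,1,4,5)] g(3) by simp
  note lm = local_max_derivatives[OF Y.open_S g(1) smooth_on_nth[OF Y.open_S Y.smooth_X], of 0]
  have le: "X (g x) $ 0 \<le> X (g 0) $ 0" if "x \<in> T" for x using mx g that by simp
  have "(N u $ 0)^2 = 1 + c * (X u $ 0)^2" using Y.height_critical[OF lm(1)[OF le]] g(3) by simp
  moreover have "(dd e1 (dd e1 (\<lambda>x. X (g x))) 0 + dd e2 (dd e2 (\<lambda>x. X (g x))) 0) $ 0 \<le> 0"
    using lm(2)[OF le, of e1] lm(2)[OF le, of e2] unfolding Y.height_derivatives by simp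
  then have "2 * c * X u $ 0 + tr_shape X N u * N u $ 0 \<ge> 0"
    unfolding Y.laplacian_position tr by (simp add: g(3))
  ultimately show ?thesis using sqrt_bound_aux c_pos N0 by blast
qed

lemma tr_shape_height_min:
  assumes u: "u \<in> S" and N0: "N u $ 0 > 0" and mn: "\<And>x. x \<in> S \<Longrightarrow> X x $ 0 \<ge> X u $ 0"
  shows "tr_shape X N u < 2 * sqrt c"
proof -
  obtain T g where g: "0 \<in> T" "smooth_on T g" "g 0 = u" "\<And>x. x \<in> T \<Longrightarrow> g x \<in> S"
    "\<And>x v. x \<in> T \<Longrightarrow> v \<noteq> 0 \<Longrightarrow> dd v g x \<noteq> 0"
    and n: "normal_patch c T (\<lambda>x. X (g x)) (\<lambda>x. N (g x)) 0" using normal_coordinates[OF u] by blast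
  interpret Y: normal_patch c T "\<lambda>x. X (g x)" "\<lambda>x. N (g x)" 0 by (rule n)
  have tr: "tr_shape (\<lambda>x. X (g x)) (\<lambda>x. N (g x)) 0 = tr_shape X N u"
    using shape_reparam_at(1)[OF Y.open_S g(2,1,4,5)] g(3) by simp
  note lm = local_min_derivatives[OF Y.open_S g(1) smooth_on_nth[OF Y.open_S Y.smooth_X], of 0]
  have le: "X (g x) $ 0 \<ge> X (g 0) $ 0" if "x \<in> T" for x using mn g that by simp
  have "(N u $ 0)^2 = 1 + c * (X u $ 0)^2" using Y.height_critical[OF lm(1)[OF le]] g(3) by simp
  \<comment> \<open>The auxiliary bound is applied to \<open>- x\<close> and \<open>- t\<close>; the
    normal stays future-directed.\<close>
  then have "(N u $ 0)^2 = 1 + c * (- X u $ 0)^2" by simp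
  moreover have "(dd e1 (dd e1 (\<lambda>x. X (g x))) 0 + dd e2 (dd e2 (\<lambda>x. X (g x))) 0) $ 0 \<ge> 0"
    using lm(2)[OF le, of e1] lm(2)[OF le, of e2] unfolding Y.height_derivatives by simp
  then have "2 * c * (- X u $ 0) + (- tr_shape X N u) * N u $ 0 \<ge> 0"
    unfolding Y.laplacian_position tr by (simp add: g(3))
  ultimately show ?thesis using sqrt_bound_aux[of c "N u $ 0" "- X u $ 0" "- tr_shape X N u"] c_pos N0 by simp
qed

lemma cmc_det_min:
  assumes u: "u \<in> S" and const: "\<And>x. x \<in> S \<Longrightarrow> tr_shape X N x = \<tau>" and bound: "\<tau>^2 < 4 * c"
    and mn: "\<And>x. x \<in> S \<Longrightarrow> det_shape X N x \<ge> det_shape X N u"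
  shows "\<tau>^2 \<le> 4 * det_shape X N u"
proof -
  obtain T g where g: "0 \<in> T" "smooth_on T g" "g 0 = u" "\<And>x. x \<in> T \<Longrightarrow> g x \<in> S"
    "\<And>x v. x \<in> T \<Longrightarrow> v \<noteq> 0 \<Longrightarrow> dd v g x \<noteq> 0"
    and n: "normal_patch c T (\<lambda>x. X (g x)) (\<lambda>x. N (g x)) 0" using normal_coordinates[OF u] by blast
  interpret Y: normal_patch c T "\<lambda>x. X (g x)" "\<lambda>x. N (g x)" 0 by (rule n)
  define t d where "t = tr_shape (\<lambda>x. X (g x)) (\<lambda>x. N (g x))" and "d = det_shape (\<lambda>x. X (g x)) (\<lambda>x. N (g x))"
  have t: "t x = \<tau>" if "x \<in> T" for x
    using shape_reparam_at(1)[OF Y.open_S g(2) that g(4,5)] const g(4) that by (simp add: t_def)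
  have d: "d x = det_shape X N (g x)" if "x \<in> T" for x
    using shape_reparam_at(2)[OF Y.open_S g(2) that g(4,5)] by (simp add: d_def)
  have t1: "dd v t x = 0" if "x \<in> T" for v x by (rule dd_const_on[OF Y.open_S that t])
  have t2: "dd w (dd v t) 0 = 0" for v w by (rule dd_const_on[OF Y.open_S g(1) t1])
  have d2: "dd v (dd v d) 0 \<ge> 0" for v
    by (rule local_min_derivatives(2)[OF Y.open_S g(1)])
      (use mn g d Y.smooth_det_shape in \<open>auto simp: d_def[symmetric]\<close>)
  have d0: "d 0 = det_shape X N u" using d g by simp
  have "(c - d 0) * (\<tau>^2 - 4 * d 0) \<le> - (dd e1 (dd e1 d) 0 + dd e2 (dd e2 d) 0)"
    using Y.simons_inequality by (simp add: t_def[symmetric] d_def[symmetric] t1 t2 t g(1))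
  also have "\<dots> \<le> 0" using d2[of e1] d2[of e2] by simp
  finally have *: "(c - d 0) * (\<tau>^2 - 4 * d 0) \<le> 0" .
  show ?thesis
  proof (rule ccontr)
    assume "\<not> \<tau>^2 \<le> 4 * det_shape X N u"
    \<comment> \<open>The negated claim gives \<open>4 d < \<tau>^2 < 4 c\<close> at the minimum, so
      both factors are positive.\<close>
    then have "\<tau>^2 - 4 * d 0 > 0" "c - d 0 > 0" using bound d0 by auto
    then show False using * by (simp add: mult_le_0_iff)
  qed
qed

text \<open>The shape operator is a tensor: the derivatives of \<open>X\<close> and \<open>N\<close>
  obey the same chain rule, and the derivative of \<open>X\<close> is injective. This carries the
  biconservative equation over to normal coordinates.\<close>

lemma shape_chain:
  assumes T: "open T" and g: "smooth_on T g" and x: "x \<in> T" and im: "\<And>x. x \<in> T \<Longrightarrow> g x \<in> S"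
    and inj: "\<And>x v. x \<in> T \<Longrightarrow> v \<noteq> 0 \<Longrightarrow> dd v g x \<noteq> 0"
  shows "dd (spacelike_patch.shape (\<lambda>x. X (g x)) (\<lambda>x. N (g x)) x v) g x = shape (g x) (dd v g x)"
proof -
  interpret Y: spacelike_patch c T "\<lambda>x. X (g x)" "\<lambda>x. N (g x)" by (rule reparametrize[OF T g im inj])
  note gd = smooth_on_differentiable[OF g T x]
  have "dd (dd v g x) N (g x) = - dd (dd (Y.shape x v) g x) X (g x)"
    using Y.dN_eq[OF x, of v] dd_compose(1)[OF gd diff[OF smooth_X im[OF x]]] dd_compose(1)[OF gd diff[OF smooth_N im[OF x]]]
    by simp
  then have "dd (dd (Y.shape x v) g x) X (g x) = dd (shape (g x) (dd v g x)) X (g x)"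
    using dN_eq[OF im[OF x], of "dd v g x"] by simp
  then show ?thesis by (rule dX_inj[OF im[OF x]])
qed

section \<open>The biconservative equation at a maximum of the squared trace\<close>

lemma smooth_zero_on_closure:
  assumes "smooth_on S f" "A \<subseteq> S" "\<And>x. x \<in> A \<Longrightarrow> f x = 0" "u \<in> closure A" "u \<in> S"
  shows "f u = 0"
proof (rule ccontr)
  assume "f u \<noteq> 0"
  have "open (f -` (- {0}) \<inter> S)"
    using continuous_on_open_vimage[OF open_S] smooth_on_continuous[OF assms(1)] by blast
  moreover have "u \<in> f -` (- {0}) \<inter> S" using \<open>f u \<noteq> 0\<close> assms by auto
  ultimately have "f -` (- {0}) \<inter> S \<inter> A \<noteq> {}"
    using assms(4) open_Int_closure_eq_empty by blast
  then show False using assms(3) by auto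
qed

text \<open>Cleared of the denominator, so that the biconservative equation becomes linear in the
  derivatives of \<open>f\<close> with polynomial coefficients and can itself be
  differentiated.\<close>

lemma dd_shape:
  assumes "u \<in> S" "smooth_on S f"
  shows "dd (shape u v) f u * gram_det X u =
    (fff X e2 e2 u * sff X N e1 v u - fff X e1 e2 u * sff X N e2 v u) * dd e1 f u
    + (fff X e1 e1 u * sff X N e2 v u - fff X e1 e2 u * sff X N e1 v u) * dd e2 f u"
proof -
  have s: "shape u v $ 1 * gram_det X u = fff X e2 e2 u * sff X N e1 v u - fff X e1 e2 u * sff X N e2 v u"
    "shape u v $ 2 * gram_det X u = fff X e1 e1 u * sff X N e2 v u - fff X e1 e2 u * sff X N e1 v u"
    using gram_det_pos[OF assms(1)] by (simp_all add: shape_nth)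
  show ?thesis
    unfolding dd_real2[OF diff[OF assms(2,1)], of "shape u v"] s[symmetric] by (simp add: algebra_simps)
qed

text \<open>The nonzero covector dt is an eigenvector of \<open>A\<close> for
  \<open>- t / 2\<close>. The characteristic polynomial at this value is
  \<open>t^2 / 4 + t^2 / 2 + d\<close>, whence the constant 3/4.\<close>

lemma biconservative_det:
  assumes u: "u \<in> S" and bic: "\<And>v. dd (shape u v) (tr_shape X N) u = - (tr_shape X N u / 2) * dd v (tr_shape X N) u"
    and nz: "dd e1 (tr_shape X N) u \<noteq> 0 \<or> dd e2 (tr_shape X N) u \<noteq> 0"
  shows "det_shape X N u + 3 / 4 * (tr_shape X N u * tr_shape X N u) = 0"
proof -
  define E F G D where "E = fff X e1 e1 u" and "F = fff X e1 e2 u" and "G = fff X e2 e2 u" and "D = gram_det X u"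
  define h11 h12 h22 where "h11 = sff X N e1 e1 u" and "h12 = sff X N e1 e2 u" and "h22 = sff X N e2 e2 u"
  define t d where "t = tr_shape X N u" and "d = det_shape X N u"
  define t1 t2 where "t1 = dd e1 (tr_shape X N) u" and "t2 = dd e2 (tr_shape X N) u"
  note defs = E_def F_def G_def D_def h11_def h12_def h22_def t_def d_def t1_def t2_def
  have D: "D > 0" "D = E * G - F * F" using gram_det_pos[OF u] by (auto simp: defs gram_det_def)
  have td: "t * D = G * h11 - 2 * (F * h12) + E * h22" "d * D = h11 * h22 - h12 * h12"
    using D(1) by (simp_all add: tr_shape_def det_shape_def defs)
  have h21: "sff X N e2 e1 u = h12" by (simp add: h12_def sff_commute[OF u])
  have 1: "(G * h11 - F * h12 + t / 2 * D) * t1 + (E * h12 - F * h11) * t2 = 0"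
    using dd_shape[OF u smooth_tr_shape, of e1] unfolding bic by (simp add: defs[symmetric] h21 algebra_simps)
  have 2: "(G * h12 - F * h22) * t1 + (E * h22 - F * h12 + t / 2 * D) * t2 = 0"
    using dd_shape[OF u smooth_tr_shape, of e2] unfolding bic by (simp add: defs[symmetric] h21 algebra_simps)
  \<comment> \<open>Determinant of the linear system satisfied by \<open>t1\<close>,
    \<open>t2\<close>. It equals \<open>D^2\<close> times the characteristic polynomial of the shape
    operator at \<open>- t / 2\<close>.\<close>
  define m where "m = (G * h11 - F * h12 + t / 2 * D) * (E * h22 - F * h12 + t / 2 * D)
      - (E * h12 - F * h11) * (G * h12 - F * h22)"
  have "(\<alpha> * \<delta> - \<beta> * \<gamma>) * x = 0 \<and> (\<alpha> * \<delta> - \<beta> * \<gamma>) * y = 0"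
    if "\<alpha> * x + \<beta> * y = 0" "\<gamma> * x + \<delta> * y = 0" for \<alpha> \<beta> \<gamma> \<delta> x y :: real
    using that by algebra
  from this[OF 1 2] have "m * t1 = 0" "m * t2 = 0" unfolding m_def by simp_all
  then have "m = 0" using nz by (auto simp: defs)
  have "m = ((G * h11 - F * h12) * (E * h22 - F * h12) - (E * h12 - F * h11) * (G * h12 - F * h22))
      + t / 2 * D * (G * h11 - 2 * (F * h12) + E * h22) + (t / 2 * D)^2"
    unfolding m_def by (simp add: algebra_simps power2_eq_square)
  also have "(G * h11 - F * h12) * (E * h22 - F * h12) - (E * h12 - F * h11) * (G * h12 - F * h22)
      = D * (h11 * h22 - h12 * h12)"
    unfolding D(2) by (simp add: algebra_simps)
  finally have "m = D * (d * D) + t / 2 * D * (t * D) + (t / 2 * D)^2" unfolding td .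
  also have "\<dots> = D^2 * (d + 3 / 4 * (t * t))" by (simp add: algebra_simps power2_eq_square)
  finally show ?thesis using \<open>m = 0\<close> D(1) by (simp add: defs)
qed

lemma biconservative_max:
  assumes u: "u \<in> S"
    and bic: "\<And>x v. x \<in> S \<Longrightarrow> dd (shape x v) (tr_shape X N) x = - (tr_shape X N x / 2) * dd v (tr_shape X N) x"
    and mx: "\<And>x. x \<in> S \<Longrightarrow> (tr_shape X N x)^2 \<le> (tr_shape X N u)^2"
    and nz: "tr_shape X N u \<noteq> 0"
    and cl: "u \<in> closure {x \<in> S. dd e1 (tr_shape X N) x \<noteq> 0 \<or> dd e2 (tr_shape X N) x \<noteq> 0}"
  shows False
proof -
  define A where "A = {x \<in> S. dd e1 (tr_shape X N) x \<noteq> 0 \<or> dd e2 (tr_shape X N) x \<noteq> 0}"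
  \<comment> \<open>Openness of \<open>A\<close> allows \<open>w = 0\<close> to be differentiated
    twice on it before passing to the closure.\<close>
  have "open (dd v (tr_shape X N) -` (- {0}) \<inter> S)" for v
    using continuous_on_open_vimage[OF open_S] smooth_on_continuous[OF smooth_on_dd[OF smooth_tr_shape]] by blast
  then have "open ((dd e1 (tr_shape X N) -` (- {0}) \<inter> S) \<union> (dd e2 (tr_shape X N) -` (- {0}) \<inter> S))"
    by (intro open_Un) auto
  also have "\<dots> = A" by (auto simp: A_def)
  finally have A: "open A" "A \<subseteq> S" by (auto simp: A_def)
  define w where "w x = det_shape X N x + 3 / 4 * (tr_shape X N x * tr_shape X N x)" for x
  have smw: "smooth_on S w"
    unfolding w_def[abs_def]
    by (intro smooth_on_add smooth_on_mult smooth_on_const open_S smooth_det_shape smooth_tr_shape)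
  have w0: "w x = 0" if "x \<in> A" for x
    unfolding w_def using that by (intro biconservative_det) (auto simp: A_def bic)
  have w1: "dd v w x = 0" if "x \<in> A" for v x by (rule dd_const_on[OF A(1) that w0])
  have w2: "dd y (dd v w) x = 0" if "x \<in> A" for v y x by (rule dd_const_on[OF A(1) that w1])
  note cl' = smooth_zero_on_closure[OF _ A(2) _ cl[folded A_def] u]
  have wu: "w u = 0" "dd v w u = 0" "dd y (dd v w) u = 0" for v y
    using cl'[OF smw w0] cl'[OF smooth_on_dd[OF smw] w1] cl'[OF smooth_on_dd[OF smooth_on_dd[OF smw]] w2] by auto
  obtain T g where g: "0 \<in> T" "smooth_on T g" "g 0 = u" "\<And>x. x \<in> T \<Longrightarrow> g x \<in> S"
    "\<And>x v. x \<in> T \<Longrightarrow> v \<noteq> 0 \<Longrightarrow> dd v g x \<noteq> 0"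
    and n: "normal_patch c T (\<lambda>x. X (g x)) (\<lambda>x. N (g x)) 0" using normal_coordinates[OF u] by blast
  define Y P where "Y = (\<lambda>x. X (g x))" and "P = (\<lambda>x. N (g x))"
  interpret Y: normal_patch c T Y P 0 unfolding Y_def P_def by (rule n)
  define t d where "t = tr_shape Y P" and "d = det_shape Y P"
  have t: "t x = tr_shape X N (g x)" if "x \<in> T" for x
    using shape_reparam_at(1)[OF Y.open_S g(2) that g(4,5)] by (simp add: t_def Y_def P_def)
  have d: "d x = det_shape X N (g x)" if "x \<in> T" for x
    using shape_reparam_at(2)[OF Y.open_S g(2) that g(4,5)] by (simp add: d_def Y_def P_def)
  have smt: "smooth_on T t" and smd: "smooth_on T d" by (simp_all add: t_def d_def Y.smooth_tr_shape Y.smooth_det_shape)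
  note sm = smooth_on_mult[OF Y.open_S] smt smd smooth_on_const
  have t0: "t 0 \<noteq> 0" using nz t g by simp
  have dt: "dd v t x = dd (dd v g x) (tr_shape X N) (g x)" if "x \<in> T" for v x
    using dd_cong[OF Y.open_S that t] dd_compose(1)[OF smooth_on_differentiable[OF g(2) Y.open_S that]
      diff[OF smooth_tr_shape g(4)[OF that]]] by simp
  have bic': "dd (Y.shape x v) t x = - (t x / 2) * dd v t x" if "x \<in> T" for x v
    using bic[OF g(4)[OF that], of "dd v g x"]
    by (simp add: dt[OF that] t[OF that] shape_chain[OF Y.open_S g(2) that g(4,5), folded Y_def P_def])
  have mx': "t x * t x \<le> t 0 * t 0" if "x \<in> T" for x
    using mx[OF g(4)[OF that]] t[OF that] t[OF g(1)] g(3) by (simp add: power2_eq_square)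
  have lm: "dd v (\<lambda>x. t x * t x) 0 = 0" "dd v (dd v (\<lambda>x. t x * t x)) 0 \<le> 0" for v
    by (rule local_max_derivatives[OF Y.open_S g(1) smooth_on_mult[OF Y.open_S smt smt]], erule mx')+
  \<comment> \<open>The derivative of \<open>t^2\<close> is \<open>2 t\<close> times that of
    \<open>t\<close>, and \<open>t 0\<close> is nonzero.\<close>
  have t1: "dd v t 0 = 0" for v
    using lm(1)[of v] t0 dd_mult[OF Y.diff[OF smt g(1)] Y.diff[OF smt g(1)], of v] by simp
  have tt: "dd y (dd v (\<lambda>x. t x * t x)) 0 = 2 * (t 0 * dd y (dd v t) 0)" for y v
    by (subst dd2_mult[OF Y.open_S g(1) smt smt]) (simp add: t1)
  have t2: "t 0 * dd v (dd v t) 0 \<le> 0" for v using lm(2)[of v] tt[of v v] by simp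
  have "dd y (dd v d) 0 + 3 / 2 * (t 0 * dd y (dd v t) 0) = 0" for y v
  proof -
  have "dd y (dd v (\<lambda>x. w (g x))) 0 = 0"
    using dd2_compose[OF Y.open_S g(1) open_S g(4) g(2) smw, of y v] by (simp add: g(3) wu)
  moreover have "dd y (dd v (\<lambda>x. w (g x))) 0 = dd y (dd v (\<lambda>x. d x + 3 / 4 * (t x * t x))) 0"
    by (rule dd2_cong[OF Y.open_S g(1)]) (simp add: w_def t d)
  moreover have "dd y (dd v (\<lambda>x. d x + 3 / 4 * (t x * t x))) 0 = dd y (dd v d) 0 + 3 / 2 * (t 0 * dd y (dd v t) 0)"
    by (subst dd2_add[OF Y.open_S g(1)], (intro sm)+, subst dd2_mult[OF Y.open_S g(1)], (intro sm)+)
      (simp add: tt dd_const)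
  ultimately show ?thesis by simp
  qed
  then have d2: "dd y (dd v d) 0 = - (3 / 2 * (t 0 * dd y (dd v t) 0))" for y v
    by (simp add: eq_neg_iff_add_eq_0)
  have d0: "d 0 = - (3 / 4 * (t 0)^2)" using wu(1) t d g(1,3) by (simp add: w_def power2_eq_square)
  have eqn: "dd (Y.shape x v) t x * gram_det Y x = - (t x / 2) * dd v t x * gram_det Y x" if "x \<in> T" for x v
    using bic'[OF that] by simp
  \<comment> \<open>Derivative of the biconservative equation, multiplied through by the Gram
    determinant. Since dt vanishes at 0, only the terms in which the derivative falls on dt survive,
    and derivatives of the shape operator drop out.\<close>
  have hess: "Y.h e1 v * dd y (dd e1 t) 0 + Y.h e2 v * dd y (dd e2 t) 0 = - (t 0 / 2) * dd y (dd v t) 0" for v y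
  proof -
    note rules = Y.diff smooth_on_diff sm Y.open_S Y.smooth_fff Y.smooth_sff Y.smooth_gram_det smooth_on_dd g(1)
    let ?l1 = "\<lambda>x. fff Y e2 e2 x * sff Y P e1 v x - fff Y e1 e2 x * sff Y P e2 v x"
    let ?l2 = "\<lambda>x. fff Y e1 e1 x * sff Y P e2 v x - fff Y e1 e2 x * sff Y P e1 v x"
    let ?r = "\<lambda>x. - 1 / 2 * (t x * gram_det Y x)"
    have "?l1 x * dd e1 t x + ?l2 x * dd e2 t x = ?r x * dd v t x" if "x \<in> T" for x
      using Y.dd_shape[OF that smt, of v] eqn[OF that, of v] by (simp add: algebra_simps)
    then have "dd y (\<lambda>x. ?l1 x * dd e1 t x + ?l2 x * dd e2 t x) 0 = dd y (\<lambda>x. ?r x * dd v t x) 0"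
      by (rule dd_cong[OF Y.open_S g(1)])
    also have "dd y (\<lambda>x. ?l1 x * dd e1 t x + ?l2 x * dd e2 t x) 0
        = dd y (\<lambda>x. ?l1 x * dd e1 t x) 0 + dd y (\<lambda>x. ?l2 x * dd e2 t x) 0"
      by (rule dd_add) (intro rules)+
    also have "dd y (\<lambda>x. ?l1 x * dd e1 t x) 0 = ?l1 0 * dd y (dd e1 t) 0 + dd y ?l1 0 * dd e1 t 0"
      by (rule dd_mult) (intro rules)+
    also have "dd y (\<lambda>x. ?l2 x * dd e2 t x) 0 = ?l2 0 * dd y (dd e2 t) 0 + dd y ?l2 0 * dd e2 t 0"
      by (rule dd_mult) (intro rules)+
    also have "dd y (\<lambda>x. ?r x * dd v t x) 0 = ?r 0 * dd y (dd v t) 0 + dd y ?r 0 * dd v t 0"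
      by (rule dd_mult) (intro rules)+
    finally show ?thesis by (simp add: t1 Y.fff_p Y.gram_p)
  qed
  have "dd e1 (dd e2 t) 0 = dd e2 (dd e1 t) 0" by (rule dd_commute[OF Y.open_S g(1) smt])
  then have hH: "Y.h e1 e1 * dd e1 (dd e1 t) 0 + 2 * Y.h e1 e2 * dd e2 (dd e1 t) 0 + Y.h e2 e2 * dd e2 (dd e2 t) 0
     = - (t 0 / 2) * (dd e1 (dd e1 t) 0 + dd e2 (dd e2 t) 0)"
    using hess[of e1 e1] hess[of e2 e2] Y.sff_commute[OF g(1), of e2 e1] by (simp add: algebra_simps)
  \<comment> \<open>The factor 3 is 1 + 3/2 + 1/2: from \<open>t Lap t\<close>, from
    \<open>- Lap d\<close> by \<open>d2\<close>, and from the Hessian term \<open>hH\<close> moved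
    to the right.\<close>
  have "(c - d 0) * ((t 0)^2 - 4 * d 0) \<le> 3 * (t 0 * dd e1 (dd e1 t) 0 + t 0 * dd e2 (dd e2 t) 0)"
    using Y.simons_inequality[folded t_def d_def] unfolding hH d2 by (simp add: t1 algebra_simps)
  also have "\<dots> \<le> 0" using t2[of e1] t2[of e2] by simp
  finally have "(c - d 0) * ((t 0)^2 - 4 * d 0) \<le> 0" .
  moreover have "c - d 0 > 0" "(t 0)^2 - 4 * d 0 > 0" using t0 c_pos by (simp_all add: d0 add_pos_nonneg)
  ultimately show False by (simp add: mult_le_0_iff)
qed

text \<open>If \<open>t\<close> vanishes at \<open>u\<close>, the maximality of \<open>t^2\<close>
  makes it vanish on \<open>S\<close>. Otherwise \<open>u\<close> lies outside the closure of the
  set where dt is nonzero, so dt vanishes on a ball around \<open>u\<close>.\<close>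

lemma biconservative_locally_constant:
  assumes u: "u \<in> S"
    and bic: "\<And>x v. x \<in> S \<Longrightarrow> dd (shape x v) (tr_shape X N) x = - (tr_shape X N x / 2) * dd v (tr_shape X N) x"
    and mx: "\<And>x. x \<in> S \<Longrightarrow> (tr_shape X N x)^2 \<le> (tr_shape X N u)^2"
  obtains B where "open B" "u \<in> B" "B \<subseteq> S" "\<And>x. x \<in> B \<Longrightarrow> tr_shape X N x = tr_shape X N u"
proof (cases "tr_shape X N u = 0")
  case True
  then show ?thesis using that[of S] mx open_S u by auto
next
  case False
  define A where "A = {x \<in> S. dd e1 (tr_shape X N) x \<noteq> 0 \<or> dd e2 (tr_shape X N) x \<noteq> 0}"
  have "u \<notin> closure A" using biconservative_max[OF u bic mx False] unfolding A_def by blast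
  then have "open (S - closure A)" "u \<in> S - closure A" using open_S u by auto
  then obtain r where r: "r > 0" "ball u r \<subseteq> S - closure A" using open_contains_ball by blast
  have "(tr_shape X N has_derivative (\<lambda>h. 0)) (at x within ball u r)" if "x \<in> ball u r" for x
  proof -
    have x: "x \<in> S" "x \<notin> A" using r(2) that closure_subset[of A] by auto
    have "dd v (tr_shape X N) x = 0" for v
      using x by (simp add: dd_real2[OF diff[OF smooth_tr_shape x(1)], of v] A_def)
    then show ?thesis
      using dd_has_derivative[OF diff[OF smooth_tr_shape x(1)]] has_derivative_at_withinI by fastforce
  qed
  then have "\<exists>k. \<forall>x\<in>ball u r. tr_shape X N x = k"
    by (intro has_derivative_zero_constant convex_ball)
  then have const: "tr_shape X N x = tr_shape X N u" if "x \<in> ball u r" for x using r(1) that by fastforce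
  have "ball u r \<subseteq> S" using r(2) by blast
  then show ?thesis by (intro that[of "ball u r"] const) (use r(1) in auto)
qed

end

subsection \<open>The future-directed unit normal\<close>

text \<open>The normal part of the timelike vector \<open>axis 0 1\<close>; it is again timelike and future-directed.\<close>

definition time_normal :: "real \<Rightarrow> (real^2 \<Rightarrow> real^4) \<Rightarrow> real^2 \<Rightarrow> real^4" where
  "time_normal c X u = (let t = axis 0 1; P1 = lorentz t (dd e1 X u); P2 = lorentz t (dd e2 X u) in
     t - (c * lorentz t (X u)) *\<^sub>R X u
       - ((fff X e2 e2 u * P1 - fff X e1 e2 u * P2) / gram_det X u) *\<^sub>R dd e1 X u
       - ((fff X e1 e1 u * P2 - fff X e1 e2 u * P1) / gram_det X u) *\<^sub>R dd e2 X u)"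

text \<open>The normalizing factor contains only the time component because the square of
  \<open>time_normal\<close> is minus that component.\<close>

definition future_normal :: "real \<Rightarrow> (real^2 \<Rightarrow> real^4) \<Rightarrow> real^2 \<Rightarrow> real^4" where
  "future_normal c X u = (1 / sqrt (time_normal c X u $ 0)) *\<^sub>R time_normal c X u"

lemma lorentz_time: "lorentz (axis 0 1) z = - z $ 0" "lorentz z (axis 0 1) = - z $ 0"
  by (simp_all add: lorentz_expand axis_def)

context spacelike_immersion begin

lemma time_normal_orthogonal:
  assumes u: "u \<in> S"
  shows "lorentz (time_normal c X u) (X u) = 0" "lorentz (time_normal c X u) (dd v X u) = 0"
proof -
  define P1 P2 where "P1 = lorentz (axis 0 1) (dd e1 X u)" and "P2 = lorentz (axis 0 1) (dd e2 X u)"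
  define E F G D where "E = fff X e1 e1 u" and "F = fff X e1 e2 u" and "G = fff X e2 e2 u" and "D = gram_det X u"
  note defs = P1_def[symmetric] P2_def[symmetric] E_def[symmetric] F_def[symmetric] G_def[symmetric] D_def[symmetric]
  have n: "time_normal c X u = axis 0 1 - (c * lorentz (axis 0 1) (X u)) *\<^sub>R X u
       - ((G * P1 - F * P2) / D) *\<^sub>R dd e1 X u - ((E * P2 - F * P1) / D) *\<^sub>R dd e2 X u"
    by (simp add: time_normal_def Let_def defs)
  have D: "D > 0" "D = E * G - F * F" using gram_det_pos[OF u] by (auto simp: E_def F_def G_def D_def gram_det_def)
  have gram: "lorentz (dd e1 X u) (dd e1 X u) = E" "lorentz (dd e1 X u) (dd e2 X u) = F"
    "lorentz (dd e2 X u) (dd e1 X u) = F" "lorentz (dd e2 X u) (dd e2 X u) = G"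
    by (simp_all add: E_def F_def G_def fff_def lorentz_commute[of "dd e2 X u" "dd e1 X u"])
  show "lorentz (time_normal c X u) (X u) = 0"
    using XX[OF u] c_pos by (simp add: n lorentz_algebra dX_X[OF u])
  have "lorentz (time_normal c X u) (dd e1 X u) = P1 - ((G * P1 - F * P2) * E + (E * P2 - F * P1) * F) / D"
    by (simp add: n lorentz_algebra gram lorentz_commute[of "X u"] dX_X[OF u] defs add_divide_distrib)
  also have "(G * P1 - F * P2) * E + (E * P2 - F * P1) * F = P1 * D" by (simp add: D(2) algebra_simps)
  finally have 1: "lorentz (time_normal c X u) (dd e1 X u) = 0" using D(1) by simp
  have "lorentz (time_normal c X u) (dd e2 X u) = P2 - ((G * P1 - F * P2) * F + (E * P2 - F * P1) * G) / D"
    by (simp add: n lorentz_algebra gram lorentz_commute[of "X u"] dX_X[OF u] defs add_divide_distrib)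
  also have "(G * P1 - F * P2) * F + (E * P2 - F * P1) * G = P2 * D" by (simp add: D(2) algebra_simps)
  finally have 2: "lorentz (time_normal c X u) (dd e2 X u) = 0" using D(1) by simp
  show "lorentz (time_normal c X u) (dd v X u) = 0"
    unfolding dd_real2[OF diff[OF smooth_X u], of v] by (simp add: lorentz_algebra 1 2)
qed

text \<open>As the orthogonal projection of the time axis, \<open>time_normal\<close> has the same
  product with the axis as with itself. Its time component is
  \<open>1 + c * x0^2 + |grad x0|^2\<close> for the height \<open>x0\<close>, where the last term is
  nonnegative by completing the square.\<close>

lemma time_normal_time:
  assumes u: "u \<in> S"
  shows "time_normal c X u $ 0 > 0" "lorentz (time_normal c X u) (time_normal c X u) = - time_normal c X u $ 0"
proof -
  define P1 P2 where "P1 = lorentz (axis 0 1) (dd e1 X u)" and "P2 = lorentz (axis 0 1) (dd e2 X u)"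
  define E F G D where "E = fff X e1 e1 u" and "F = fff X e1 e2 u" and "G = fff X e2 e2 u" and "D = gram_det X u"
  have D: "D > 0" "D = E * G - F * F" "E > 0" using gram_det_pos[OF u] fff_pos[OF u]
    by (auto simp: E_def F_def G_def D_def gram_det_def)
  define \<alpha> \<beta> where "\<alpha> = (G * P1 - F * P2) / D" and "\<beta> = (E * P2 - F * P1) / D"
  have n: "time_normal c X u = axis 0 1 - (c * lorentz (axis 0 1) (X u)) *\<^sub>R X u - \<alpha> *\<^sub>R dd e1 X u - \<beta> *\<^sub>R dd e2 X u"
    by (simp add: time_normal_def Let_def P1_def P2_def E_def F_def G_def D_def \<alpha>_def \<beta>_def)
  have "lorentz (time_normal c X u) (time_normal c X u)
      = lorentz (time_normal c X u) (axis 0 1 - (c * lorentz (axis 0 1) (X u)) *\<^sub>R X u - \<alpha> *\<^sub>R dd e1 X u - \<beta> *\<^sub>R dd e2 X u)"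
    by (subst (2) n) (rule refl)
  also have "\<dots> = - time_normal c X u $ 0"
    by (simp add: lorentz_algebra time_normal_orthogonal[OF u] lorentz_time)
  finally show "lorentz (time_normal c X u) (time_normal c X u) = - time_normal c X u $ 0" .
  have "E * (G * P1 * P1 - 2 * (F * P1 * P2) + E * P2 * P2) = D * P1 * P1 + (E * P2 - F * P1)^2"
    by (simp add: D(2) algebra_simps power2_eq_square)
  also have "\<dots> \<ge> 0" using D(1) by (simp add: mult.assoc)
  finally have "G * P1 * P1 - 2 * (F * P1 * P2) + E * P2 * P2 \<ge> 0" using D(3) by (simp add: zero_le_mult_iff)
  then have "(G * P1 * P1 - 2 * (F * P1 * P2) + E * P2 * P2) / D \<ge> 0" using D(1) by simp
  also have "(G * P1 * P1 - 2 * (F * P1 * P2) + E * P2 * P2) / D = \<alpha> * P1 + \<beta> * P2"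
    unfolding \<alpha>_def \<beta>_def by (simp add: algebra_simps flip: add_divide_distrib diff_divide_distrib)
  also have "\<dots> = - (\<alpha> * dd e1 X u $ 0 + \<beta> * dd e2 X u $ 0)" by (simp add: P1_def P2_def lorentz_time)
  finally have "\<alpha> * dd e1 X u $ 0 + \<beta> * dd e2 X u $ 0 \<le> 0" by simp
  moreover have "time_normal c X u $ 0 = 1 + c * (X u $ 0)^2 - (\<alpha> * dd e1 X u $ 0 + \<beta> * dd e2 X u $ 0)"
    by (simp add: n lorentz_time power2_eq_square)
  moreover have "c * (X u $ 0)^2 \<ge> 0" using c_pos by simp
  ultimately show "time_normal c X u $ 0 > 0" by linarith
qed

lemma smooth_time_normal: "smooth_on S (time_normal c X)"
proof -
  have nz: "gram_det X u \<noteq> 0" if "u \<in> S" for u using gram_det_pos[OF that] by simp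
  show ?thesis
    unfolding time_normal_def[abs_def] Let_def
    by (intro smooth_on_diff smooth_on_scaleR smooth_on_divide smooth_on_mult smooth_on_lorentz smooth_on_const
        open_S smooth_fff smooth_gram_det smooth_X smooth_on_dd nz)
qed

lemma future_normal_pos: "u \<in> S \<Longrightarrow> future_normal c X u $ 0 > 0"
  using time_normal_time(1)[of u] by (simp add: future_normal_def)

lemma smooth_future_normal: "smooth_on S (future_normal c X)"
proof -
  have nz: "sqrt (time_normal c X u $ 0) \<noteq> 0" if "u \<in> S" for u using time_normal_time(1)[OF that] by simp
  show ?thesis
    unfolding future_normal_def[abs_def]
    by (intro smooth_on_scaleR smooth_on_divide smooth_on_sqrt smooth_on_nth smooth_on_const smooth_time_normal
        open_S nz time_normal_time(1))
qed

lemma future_normal_patch: "spacelike_patch c S X (future_normal c X)"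
proof
  fix u v assume u: "u \<in> S"
  show "lorentz (future_normal c X u) (X u) = 0" "lorentz (future_normal c X u) (dd v X u) = 0"
    by (simp_all add: future_normal_def lorentz_algebra time_normal_orthogonal[OF u])
  define s where "s = sqrt (time_normal c X u $ 0)"
  have s: "s * s = time_normal c X u $ 0" "s > 0" using time_normal_time(1)[OF u] by (simp_all add: s_def)
  then show "lorentz (future_normal c X u) (future_normal c X u) = - 1"
    unfolding future_normal_def s_def[symmetric] by (simp add: lorentz_algebra time_normal_time(2)[OF u] flip: s(1))
qed (rule smooth_future_normal)

end

section \<open>Uniqueness of the normal and the covector form of the biconservative equation\<close>

context spacelike_patch begin

text \<open>Within de Sitter space the normal space of the surface is a line, so a unit normal is
  determined up to sign.\<close>

lemma unit_normal_unique:
  assumes u: "u \<in> S" and n: "lorentz n n = - 1" "lorentz n (X u) = 0" "\<And>v. lorentz n (dd v X u) = 0"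
  shows "n = N u \<or> n = - N u"
proof -
  define k where "k = - lorentz n (N u)"
  have "n - k *\<^sub>R N u = 0"
    by (rule frame_zero[OF u]) (simp_all add: lorentz_algebra n NX NN NdX u k_def)
  then have nk: "n = k *\<^sub>R N u" by simp
  then have "k * k = 1" using n(1) NN[OF u] by (simp add: lorentz_algebra)
  then have "k = 1 \<or> k = - 1" by algebra
  then show ?thesis using nk by auto
qed

lemma unit_normal_unique_future:
  assumes "u \<in> S" "N u $ 0 > 0" "n $ 0 > 0" "lorentz n n = - 1" "lorentz n (X u) = 0" "\<And>v. lorentz n (dd v X u) = 0"
  shows "n = N u"
  using unit_normal_unique[OF assms(1,4-6)] assms(2,3) by auto

text \<open>Changing the normal can only reverse the sign of the second fundamental form, hence of
  the trace, but not that of the determinant. The criterion \<open>t^2 = 4 d\<close> thus passes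
  from the future-directed normal to any other.\<close>

lemma shape_other_normal:
  assumes "spacelike_patch c S' X N'" and u: "u \<in> S" "u \<in> S'"
  shows "(tr_shape X N' u)^2 = (tr_shape X N u)^2" "det_shape X N' u = det_shape X N u"
proof -
  interpret P: spacelike_patch c S' X N' by fact
  have "N' u = N u \<or> N' u = - N u"
    by (rule unit_normal_unique[OF u(1) P.NN[OF u(2)] P.NX[OF u(2)] P.NdX[OF u(2)]])
  then have "(\<forall>v w. sff X N' v w u = sff X N v w u) \<or> (\<forall>v w. sff X N' v w u = - sff X N v w u)"
    by (auto simp: sff_eq[OF u(1)] P.sff_eq[OF u(2)] lorentz_algebra)
  then have "(tr_shape X N' u = tr_shape X N u \<or> tr_shape X N' u = - tr_shape X N u)
    \<and> det_shape X N' u = det_shape X N u"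
    by (auto simp: tr_shape_def det_shape_def minus_divide_left)
  then show "(tr_shape X N' u)^2 = (tr_shape X N u)^2" "det_shape X N' u = det_shape X N u"
    by auto
qed

text \<open>Cramer's rule gives a representing vector, and definiteness of the induced metric gives
  the uniqueness that \<open>THE\<close> requires.\<close>

lemma grad_eq:
  assumes u: "u \<in> S" and f: "f differentiable (at u)"
  shows "fff X (grad X f u) v u = dd v f u"
proof -
  define D where "D = gram_det X u"
  have D: "D > 0" "D = fff X e1 e1 u * fff X e2 e2 u - fff X e1 e2 u * fff X e1 e2 u"
    using gram_det_pos[OF u] by (auto simp: D_def gram_det_def)
  define w where "w = ((fff X e2 e2 u * dd e1 f u - fff X e1 e2 u * dd e2 f u) / D) *\<^sub>R e1
    + ((fff X e1 e1 u * dd e2 f u - fff X e1 e2 u * dd e1 f u) / D) *\<^sub>R e2"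
  have wn: "w $ 1 * D = fff X e2 e2 u * dd e1 f u - fff X e1 e2 u * dd e2 f u"
    "w $ 2 * D = fff X e1 e1 u * dd e2 f u - fff X e1 e2 u * dd e1 f u"
    using D(1) by (simp_all add: w_def e_nth)
  have w: "fff X w v u = dd v f u" for v
  proof -
    have "D * fff X w v u = (w $ 1 * D) * (v $ 1 * fff X e1 e1 u + v $ 2 * fff X e1 e2 u)
      + (w $ 2 * D) * (v $ 1 * fff X e1 e2 u + v $ 2 * fff X e2 e2 u)"
      unfolding fff_expand[OF u, of w v] by (simp add: algebra_simps)
    also have "\<dots> = (fff X e1 e1 u * fff X e2 e2 u - fff X e1 e2 u * fff X e1 e2 u) * dd v f u"
      unfolding wn dd_real2[OF f, of v] by (simp add: algebra_simps)
    finally show ?thesis using D by simp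
  qed
  have "grad X f u = w"
    unfolding grad_def induced_metric_def dd_def[symmetric] fff_def[symmetric]
  proof (rule the_equality)
    show "\<forall>v. fff X w v u = dd v f u" using w by blast
    fix w' assume "\<forall>v. fff X w' v u = dd v f u"
    then have "fff X (w' - w) (w' - w) u = 0" using w
      unfolding fff_def by (simp add: linear_diff[OF linear_dd[OF diff[OF smooth_X u]]] lorentz_algebra)
    then show "w' = w" using pos[OF u, of "w' - w"] by (auto simp: fff_def)
  qed
  then show ?thesis using w by simp
qed

text \<open>The symmetry of \<open>A\<close> moves it from grad f onto the argument of the
  differential, which turns the vector equation into one for dt. In this form it changes coordinates
  by the chain rule alone.\<close>

lemma biconservative_covector:
  assumes u: "u \<in> S" and f: "f = mean_curvature X N"
    and bic: "shape_operator X N u (grad X f u) = f u *\<^sub>R grad X f u"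
  shows "dd (shape u v) (tr_shape X N) u = - (tr_shape X N u / 2) * dd v (tr_shape X N) u"
proof -
  have f_eq: "f x = - 1 / 2 * tr_shape X N x" if "x \<in> S" for x
    using mean_curvature_eq[OF that] f by simp
  have "smooth_on S (\<lambda>x. - 1 / 2 * tr_shape X N x)"
    by (intro smooth_on_mult open_S smooth_on_const smooth_tr_shape)
  moreover have "smooth_on S f \<longleftrightarrow> smooth_on S (\<lambda>x. - 1 / 2 * tr_shape X N x)"
    by (rule smooth_on_cong[OF open_S]) (rule f_eq)
  ultimately have smf: "smooth_on S f" by simp
  have df: "dd v f u = - 1 / 2 * dd v (tr_shape X N) u" for v
  proof -
    have "dd v f u = dd v (\<lambda>x. - 1 / 2 * tr_shape X N x) u" by (rule dd_cong[OF open_S u]) (rule f_eq)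
    then show ?thesis
    using dd_mult[of "\<lambda>_. - 1 / 2" u "tr_shape X N" v] diff[OF smooth_tr_shape u]
    by (simp add: dd_const)
  qed
  note g = grad_eq[OF u diff[OF smf u]]
  have "dd (shape u v) f u = fff X (grad X f u) (shape u v) u" by (rule g[symmetric])
  also have "\<dots> = sff X N (grad X f u) v u" using fff_shape[OF u, of v] by (simp add: fff_commute)
  also have "\<dots> = fff X (shape u (grad X f u)) v u" by (simp add: fff_shape[OF u] sff_commute[OF u])
  also have "\<dots> = fff X (f u *\<^sub>R grad X f u) v u" using bic shape_operator_eq[OF u] by simp
  also have "\<dots> = f u * fff X (grad X f u) v u"
    unfolding fff_def by (simp add: linear_cmul[OF linear_dd[OF diff[OF smooth_X u]]] lorentz_algebra)
  also have "\<dots> = f u * dd v f u" by (simp only: g)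
  finally show ?thesis unfolding df f_eq[OF u] by simp
qed

end

subsection \<open>Compact spacelike biconservative surfaces\<close>

lemma shape_cong:
  assumes "open W" "u \<in> W" "\<And>w. w \<in> W \<Longrightarrow> X w = X' w" "\<And>w. w \<in> W \<Longrightarrow> N w = N' w"
  shows "tr_shape X N u = tr_shape X' N' u" "det_shape X N u = det_shape X' N' u"
proof -
  have "dd v X u = dd v X' u" "dd v N u = dd v N' u" for v
    by (rule dd_cong[OF assms(1,2)], erule assms)+
  then show "tr_shape X N u = tr_shape X' N' u" "det_shape X N u = det_shape X' N' u"
    by (simp_all add: tr_shape_def det_shape_def gram_det_def fff_def sff_def)
qed

section \<open>The surface and its charts\<close>

locale spacelike_surface =
  fixes c :: real and M :: "'m topology" and \<A> :: "'m chart set" and x :: "'m \<Rightarrow> real^4"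
  assumes c_pos: "c > 0" and surface: "smooth_surface M \<A>"
    and immersed: "immersed_in_de_sitter c M \<A> x" and spacelike: "spacelike \<A> x"
begin

lemma chart:
  assumes "(U, \<phi>) \<in> \<A>"
  shows "openin M U" "open (\<phi> ` U)" "homeomorphic_map (subtopology M U) (top_of_set (\<phi> ` U)) \<phi>"
    "inj_on \<phi> U" "U \<subseteq> topspace M"
proof -
  have ch: "surface_chart M (U, \<phi>)" using surface assms unfolding smooth_surface_def by blast
  then show "openin M U" "open (\<phi> ` U)" and
    h: "homeomorphic_map (subtopology M U) (top_of_set (\<phi> ` U)) \<phi>"
    by (auto simp: surface_chart_def)
  then show U: "U \<subseteq> topspace M" by (simp add: openin_subset)
  have "topspace (subtopology M U) = U" using U by auto
  then show "inj_on \<phi> U" using homeomorphic_imp_injective_map[OF h] by simp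
qed

lemma chart_image_open:
  assumes \<phi>: "(U, \<phi>) \<in> \<A>" and "openin M V"
  shows "open (\<phi> ` (U \<inter> V))"
proof -
  have "openin (subtopology M U) (U \<inter> V)"
    using assms(2) by (metis inf_commute openin_subtopology)
  then have "openin (top_of_set (\<phi> ` U)) (\<phi> ` (U \<inter> V))"
    using homeomorphic_imp_open_map[OF chart(3)[OF \<phi>]] by (simp add: open_map_def)
  then show ?thesis using chart(2)[OF \<phi>] openin_open_trans by blast
qed

lemma chart_vimage_open:
  assumes \<phi>: "(U, \<phi>) \<in> \<A>" and B: "open B"
  shows "openin M {q \<in> U. \<phi> q \<in> B}"
proof -
  have U: "topspace (subtopology M U) = U" using chart(5)[OF \<phi>] by auto
  have "continuous_map (subtopology M U) (top_of_set (\<phi> ` U)) \<phi>"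
    using chart(3)[OF \<phi>] homeomorphic_imp_continuous_map by blast
  then have "continuous_map (subtopology M U) euclidean \<phi>"
    using continuous_map_in_subtopology by blast
  then have "openin (subtopology M U) {q \<in> topspace (subtopology M U). \<phi> q \<in> B}"
    by (rule openin_continuous_map_preimage) (simp add: B)
  then have "openin (subtopology M U) {q \<in> U. \<phi> q \<in> B}" by (simp only: U)
  then show ?thesis using chart(1)[OF \<phi>] openin_trans_full by blast
qed

lemma immersion:
  assumes \<phi>: "(U, \<phi>) \<in> \<A>"
  shows "spacelike_immersion c (\<phi> ` U) (x \<circ> inv_into U \<phi>)"
proof
  show "c > 0" by (rule c_pos)
  show "open (\<phi> ` U)" by (rule chart(2)[OF \<phi>])
  have "U \<inter> topspace M = U" using chart(5)[OF \<phi>] by blast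
  moreover have "smooth_on (\<phi> ` (U \<inter> topspace M)) (x \<circ> inv_into U \<phi>)"
    using immersed \<phi> unfolding immersed_in_de_sitter_def smooth_on_surface_def by blast
  ultimately show "smooth_on (\<phi> ` U) (x \<circ> inv_into U \<phi>)" by simp
  fix u assume u: "u \<in> \<phi> ` U"
  have "inv_into U \<phi> u \<in> topspace M" using inv_into_into[OF u] chart(5)[OF \<phi>] by blast
  then show "lorentz ((x \<circ> inv_into U \<phi>) u) ((x \<circ> inv_into U \<phi>) u) = 1 / c"
    using immersed by (auto simp: immersed_in_de_sitter_def de_sitter_def)
  show "lorentz (dd v (x \<circ> inv_into U \<phi>) u) (dd v (x \<circ> inv_into U \<phi>) u) > 0" if "v \<noteq> 0" for v
    using spacelike \<phi> u that unfolding spacelike_def induced_metric_def dd_def by blast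
qed

abbreviation "chart_normal U \<phi> \<equiv> future_normal c (x \<circ> inv_into U \<phi>)"

lemma patch: "(U, \<phi>) \<in> \<A> \<Longrightarrow> spacelike_patch c (\<phi> ` U) (x \<circ> inv_into U \<phi>) (chart_normal U \<phi>)"
  by (rule spacelike_immersion.future_normal_patch[OF immersion])

text \<open>Both chart normals are future-directed unit normals to the same tangent plane, so they
  coincide; trace and determinant then agree by reparametrization with the transition map.\<close>

lemma transition:
  assumes \<phi>: "(U, \<phi>) \<in> \<A>" and \<psi>: "(V, \<psi>) \<in> \<A>" and p: "p \<in> U" "p \<in> V"
  shows "chart_normal V \<psi> (\<psi> p) = chart_normal U \<phi> (\<phi> p)"
    and "tr_shape (x \<circ> inv_into V \<psi>) (chart_normal V \<psi>) (\<psi> p) = tr_shape (x \<circ> inv_into U \<phi>) (chart_normal U \<phi>) (\<phi> p)"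
    and "det_shape (x \<circ> inv_into V \<psi>) (chart_normal V \<psi>) (\<psi> p) = det_shape (x \<circ> inv_into U \<phi>) (chart_normal U \<phi>) (\<phi> p)"
proof -
  define X Y where "X = x \<circ> inv_into U \<phi>" and "Y = x \<circ> inv_into V \<psi>"
  define W where "W = \<psi> ` (V \<inter> U)"
  define g where "g = \<phi> \<circ> inv_into V \<psi>"
  interpret PX: spacelike_patch c "\<phi> ` U" X "future_normal c X" unfolding X_def by (rule patch[OF \<phi>])
  interpret PY: spacelike_patch c "\<psi> ` V" Y "future_normal c Y" unfolding Y_def by (rule patch[OF \<psi>])
  have W: "open W" unfolding W_def by (rule chart_image_open[OF \<psi> chart(1)[OF \<phi>]])
  have WV: "w \<in> \<psi> ` V" if "w \<in> W" for w using that by (auto simp: W_def)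
  have "\<forall>(U, \<phi>)\<in>\<A>. \<forall>(V, \<psi>)\<in>\<A>. smooth_on (\<phi> ` (U \<inter> V)) (\<psi> \<circ> inv_into U \<phi>)"
    using surface by (simp add: smooth_surface_def)
  from bspec[OF this \<psi>] have "\<forall>(U, \<phi>)\<in>\<A>. smooth_on (\<psi> ` (V \<inter> U)) (\<phi> \<circ> inv_into V \<psi>)" by simp
  from bspec[OF this \<phi>] have g: "smooth_on W g" by (simp add: W_def g_def)
  have im: "g w \<in> \<phi> ` U" and YX: "Y w = X (g w)" if "w \<in> W" for w
    using that chart(4)[OF \<phi>] chart(4)[OF \<psi>] by (auto simp: W_def g_def X_def Y_def)
  have gp: "g (\<psi> p) = \<phi> p" and pW: "\<psi> p \<in> W" using p chart(4)[OF \<psi>] by (auto simp: g_def W_def)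
  note gd = smooth_on_differentiable[OF g W]
  have dY: "dd z Y w = dd (dd z g w) X (g w)" if "w \<in> W" for z w
  proof -
    have "dd z Y w = dd z (\<lambda>w. X (g w)) w" by (rule dd_cong[OF W that]) (rule YX)
    then show ?thesis
      using dd_compose(1)[OF gd[OF that] PX.diff[OF PX.smooth_X im[OF that]]] by simp
  qed
  \<comment> \<open>The transition map has injective derivative because \<open>Y\<close> is the
    composition of \<open>X\<close> with \<open>g\<close> and is an immersion.\<close>
  have inj: "dd z g w \<noteq> 0" if "w \<in> W" "z \<noteq> 0" for w z
  proof
    assume "dd z g w = 0"
    then have "dd z Y w = 0"
      using dY[OF that(1)] linear_0[OF linear_dd[OF PX.diff[OF PX.smooth_X im[OF that(1)]]]] by simp
    then show False using PY.pos[OF WV[OF that(1)] that(2)] by (simp add: lorentz_zero)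
  qed
  have N: "future_normal c X (g w) = future_normal c Y w" if "w \<in> W" for w
    by (rule PY.unit_normal_unique_future[OF WV[OF that]])
      (use WV[OF that] im[OF that] in \<open>auto simp: YX that dY PX.NN PX.NX PX.NdX
        PX.future_normal_pos PY.future_normal_pos\<close>)
  have sc: "tr_shape Y (future_normal c Y) (\<psi> p) = tr_shape (\<lambda>w. X (g w)) (\<lambda>w. future_normal c X (g w)) (\<psi> p)"
    "det_shape Y (future_normal c Y) (\<psi> p) = det_shape (\<lambda>w. X (g w)) (\<lambda>w. future_normal c X (g w)) (\<psi> p)"
    by (rule shape_cong[OF W pW]; simp add: YX N)+
  note sr = PX.shape_reparametrize[OF im[OF pW] gd[OF pW] inj[OF pW], unfolded gp]
  show "chart_normal V \<psi> (\<psi> p) = chart_normal U \<phi> (\<phi> p)"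
    using N[OF pW] by (simp add: gp X_def Y_def)
  show "tr_shape (x \<circ> inv_into V \<psi>) (chart_normal V \<psi>) (\<psi> p) = tr_shape (x \<circ> inv_into U \<phi>) (chart_normal U \<phi>) (\<phi> p)"
    using sc(1) sr(1) by (simp add: X_def Y_def)
  show "det_shape (x \<circ> inv_into V \<psi>) (chart_normal V \<psi>) (\<psi> p) = det_shape (x \<circ> inv_into U \<phi>) (chart_normal U \<phi>) (\<phi> p)"
    using sc(2) sr(2) by (simp add: X_def Y_def)
qed

section \<open>Normal, trace and determinant as functions on the whole surface\<close>

definition chart_at :: "'m \<Rightarrow> 'm chart" where
  "chart_at p = (SOME \<kappa>. \<kappa> \<in> \<A> \<and> p \<in> fst \<kappa>)"

definition normal :: "'m \<Rightarrow> real^4" where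
  "normal p = (case chart_at p of (U, \<phi>) \<Rightarrow> chart_normal U \<phi> (\<phi> p))"

definition tr_A :: "'m \<Rightarrow> real" where
  "tr_A p = (case chart_at p of (U, \<phi>) \<Rightarrow> tr_shape (x \<circ> inv_into U \<phi>) (chart_normal U \<phi>) (\<phi> p))"

definition det_A :: "'m \<Rightarrow> real" where
  "det_A p = (case chart_at p of (U, \<phi>) \<Rightarrow> det_shape (x \<circ> inv_into U \<phi>) (chart_normal U \<phi>) (\<phi> p))"

text \<open>By \<open>transition\<close> the chart picked by \<open>chart_at\<close> may be
  exchanged for any other chart around the point.\<close>

lemma in_chart:
  assumes \<phi>: "(U, \<phi>) \<in> \<A>" and p: "p \<in> U"
  shows "normal p = chart_normal U \<phi> (\<phi> p)"
    and "tr_A p = tr_shape (x \<circ> inv_into U \<phi>) (chart_normal U \<phi>) (\<phi> p)"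
    and "det_A p = det_shape (x \<circ> inv_into U \<phi>) (chart_normal U \<phi>) (\<phi> p)"
proof -
  obtain V \<psi> where V: "chart_at p = (V, \<psi>)" by fastforce
  have "chart_at p \<in> \<A> \<and> p \<in> fst (chart_at p)"
    unfolding chart_at_def by (rule someI[of _ "(U, \<phi>)"]) (use assms in simp)
  then have "(V, \<psi>) \<in> \<A>" "p \<in> V" using V by auto
  from transition[OF \<phi> this(1) p this(2)] show "normal p = chart_normal U \<phi> (\<phi> p)"
    "tr_A p = tr_shape (x \<circ> inv_into U \<phi>) (chart_normal U \<phi>) (\<phi> p)"
    "det_A p = det_shape (x \<circ> inv_into U \<phi>) (chart_normal U \<phi>) (\<phi> p)"
    by (simp_all add: normal_def tr_A_def det_A_def V)
qed

lemma in_chart_image: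
  assumes \<phi>: "(U, \<phi>) \<in> \<A>" and u: "u \<in> \<phi> ` U"
  shows "normal (inv_into U \<phi> u) = chart_normal U \<phi> u"
    and "tr_A (inv_into U \<phi> u) = tr_shape (x \<circ> inv_into U \<phi>) (chart_normal U \<phi>) u"
    and "det_A (inv_into U \<phi> u) = det_shape (x \<circ> inv_into U \<phi>) (chart_normal U \<phi>) u"
  by (rule in_chart[OF \<phi> inv_into_into[OF u], unfolded f_inv_into_f[OF u]])+

lemma obtain_chart:
  assumes "p \<in> topspace M"
  obtains U \<phi> where "(U, \<phi>) \<in> \<A>" "p \<in> U"
proof -
  have "p \<in> \<Union> (fst ` \<A>)" using assms surface by (simp add: smooth_surface_def)
  then show ?thesis using that by auto
qed

lemma continuous_on_surface:
  fixes h :: "'m \<Rightarrow> real"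
  assumes "\<And>U \<phi>. (U, \<phi>) \<in> \<A> \<Longrightarrow> continuous_on (\<phi> ` U) (\<lambda>u. h (inv_into U \<phi> u))"
  shows "continuous_map M euclideanreal h"
  unfolding continuous_map_def
proof (intro conjI allI impI)
  fix B :: "real set" assume "openin euclideanreal B"
  then have B: "open B" by simp
  show "openin M {p \<in> topspace M. h p \<in> B}"
  proof (subst openin_subopen, intro ballI)
    fix p assume "p \<in> {p \<in> topspace M. h p \<in> B}"
    then have p: "p \<in> topspace M" "h p \<in> B" by auto
    obtain U \<phi> where \<phi>: "(U, \<phi>) \<in> \<A>" "p \<in> U" using obtain_chart[OF p(1)] by blast
    define C where "C = (\<lambda>u. h (inv_into U \<phi> u)) -` B \<inter> \<phi> ` U"
    have "open C" unfolding C_def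
      using continuous_on_open_vimage[OF chart(2)[OF \<phi>(1)]] assms[OF \<phi>(1)] B by blast
    moreover have "\<phi> q \<in> C \<longleftrightarrow> h q \<in> B" if "q \<in> U" for q
      using that chart(4)[OF \<phi>(1)] by (auto simp: C_def)
    ultimately show "\<exists>T. openin M T \<and> p \<in> T \<and> T \<subseteq> {p \<in> topspace M. h p \<in> B}"
      using chart_vimage_open[OF \<phi>(1), of C] p \<phi>(2) chart(5)[OF \<phi>(1)]
      by (intro exI[of _ "{q \<in> U. \<phi> q \<in> C}"]) auto
  qed
qed simp

lemma continuous_tr_A: "continuous_map M euclideanreal tr_A"
proof (rule continuous_on_surface)
  fix U \<phi> assume \<phi>: "(U, \<phi>) \<in> \<A>"
  show "continuous_on (\<phi> ` U) (\<lambda>u. tr_A (inv_into U \<phi> u))"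
    by (rule continuous_on_eq[OF smooth_on_continuous[OF spacelike_patch.smooth_tr_shape[OF patch[OF \<phi>]]]])
      (simp add: in_chart_image(2)[OF \<phi>])
qed

lemma continuous_det_A: "continuous_map M euclideanreal det_A"
proof (rule continuous_on_surface)
  fix U \<phi> assume \<phi>: "(U, \<phi>) \<in> \<A>"
  show "continuous_on (\<phi> ` U) (\<lambda>u. det_A (inv_into U \<phi> u))"
    by (rule continuous_on_eq[OF smooth_on_continuous[OF spacelike_patch.smooth_det_shape[OF patch[OF \<phi>]]]])
      (simp add: in_chart_image(3)[OF \<phi>])
qed

lemma continuous_height: "continuous_map M euclideanreal (\<lambda>p. x p $ 0)"
proof (rule continuous_on_surface)
  fix U \<phi> assume \<phi>: "(U, \<phi>) \<in> \<A>"
  interpret spacelike_immersion c "\<phi> ` U" "x \<circ> inv_into U \<phi>" by (rule immersion[OF \<phi>])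
  show "continuous_on (\<phi> ` U) (\<lambda>u. x (inv_into U \<phi> u) $ 0)"
    using smooth_on_continuous[OF smooth_on_nth[OF open_S smooth_X]] by (simp add: o_def)
qed

lemma unit_normal_patch:
  assumes \<phi>: "(U, \<phi>) \<in> \<A>" and W: "openin M W" and \<eta>: "unit_normal_on \<A> x W \<eta>"
  shows "spacelike_patch c (\<phi> ` (U \<inter> W)) (x \<circ> inv_into U \<phi>) (\<eta> \<circ> inv_into U \<phi>)"
proof -
  interpret spacelike_immersion c "\<phi> ` U" "x \<circ> inv_into U \<phi>" by (rule immersion[OF \<phi>])
  have sub: "u \<in> \<phi> ` U" if "u \<in> \<phi> ` (U \<inter> W)" for u using that by auto
  show ?thesis
  proof
    show "smooth_on (\<phi> ` (U \<inter> W)) (x \<circ> inv_into U \<phi>)" by (rule smooth_on_subset[OF smooth_X]) auto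
    show "smooth_on (\<phi> ` (U \<inter> W)) (\<eta> \<circ> inv_into U \<phi>)"
      using \<eta> \<phi> unfolding unit_normal_on_def smooth_on_surface_def by blast
    fix u v assume u: "u \<in> \<phi> ` (U \<inter> W)"
    then obtain p where p: "p \<in> U" "p \<in> W" "u = \<phi> p" "inv_into U \<phi> u = p" using chart(4)[OF \<phi>] by auto
    show "lorentz ((\<eta> \<circ> inv_into U \<phi>) u) ((\<eta> \<circ> inv_into U \<phi>) u) = - 1"
      "lorentz ((\<eta> \<circ> inv_into U \<phi>) u) ((x \<circ> inv_into U \<phi>) u) = 0"
      using \<eta> p unfolding unit_normal_on_def by auto
    show "lorentz ((\<eta> \<circ> inv_into U \<phi>) u) (dd v (x \<circ> inv_into U \<phi>) u) = 0"
      using \<eta> p \<phi> unfolding unit_normal_on_def dd_def by fastforce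
  qed (use c_pos chart_image_open[OF \<phi> W] XX pos sub in auto)
qed

text \<open>\<open>biconservative\<close> quantifies over smooth unit normal fields on open sets;
  this result allows it to be instantiated with the global future-directed one.\<close>

lemma normal_unit_normal: "unit_normal_on \<A> x (topspace M) normal"
proof -
  have "smooth_on (\<phi> ` (U \<inter> topspace M)) (normal \<circ> inv_into U \<phi>)" if \<phi>: "(U, \<phi>) \<in> \<A>" for U \<phi>
  proof -
    interpret spacelike_patch c "\<phi> ` U" "x \<circ> inv_into U \<phi>" "chart_normal U \<phi>" by (rule patch[OF \<phi>])
    have "smooth_on (\<phi> ` U) (normal \<circ> inv_into U \<phi>) \<longleftrightarrow> smooth_on (\<phi> ` U) (chart_normal U \<phi>)"
      by (rule smooth_on_cong[OF open_S]) (simp add: in_chart_image(1)[OF \<phi>])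
    moreover have "U \<inter> topspace M = U" using chart(5)[OF \<phi>] by blast
    ultimately show ?thesis using smooth_N by simp
  qed
  moreover have "lorentz (normal p) (normal p) = - 1 \<and> lorentz (normal p) (x p) = 0" if p: "p \<in> topspace M" for p
  proof -
    obtain U \<phi> where \<phi>: "(U, \<phi>) \<in> \<A>" "p \<in> U" using obtain_chart[OF p] by blast
    interpret spacelike_patch c "\<phi> ` U" "x \<circ> inv_into U \<phi>" "chart_normal U \<phi>" by (rule patch[OF \<phi>(1)])
    show ?thesis using NN[of "\<phi> p"] NX[of "\<phi> p"] \<phi>(2) chart(4)[OF \<phi>(1)] by (simp add: in_chart(1)[OF \<phi>])
  qed
  moreover have "lorentz (normal p) (push (x \<circ> inv_into U \<phi>) (\<phi> p) v) = 0"
    if \<phi>: "(U, \<phi>) \<in> \<A>" "p \<in> U" for U \<phi> p v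
    using spacelike_patch.NdX[OF patch[OF \<phi>(1)], of "\<phi> p" v] \<phi>(2) by (simp add: in_chart(1)[OF \<phi>] dd_def)
  ultimately show ?thesis unfolding unit_normal_on_def smooth_on_surface_def by blast
qed

lemma biconservative_in_chart:
  assumes bic: "biconservative M \<A> x" and \<phi>: "(U, \<phi>) \<in> \<A>" and u: "u \<in> \<phi> ` U"
  defines "X \<equiv> x \<circ> inv_into U \<phi>"
  defines "N \<equiv> chart_normal U \<phi>"
  shows "dd (spacelike_patch.shape X N u v) (tr_shape X N) u = - (tr_shape X N u / 2) * dd v (tr_shape X N) u"
proof -
  \<comment> \<open>\<open>biconservative\<close> yields a statement about this field, which agrees
    with \<open>N\<close> only on the chart image. Trace, shape operator and derivatives are carried
    over because they depend on local values only.\<close>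
  define \<eta> where "\<eta> = normal \<circ> inv_into U \<phi>"
  have UM: "U \<inter> topspace M = U" using chart(5)[OF \<phi>] by blast
  interpret P: spacelike_patch c "\<phi> ` U" X N unfolding X_def N_def by (rule patch[OF \<phi>])
  interpret Q: spacelike_patch c "\<phi> ` U" X \<eta>
    using unit_normal_patch[OF \<phi> openin_topspace normal_unit_normal] by (simp add: UM X_def \<eta>_def)
  have eq: "\<eta> w = N w" if "w \<in> \<phi> ` U" for w using in_chart_image(1)[OF \<phi> that] by (simp add: \<eta>_def N_def)
  have tr: "tr_shape X \<eta> w = tr_shape X N w" if "w \<in> \<phi> ` U" for w
    by (rule shape_cong(1)[OF P.open_S that]) (simp_all add: eq)
  have sh: "Q.shape u v = P.shape u v"
  proof (rule P.dX_inj[OF u])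
    have "dd v \<eta> u = dd v N u" by (rule dd_cong[OF P.open_S u]) (rule eq)
    then show "dd (Q.shape u v) X u = dd (P.shape u v) X u" using P.dN_eq[OF u] Q.dN_eq[OF u] by simp
  qed
  have all: "\<forall>(U, \<phi>)\<in>\<A>. \<forall>u\<in>\<phi> ` (U \<inter> topspace M).
      let X = x \<circ> inv_into U \<phi>; N = normal \<circ> inv_into U \<phi>; f = mean_curvature X N
      in shape_operator X N u (grad X f u) = f u *\<^sub>R grad X f u"
    using bic normal_unit_normal unfolding biconservative_def by blast
  from bspec[OF all \<phi>] have all: "\<forall>u\<in>\<phi> ` (U \<inter> topspace M). shape_operator X \<eta> u (grad X (mean_curvature X \<eta>) u)
      = mean_curvature X \<eta> u *\<^sub>R grad X (mean_curvature X \<eta>) u"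
    by (simp only: Let_def X_def \<eta>_def prod.case)
  have "u \<in> \<phi> ` (U \<inter> topspace M)" using u UM by simp
  with all have "shape_operator X \<eta> u (grad X (mean_curvature X \<eta>) u)
      = mean_curvature X \<eta> u *\<^sub>R grad X (mean_curvature X \<eta>) u" by (rule bspec)
  from Q.biconservative_covector[OF u refl this, of v]
  have "dd (P.shape u v) (tr_shape X \<eta>) u = - (tr_shape X \<eta> u / 2) * dd v (tr_shape X \<eta>) u"
    by (simp add: sh)
  moreover have "dd z (tr_shape X \<eta>) u = dd z (tr_shape X N) u" for z
    by (rule dd_cong[OF P.open_S u]) (rule tr)
  ultimately show ?thesis using tr[OF u] by simp
qed

section \<open>Global maximum principles on the compact surface\<close>

lemma attains_max:
  fixes h :: "'m \<Rightarrow> real"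
  assumes "compact_space M" "topspace M \<noteq> {}" "continuous_map M euclideanreal h"
  obtains p where "p \<in> topspace M" "\<And>q. q \<in> topspace M \<Longrightarrow> h q \<le> h p"
proof -
  have "compactin euclideanreal (h ` topspace M)"
    using image_compactin[of M "topspace M" euclideanreal h] assms by (simp add: compact_space_def)
  then have "compact (h ` topspace M)" by simp
  from compact_attains_sup[OF this] assms(2) show ?thesis using that by auto
qed

text \<open>\<open>Z\<close> is a level set of the signed trace, closed by continuity. Each of its
  points is again a maximum of the squared trace, so the local result applies there and makes
  \<open>Z\<close> open.\<close>

lemma tr_A_constant:
  assumes "compact_space M" "connected_space M" "biconservative M \<A> x"
  obtains a where "\<And>p. p \<in> topspace M \<Longrightarrow> tr_A p = a"
proof (cases "topspace M = {}")
  case True then show ?thesis using that by simp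
next
  case False
  have "continuous_map M euclideanreal (\<lambda>p. (tr_A p)^2)"
    by (intro continuous_intros continuous_tr_A)
  from attains_max[OF assms(1) False this] obtain p where p: "p \<in> topspace M"
    and mx: "\<And>q. q \<in> topspace M \<Longrightarrow> (tr_A q)^2 \<le> (tr_A p)^2" by blast
  define Z where "Z = {q \<in> topspace M. tr_A q \<in> {tr_A p}}"
  have "closedin M Z" unfolding Z_def
    by (rule closedin_continuous_map_preimage[OF continuous_tr_A]) simp
  moreover have "openin M Z"
  proof (subst openin_subopen, intro ballI)
    fix q assume q: "q \<in> Z"
    then obtain U \<phi> where \<phi>: "(U, \<phi>) \<in> \<A>" "q \<in> U" using obtain_chart unfolding Z_def by blast
    define X N where "X = x \<circ> inv_into U \<phi>" and "N = chart_normal U \<phi>"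
    interpret spacelike_patch c "\<phi> ` U" X N unfolding X_def N_def by (rule patch[OF \<phi>(1)])
    have tr: "tr_shape X N (\<phi> r) = tr_A r" if "r \<in> U" for r
      using in_chart(2)[OF \<phi>(1) that] by (simp add: X_def N_def)
    have qU: "\<phi> q \<in> \<phi> ` U" using \<phi>(2) by simp
    have bic: "dd (shape u v) (tr_shape X N) u = - (tr_shape X N u / 2) * dd v (tr_shape X N) u" if "u \<in> \<phi> ` U" for u v
      unfolding X_def N_def by (rule biconservative_in_chart[OF assms(3) \<phi>(1) that])
    have "(tr_shape X N u)^2 \<le> (tr_shape X N (\<phi> q))^2" if "u \<in> \<phi> ` U" for u
      using that tr \<phi>(2) q mx chart(5)[OF \<phi>(1)] by (auto simp: Z_def)
    from biconservative_locally_constant[OF qU bic this] obtain B where B: "open B" "\<phi> q \<in> B" "B \<subseteq> \<phi> ` U"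
      "\<And>u. u \<in> B \<Longrightarrow> tr_shape X N u = tr_shape X N (\<phi> q)" by blast
    have "r \<in> Z" if "r \<in> U" "\<phi> r \<in> B" for r
      using B(4)[OF that(2)] tr[OF that(1)] tr[OF \<phi>(2)] q chart(5)[OF \<phi>(1)] that(1) by (auto simp: Z_def)
    then show "\<exists>T. openin M T \<and> q \<in> T \<and> T \<subseteq> Z"
      using chart_vimage_open[OF \<phi>(1) B(1)] \<phi>(2) B(2) by (intro exI[of _ "{q \<in> U. \<phi> q \<in> B}"]) auto
  qed
  ultimately have "Z = {} \<or> Z = topspace M"
    using assms(2) connected_space_clopen_in by blast
  then have "Z = topspace M" using p by (auto simp: Z_def)
  then show ?thesis using that[of "tr_A p"] by (auto simp: Z_def)
qed

text \<open>The highest point gives the lower bound and the lowest point the upper one. Both concern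
  the same number \<open>a\<close>, because the trace is taken with respect to one global
  normal.\<close>

lemma constant_tr_A_bound:
  assumes "compact_space M" "topspace M \<noteq> {}" and a: "\<And>p. p \<in> topspace M \<Longrightarrow> tr_A p = a"
  shows "a^2 < 4 * c"
proof -
  obtain p where p: "p \<in> topspace M" "\<And>q. q \<in> topspace M \<Longrightarrow> x q $ 0 \<le> x p $ 0"
    using attains_max[OF assms(1,2) continuous_height] by blast
  have "continuous_map M euclideanreal (\<lambda>p. - (x p $ 0))" by (intro continuous_intros continuous_height)
  then obtain p' where p': "p' \<in> topspace M" "\<And>q. q \<in> topspace M \<Longrightarrow> x q $ 0 \<ge> x p' $ 0"
    using attains_max[OF assms(1,2), of "\<lambda>p. - (x p $ 0)"] by auto
  have "a > - 2 * sqrt c"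
  proof -
    obtain U \<phi> where \<phi>: "(U, \<phi>) \<in> \<A>" "p \<in> U" using obtain_chart[OF p(1)] by blast
    interpret spacelike_patch c "\<phi> ` U" "x \<circ> inv_into U \<phi>" "chart_normal U \<phi>" by (rule patch[OF \<phi>(1)])
    have "tr_shape (x \<circ> inv_into U \<phi>) (chart_normal U \<phi>) (\<phi> p) > - 2 * sqrt c"
      by (rule tr_shape_height_max)
        (use \<phi> p(2) chart(4,5)[OF \<phi>(1)] future_normal_pos in auto)
    then show ?thesis using in_chart(2)[OF \<phi>] a[OF p(1)] by simp
  qed
  moreover have "a < 2 * sqrt c"
  proof -
    obtain U \<phi> where \<phi>: "(U, \<phi>) \<in> \<A>" "p' \<in> U" using obtain_chart[OF p'(1)] by blast
    interpret spacelike_patch c "\<phi> ` U" "x \<circ> inv_into U \<phi>" "chart_normal U \<phi>" by (rule patch[OF \<phi>(1)])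
    have "tr_shape (x \<circ> inv_into U \<phi>) (chart_normal U \<phi>) (\<phi> p') < 2 * sqrt c"
      by (rule tr_shape_height_min)
        (use \<phi> p'(2) chart(4,5)[OF \<phi>(1)] future_normal_pos in auto)
    then show ?thesis using in_chart(2)[OF \<phi>] a[OF p'(1)] by simp
  qed
  ultimately have "\<bar>a\<bar> < 2 * sqrt c" by linarith
  then have "\<bar>a\<bar>^2 < (2 * sqrt c)^2" by (intro power_strict_mono) auto
  then show ?thesis using c_pos by (simp add: power_mult_distrib)
qed

lemma umbilic_everywhere:
  assumes comp: "compact_space M" and "connected_space M" "biconservative M \<A> x" and q: "q \<in> topspace M"
  shows "(tr_A q)^2 = 4 * det_A q"
proof -
  have ne: "topspace M \<noteq> {}" using q by auto
  obtain a where a: "\<And>p. p \<in> topspace M \<Longrightarrow> tr_A p = a" using tr_A_constant[OF assms(1-3)] by blast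
  have bound: "a^2 < 4 * c" by (rule constant_tr_A_bound[OF comp ne a])
  have "continuous_map M euclideanreal (\<lambda>p. - det_A p)" by (intro continuous_intros continuous_det_A)
  then obtain p where p: "p \<in> topspace M" "\<And>q. q \<in> topspace M \<Longrightarrow> det_A q \<ge> det_A p"
    using attains_max[OF comp ne, of "\<lambda>p. - det_A p"] by auto
  have "a^2 \<le> 4 * det_A p"
  proof -
    obtain U \<phi> where \<phi>: "(U, \<phi>) \<in> \<A>" "p \<in> U" using obtain_chart[OF p(1)] by blast
    interpret spacelike_patch c "\<phi> ` U" "x \<circ> inv_into U \<phi>" "chart_normal U \<phi>" by (rule patch[OF \<phi>(1)])
    have M: "inv_into U \<phi> u \<in> topspace M" if "u \<in> \<phi> ` U" for u
      using inv_into_into[OF that] chart(5)[OF \<phi>(1)] by blast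
    have "a^2 \<le> 4 * det_shape (x \<circ> inv_into U \<phi>) (chart_normal U \<phi>) (\<phi> p)"
    proof (rule cmc_det_min[OF _ _ bound])
      fix u assume u: "u \<in> \<phi> ` U"
      show "tr_shape (x \<circ> inv_into U \<phi>) (chart_normal U \<phi>) u = a"
        using in_chart_image(2)[OF \<phi>(1) u] a[OF M[OF u]] by simp
      show "det_shape (x \<circ> inv_into U \<phi>) (chart_normal U \<phi>) (\<phi> p) \<le> det_shape (x \<circ> inv_into U \<phi>) (chart_normal U \<phi>) u"
        using in_chart_image(3)[OF \<phi>(1) u] in_chart(3)[OF \<phi>] p(2)[OF M[OF u]] by simp
    qed (use \<phi>(2) in simp)
    then show ?thesis using in_chart(3)[OF \<phi>] by simp
  qed
  moreover have "4 * det_A q \<le> (tr_A q)^2"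
  proof -
    obtain U \<phi> where \<phi>: "(U, \<phi>) \<in> \<A>" "q \<in> U" using obtain_chart[OF q] by blast
    then show ?thesis
      using spacelike_patch.discriminant_nonneg[OF patch[OF \<phi>(1)], of "\<phi> q"] in_chart[OF \<phi>] by simp
  qed
  ultimately show ?thesis using a[OF q] p(2)[OF q] by simp
qed

end

theorem theorem1p5:
  fixes c :: real and M :: "'m topology" and \<A> :: "'m chart set" and x :: "'m \<Rightarrow> real^4"
  assumes "c > 0"
    and "smooth_surface M \<A>" and "compact_space M" and "connected_space M"
    and "immersed_in_de_sitter c M \<A> x"
    and "spacelike \<A> x"
    and "biconservative M \<A> x"
  shows "totally_umbilical M \<A> x"
proof -
  interpret spacelike_surface c M \<A> x using assms by unfold_locales
  have "\<exists>\<mu>. \<forall>v. shape_operator (x \<circ> inv_into U \<phi>) (\<eta> \<circ> inv_into U \<phi>) u v = \<mu> *\<^sub>R v"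
    if W: "openin M W" "unit_normal_on \<A> x W \<eta>" and \<phi>: "(U, \<phi>) \<in> \<A>" and u: "u \<in> \<phi> ` (U \<inter> W)" for W \<eta> U \<phi> u
  proof -
    interpret P: spacelike_patch c "\<phi> ` (U \<inter> W)" "x \<circ> inv_into U \<phi>" "\<eta> \<circ> inv_into U \<phi>"
      by (rule unit_normal_patch[OF \<phi> W])
    have uU: "u \<in> \<phi> ` U" using u by blast
    have "inv_into U \<phi> u \<in> topspace M" using inv_into_into[OF uU] chart(5)[OF \<phi>] by blast
    from umbilic_everywhere[OF assms(3,4,7) this]
    have "(tr_shape (x \<circ> inv_into U \<phi>) (chart_normal U \<phi>) u)^2 = 4 * det_shape (x \<circ> inv_into U \<phi>) (chart_normal U \<phi>) u"
      by (simp add: in_chart_image[OF \<phi> uU])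
    \<comment> \<open>The criterion holds for the future-directed normal;
      \<open>shape_other_normal\<close> transfers it to \<open>\<eta>\<close>, where
      \<open>umbilic\<close> applies.\<close>
    then show ?thesis
      using P.umbilic[OF u] spacelike_patch.shape_other_normal[OF patch[OF \<phi>] P.spacelike_patch_axioms uU u] by simp
  qed
  then show ?thesis unfolding totally_umbilical_def by blast
qed

end
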